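(* Let $f:\mathbb{R}\to\mathbb{R}$ satisfy all the following conditions: (a) $f$ is continuous, strictly increasing, and $f(0)=0$; (b) $f$ is piecewise $C^1$: its derivative exists and is continuous except at a finite (possibly empty) set of points $r_1<\dots<r_n$, none of which is $0$, at each of which the limits $\lim_{r\to r_i^{\pm}}f'(r)$ exist and are finite; (c) $f'(0)>0$; (d) $\lim_{r\to-\infty}f'(r)=0$; (e) the limit $M:=\lim_{r\to+\infty}f'(r)$ exists (finite) and $M>0$. Let $\alpha,\beta,\gamma>0$, let $j,k$ be positive integers with $j$ odd, and consider the system $$\ddot y+\alpha j^4y+\psi_1(y,z)=0,\qquad \ddot z+\beta k^2z+\gamma\,\psi_2(y,z)=0, \tag{S}$$ where $$\psi_1(y,z)=\frac2\pi\int_0^\pi\big[f(y\sin jx+z\sin kx)+f(y\sin jx-z\sin kx)\big]\sin jx\,dx,$$ $$\psi_2(y,z)=\frac2\pi\int_0^\pi\big[f(y\sin jx+z\sin kx)-f(y\sin jx-z\sin kx)\big]\sin kx\,dx.$$ For $q>0$ let $u(t;q)$ be the (periodic) solution of $\ddot u+\alpha j^4u+\psi_1(u,0)=0$, $u(0)=q$, $\dot u(0)=0$, so that $(y,z)=(u(t;q),0)$ is a periodic solution of (S) (a pure flexural solution). Define the positive constants $\omega_\pm,A_\pm$ by $$\omega_\pm^2=\alpha j^4+M\Big(1\pm\frac1j\Big),\qquad A_\pm^2=\beta k^2+\gamma M(1\pm\epsilon_{j,k}),\qquad \epsilon_{j,k}=\frac1j-\frac{\tan(\pi k/j)}{k\pi},$$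 and set $$\phi_\pm=\frac{A_\pm}{\omega_\pm}\,\pi,\qquad a=\frac{A_+}{A_-}.$$ If $$\left|\cos\phi_+\cos\phi_--\frac{a+a^{-1}}2\,\sin\phi_+\sin\phi_-\right|>1,$$ then there exists $q_0$ such that, for every $q>q_0$, the pure flexural periodic solution $(u(t;q),0)$ of the nonlinear system (S) is unstable.
   Context: The quantities $1\pm\epsilon_{j,k}$ are positive, being the values (for $r>0$ and $r<0$ respectively) of $\frac4\pi\int_0^\pi H(r\sin jx)\sin^2kx\,dx$, where $H$ is the Heaviside function; hence $A_\pm>0$ are well defined. Under the hypotheses (a)-(c), $\psi_1,\psi_2$ are of class $C^1(\mathbb{R}^2)$, and $\psi_2(y,0)\equiv0$. All solutions of (S) are global and bounded. Unstable means unstable as a periodic orbit of the first-order system in the phase space of $(y,\dot y,z,\dot z)$: there is a neighbourhood $W$ of the orbit $\{(u(t;q),\dot u(t;q),0,0):t\in\mathbb{R}\}$ such that, arbitrarily close to this orbit, there are initial data whose solutions leave $W$ at some later time. *)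

theory Defs
  imports "HOL-Analysis.Analysis"
begin

definition psi1 :: "(real \<Rightarrow> real) \<Rightarrow> nat \<Rightarrow> nat \<Rightarrow> real \<Rightarrow> real \<Rightarrow> real" where
  "psi1 f j k y z = (2 / pi) * integral {0..pi} (\<lambda>x.
     (f (y * sin (real j * x) + z * sin (real k * x))
      + f (y * sin (real j * x) - z * sin (real k * x))) * sin (real j * x))"

definition psi2 :: "(real \<Rightarrow> real) \<Rightarrow> nat \<Rightarrow> nat \<Rightarrow> real \<Rightarrow> real \<Rightarrow> real" where
  "psi2 f j k y z = (2 / pi) * integral {0..pi} (\<lambda>x.
     (f (y * sin (real j * x) + z * sin (real k * x))
      - f (y * sin (real j * x) - z * sin (real k * x))) * sin (real k * x))"

text \<open>The first-order vector field, in the coordinates \<open>(y, y', z, z')\<close>, of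
  \<open>y'' + \<alpha> j^4 y + \<psi>\<^sub>1(y,z) = 0\<close>, \<open>z'' + \<beta> k^2 z + \<gamma> \<psi>\<^sub>2(y,z) = 0\<close>.\<close>

definition bridge_field ::
  "(real \<Rightarrow> real) \<Rightarrow> real \<Rightarrow> real \<Rightarrow> real \<Rightarrow> nat \<Rightarrow> nat
    \<Rightarrow> real \<times> real \<times> real \<times> real \<Rightarrow> real \<times> real \<times> real \<times> real" where
  "bridge_field f \<alpha> \<beta> \<gamma> j k = (\<lambda>(y, v, z, w).
     (v, - (\<alpha> * real j ^ 4 * y + psi1 f j k y z),
      w, - (\<beta> * (real k)\<^sup>2 * z + \<gamma> * psi2 f j k y z)))"

definition ode_solution :: "('a::real_normed_vector \<Rightarrow> 'a) \<Rightarrow> (real \<Rightarrow> 'a) \<Rightarrow> bool" where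
  "ode_solution F X \<longleftrightarrow> (\<forall>t. (X has_vector_derivative F (X t)) (at t))"

text \<open>Orbital instability. The existential over solutions \<open>Y\<close> amounts to one over initial data
  \<open>Y 0\<close> when, as for the fields considered here, initial value problems have unique
  global solutions.\<close>

definition unstable_periodic_solution ::
  "('a::real_normed_vector \<Rightarrow> 'a) \<Rightarrow> (real \<Rightarrow> 'a) \<Rightarrow> bool" where
  "unstable_periodic_solution F X \<longleftrightarrow>
     ode_solution F X \<and>
     (\<exists>T>0. \<forall>t. X (t + T) = X t) \<and>
     (\<exists>W. open W \<and> range X \<subseteq> W \<and>
        (\<forall>\<epsilon>>0. \<exists>Y. ode_solution F Y \<and> (\<exists>p\<in>range X. dist (Y 0) p < \<epsilon>) \<and>
                (\<exists>t>0. Y t \<notin> W)))"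

definition flexural_ivp ::
  "(real \<Rightarrow> real) \<Rightarrow> real \<Rightarrow> nat \<Rightarrow> nat \<Rightarrow> real \<Rightarrow> (real \<Rightarrow> real) \<Rightarrow> bool" where
  "flexural_ivp f \<alpha> j k q u \<longleftrightarrow>
     (\<forall>t. u differentiable (at t) \<and>
          (deriv u has_real_derivative - (\<alpha> * real j ^ 4 * u t + psi1 f j k (u t) 0)) (at t)) \<and>
     u 0 = q \<and> deriv u 0 = 0"

text \<open>The function \<open>u(\<sqdot>; q)\<close>. It does not depend on \<open>k\<close>, which is
  irrelevant in \<open>\<psi>\<^sub>1(y,0)\<close>.\<close>

definition flexural ::
  "(real \<Rightarrow> real) \<Rightarrow> real \<Rightarrow> nat \<Rightarrow> nat \<Rightarrow> real \<Rightarrow> real \<Rightarrow> real" where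
  "flexural f \<alpha> j k q = (THE u. flexural_ivp f \<alpha> j k q u)"

definition pure_flexural ::
  "(real \<Rightarrow> real) \<Rightarrow> real \<Rightarrow> nat \<Rightarrow> nat \<Rightarrow> real \<Rightarrow> real \<Rightarrow> real \<times> real \<times> real \<times> real" where
  "pure_flexural f \<alpha> j k q t =
     (flexural f \<alpha> j k q t, deriv (flexural f \<alpha> j k q) t, 0, 0)"

text \<open>In \<open>freq_y\<close> and \<open>freq_z\<close> the argument \<open>s\<close> is the sign
  \<open>1\<close> or \<open>-1\<close>, giving \<open>\<omega>\<^sub>\<plusminus>\<close> and \<open>A\<^sub>\<plusminus>\<close>. The tangent has no pole
  at \<open>\<pi> k / j\<close> because \<open>j\<close> will be odd.\<close>

definition eps :: "nat \<Rightarrow> nat \<Rightarrow> real" where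
  "eps j k = 1 / real j - tan (pi * real k / real j) / (real k * pi)"

definition freq_y :: "real \<Rightarrow> real \<Rightarrow> nat \<Rightarrow> real \<Rightarrow> real" where
  "freq_y \<alpha> M j s = sqrt (\<alpha> * real j ^ 4 + M * (1 + s * (1 / real j)))"

definition freq_z :: "real \<Rightarrow> real \<Rightarrow> real \<Rightarrow> nat \<Rightarrow> nat \<Rightarrow> real \<Rightarrow> real" where
  "freq_z \<beta> \<gamma> M j k s = sqrt (\<beta> * (real k)\<^sup>2 + \<gamma> * M * (1 + s * eps j k))"

definition phase ::
  "real \<Rightarrow> real \<Rightarrow> real \<Rightarrow> real \<Rightarrow> nat \<Rightarrow> nat \<Rightarrow> real \<Rightarrow> real" where
  "phase \<alpha> \<beta> \<gamma> M j k s = freq_z \<beta> \<gamma> M j k s / freq_y \<alpha> M j s * pi"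

definition amp_ratio :: "real \<Rightarrow> real \<Rightarrow> real \<Rightarrow> nat \<Rightarrow> nat \<Rightarrow> real" where
  "amp_ratio \<beta> \<gamma> M j k = freq_z \<beta> \<gamma> M j k 1 / freq_z \<beta> \<gamma> M j k (-1)"

end

theory Submission
  imports Defs
begin

text \<open>
  On the invariant plane \<open>z = z' = 0\<close> the system is the oscillator \<open>y'' + h(y) = 0\<close> with
  \<open>h(y) = \<alpha> j^4 y + \<psi>\<^sub>1(y,0)\<close>, and since \<open>\<psi>\<^sub>2(y,z)\<close> is divisible by \<open>z\<close>, say
  \<open>\<psi>\<^sub>2(y,z) = z g(y,z)\<close>, the transverse component of every solution obeys the Hill equation
  \<open>z'' + (\<beta> k^2 + \<gamma> g(y,z)) z = 0\<close>. Along the flexural orbit its coefficient is periodic, and the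
  orbit is unstable as soon as the trace \<open>\<tau>\<close> of the monodromy matrix satisfies \<open>\<bar>\<tau>\<bar> > 2\<close>.

  The hypothesis on the phases gives \<open>\<bar>\<tau>\<bar> > 2\<close> for large \<open>q\<close>. Because \<open>f'\<close> tends to \<open>M\<close> at
  \<open>+\<infinity>\<close> and to \<open>0\<close> at \<open>-\<infinity>\<close>, the quotient \<open>h(y)/y\<close> tends to the squares of \<open>\<omega>\<^sub>\<plusminus>\<close> and the Hill coefficient to
  the squares of \<open>A\<^sub>\<plusminus>\<close> as \<open>y \<rightarrow> \<plusminus>\<infinity>\<close>. After division by \<open>q\<close> a large oscillation therefore follows a
  harmonic arc of duration \<open>\<pi>/\<omega>\<^sub>+\<close> above zero and one of duration \<open>\<pi>/\<omega>\<^sub>-\<close> below, while the Hill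
  equation has the constant frequency \<open>A\<^sub>+\<close> on the first arc and \<open>A\<^sub>-\<close> on the second. The trace of
  the product of the two harmonic propagators is twice the expression in the hypothesis
  (\<open>large_amplitude_hill_trace\<close>; the averages over \<open>x\<close> that produce \<open>1/j\<close> and \<open>\<epsilon>\<close> are
  computed in \<open>has_integral_positive_sine_square\<close>).

  Leaving a neighbourhood of the whole orbit does not follow at once from the spectrum of the period
  map, because nearby solutions may drift in phase along the orbit. The remedy
  is an identity that does not see the phase: by Cayley and Hamilton every solution of the Hill
  equation, sampled from any starting time, satisfies
  \<open>\<zeta>(t + 2 T) = \<tau> \<zeta>(t + T) - \<zeta>(t)\<close> with one and the same \<open>\<tau>\<close>. A trajectory that stays in a
  thin tube around the orbit shadows, over any two periods, the orbit started at some phase, so its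
  transverse component satisfies this recurrence up to a small relative error. For \<open>\<bar>\<tau>\<bar> > 2\<close> the
  recurrence forces geometric growth, and the trajectory leaves the tube
  (\<open>unstable_of_hyperbolic_hill\<close>).

  The derivative of \<open>f\<close> may jump, so \<open>g\<close> is written as an average of symmetric difference
  quotients of \<open>f\<close>; it is continuous because for given \<open>y\<close> the points \<open>x\<close> at which
  \<open>y sin jx\<close> meets a jump form a countable set.
\<close>

section \<open>Globally Lipschitz differential equations\<close>

text \<open>
  For \<open>E = \<bar>x - y\<bar>\<^sup>2\<close> the bound \<open>2 \<bar>e\<bar> \<bar>x - y\<bar> \<le> \<bar>e\<bar>\<^sup>2 + \<bar>x - y\<bar>\<^sup>2\<close> turns the differential equations into
  \<open>E' \<le> (2 L + 1) E + \<bar>e\<bar>\<^sup>2\<close>. The error is measured in mean square, not in the supremum norm,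
  because the vector fields compared below converge only pointwise almost everywhere in time.
\<close>

lemma gronwall_perturbed:
  fixes x y e :: "real \<Rightarrow> 'a::real_inner"
  assumes ab: "a \<le> b" and L: "0 \<le> L"
    and x: "\<And>t. t \<in> {a..b} \<Longrightarrow> (x has_vector_derivative G t (x t)) (at t)"
    and y: "\<And>t. t \<in> {a..b} \<Longrightarrow> (y has_vector_derivative (G t (y t) + e t)) (at t)"
    and lip: "\<And>t. t \<in> {a..b} \<Longrightarrow> norm (G t (x t) - G t (y t)) \<le> L * norm (x t - y t)"
    and e: "continuous_on {a..b} e"
  shows "(norm (x b - y b))\<^sup>2
    \<le> exp ((2 * L + 1) * (b - a)) * ((norm (x a - y a))\<^sup>2 + integral {a..b} (\<lambda>t. (norm (e t))\<^sup>2))"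
proof -
  define K where "K = 2 * L + 1"
  define E where "E t = (x t - y t) \<bullet> (x t - y t)" for t
  define E' where "E' t = 2 * ((x t - y t) \<bullet> (G t (x t) - (G t (y t) + e t)))" for t
  define \<Phi> where "\<Phi> t = exp (- K * (t - a)) * E t - integral {a..t} (\<lambda>t. (norm (e t))\<^sup>2)" for t
  have E_deriv: "(E has_real_derivative E' t) (at t)" if "t \<in> {a..b}" for t
  proof -
    have "((\<lambda>t. x t - y t) has_derivative (\<lambda>h. h *\<^sub>R (G t (x t) - (G t (y t) + e t)))) (at t)"
      using has_vector_derivative_diff[OF x[OF that] y[OF that]]
      unfolding has_vector_derivative_def .
    from has_derivative_inner[OF this this] show ?thesis
      unfolding E_def E'_def has_field_derivative_def
      by (rule has_derivative_eq_rhs) (auto simp: inner_commute algebra_simps inner_add_left inner_diff_left inner_diff_right inner_add_right)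
  qed
  have E'_le: "E' t \<le> K * E t + (norm (e t))\<^sup>2" if "t \<in> {a..b}" for t
  proof -
    have "(x t - y t) \<bullet> (G t (x t) - G t (y t)) \<le> norm (x t - y t) * (L * norm (x t - y t))"
      by (rule order_trans[OF norm_cauchy_schwarz]) (intro mult_left_mono lip that; simp)
    moreover have "(x t - y t) \<bullet> (- e t) \<le> norm (x t - y t) * norm (e t)"
      using norm_cauchy_schwarz[of "x t - y t" "- e t"] by simp
    moreover have "2 * (norm (x t - y t) * norm (e t)) \<le> (norm (x t - y t))\<^sup>2 + (norm (e t))\<^sup>2"
      using sum_squares_bound[of "norm (x t - y t)" "norm (e t)"] by (simp add: mult.assoc)
    moreover have "E' t = 2 * ((x t - y t) \<bullet> (G t (x t) - G t (y t))) + 2 * ((x t - y t) \<bullet> (- e t))"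
      unfolding E'_def by (simp add: inner_diff_right inner_add_right algebra_simps)
    ultimately have "E' t \<le> 2 * (norm (x t - y t) * (L * norm (x t - y t)))
        + ((norm (x t - y t))\<^sup>2 + (norm (e t))\<^sup>2)"
      by linarith
    also have "\<dots> = K * E t + (norm (e t))\<^sup>2"
      unfolding K_def E_def dot_square_norm by (simp add: algebra_simps power2_eq_square)
    finally show ?thesis .
  qed
  have ce: "continuous_on {a..b} (\<lambda>t. (norm (e t))\<^sup>2)"
    by (intro continuous_intros e)
  have "\<exists>t\<in>{a..b}. \<Phi> b - \<Phi> a =
      (\<lambda>h. (exp (- K * (t - a)) * (E' t - K * E t) - (norm (e t))\<^sup>2) * h) (b - a)"
  proof (rule mvt_very_simple[OF ab])
    fix t assume t: "a \<le> t" "t \<le> b"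
    have "(\<Phi> has_real_derivative (exp (- K * (t - a)) * (E' t - K * E t) - (norm (e t))\<^sup>2))
        (at t within {a..b})"
    proof -
      have 1: "((\<lambda>t. integral {a..t} (\<lambda>t. (norm (e t))\<^sup>2)) has_real_derivative (norm (e t))\<^sup>2)
          (at t within {a..b})"
        using integral_has_real_derivative[OF ce, of t] t by simp
      have 2: "(E has_real_derivative E' t) (at t within {a..b})"
        using E_deriv[of t] t by (simp add: has_field_derivative_at_within)
      show ?thesis unfolding \<Phi>_def
        by (rule derivative_eq_intros 1 2 refl | simp)+ (simp add: algebra_simps)
    qed
    then show "(\<Phi> has_derivative (\<lambda>h. (exp (- K * (t - a)) * (E' t - K * E t) - (norm (e t))\<^sup>2) * h))
        (at t within {a..b})"
      by (simp add: has_field_derivative_def)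
  qed
  then obtain t where t: "t \<in> {a..b}" and eq: "\<Phi> b - \<Phi> a =
      (exp (- K * (t - a)) * (E' t - K * E t) - (norm (e t))\<^sup>2) * (b - a)" by blast
  have "0 \<le> K" using L by (simp add: K_def)
  have "exp (- K * (t - a)) * (E' t - K * E t) \<le> exp (- K * (t - a)) * (norm (e t))\<^sup>2"
    using E'_le[OF t] by (intro mult_left_mono) auto
  also have "\<dots> \<le> 1 * (norm (e t))\<^sup>2"
    using t mult_nonneg_nonneg[OF \<open>0 \<le> K\<close>, of "t - a"] by (intro mult_right_mono) auto
  finally have "\<Phi> b \<le> \<Phi> a"
    using eq ab mult_nonpos_nonneg[of "exp (- K * (t - a)) * (E' t - K * E t) - (norm (e t))\<^sup>2" "b - a"]
    by simp
  then have "exp (- K * (b - a)) * E b \<le> E a + integral {a..b} (\<lambda>t. (norm (e t))\<^sup>2)"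
    by (simp add: \<Phi>_def)
  then have "exp (K * (b - a)) * (exp (- K * (b - a)) * E b)
      \<le> exp (K * (b - a)) * (E a + integral {a..b} (\<lambda>t. (norm (e t))\<^sup>2))"
    by (intro mult_left_mono) auto
  moreover have "exp (K * (b - a)) * (exp (- K * (b - a)) * E b) = E b"
    by (simp add: mult.assoc[symmetric] exp_add[symmetric])
  ultimately have "E b \<le> exp (K * (b - a)) * (E a + integral {a..b} (\<lambda>t. (norm (e t))\<^sup>2))"
    by linarith
  then show ?thesis
    by (simp add: E_def K_def dot_square_norm)
qed

definition solves :: "(real \<Rightarrow> 'a::real_normed_vector \<Rightarrow> 'a) \<Rightarrow> (real \<Rightarrow> 'a) \<Rightarrow> bool" where
  "solves G x \<longleftrightarrow> (\<forall>t. (x has_vector_derivative G t (x t)) (at t))"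

lemma solvesD: "solves G x \<Longrightarrow> (x has_vector_derivative G t (x t)) (at t)"
  by (simp add: solves_def)

lemma solves_shift:
  assumes "solves G x"
  shows "solves (\<lambda>t. G (t + s)) (\<lambda>t. x (t + s))"
  unfolding solves_def
proof
  fix t
  show "((\<lambda>t. x (t + s)) has_vector_derivative G (t + s) (x (t + s))) (at t)"
  proof -
    have "((\<lambda>t. t + s) has_vector_derivative 1) (at t)"
      by (auto intro!: derivative_eq_intros)
    from vector_diff_chain_at[OF this solvesD[OF assms]] show ?thesis
      by (simp add: o_def)
  qed
qed

lemma solves_reverse:
  assumes "solves G x"
  shows "solves (\<lambda>t y. - G (s - t) y) (\<lambda>t. x (s - t))"
  unfolding solves_def
proof
  fix t
  show "((\<lambda>t. x (s - t)) has_vector_derivative - G (s - t) (x (s - t))) (at t)"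
  proof -
    have "((\<lambda>t. s - t) has_vector_derivative - 1) (at t)"
      by (auto intro!: derivative_eq_intros)
    from vector_diff_chain_at[OF this solvesD[OF assms]] show ?thesis
      by (simp add: o_def)
  qed
qed

text \<open>
  Gronwall with zero error forwards in time; reversing time gives the other direction.
\<close>

lemma solution_growth:
  fixes x y :: "real \<Rightarrow> 'a::real_inner"
  assumes L: "0 \<le> L" and lip: "\<And>t u v. norm (G t u - G t v) \<le> L * norm (u - v)"
    and x: "solves G x" and y: "solves G y"
  shows "norm (x t - y t) \<le> exp ((L + 1) * \<bar>t - s\<bar>) * norm (x s - y s)"
proof -
  have fwd: "norm (x t - y t) \<le> exp ((L + 1) * (t - s)) * norm (x s - y s)"
    if "s \<le> t" and lip: "\<And>t u v. norm (G t u - G t v) \<le> L * norm (u - v)"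
      and x: "solves G x" and y: "solves G y" for x y :: "real \<Rightarrow> 'a" and G s t
  proof -
    have "(norm (x t - y t))\<^sup>2
      \<le> exp ((2 * L + 1) * (t - s)) * ((norm (x s - y s))\<^sup>2 + integral {s..t} (\<lambda>t. (norm (0::'a))\<^sup>2))"
      using solvesD[OF x] solvesD[OF y]
      by (intro gronwall_perturbed[where G = G] that L) auto
    also have "\<dots> = exp ((2 * L + 1) * (t - s)) * (norm (x s - y s))\<^sup>2"
      by simp
    also have "\<dots> \<le> exp ((L + 1) * (t - s) + (L + 1) * (t - s)) * (norm (x s - y s))\<^sup>2"
      using L \<open>s \<le> t\<close> by (intro mult_right_mono) (auto simp: algebra_simps)
    also have "\<dots> = (exp ((L + 1) * (t - s)) * norm (x s - y s))\<^sup>2"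
      by (simp only: exp_add power2_eq_square mult_ac)
    finally show ?thesis
      by (rule power2_le_imp_le) simp
  qed
  show ?thesis
  proof (cases "s \<le> t")
    case True
    then show ?thesis using fwd[OF True lip x y] by simp
  next
    case False
    have "norm (x (0 - (- t)) - y (0 - (- t)))
        \<le> exp ((L + 1) * (- t - (- s))) * norm (x (0 - (- s)) - y (0 - (- s)))"
    proof (rule fwd[OF _ _ solves_reverse[OF x] solves_reverse[OF y]])
      fix t u v
      show "norm (- G (0 - t) u - - G (0 - t) v) \<le> L * norm (u - v)"
        using lip[of "-t" u v] by (simp add: norm_minus_commute)
    qed (use False in simp)
    then show ?thesis using False by simp
  qed
qed

lemma solution_unique:
  fixes x y :: "real \<Rightarrow> 'a::real_inner"
  assumes "0 \<le> L" and "\<And>t u v. norm (G t u - G t v) \<le> L * norm (u - v)"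
    and "solves G x" and "solves G y" and "x s = y s"
  shows "x t = y t"
  using solution_growth[OF assms(1-4), of t s] assms(5) by simp

lemma continuous_antiderivative:
  fixes g :: "real \<Rightarrow> 'a::euclidean_space"
  assumes "continuous_on UNIV g"
  obtains J where "J 0 = 0" and "\<And>t. (J has_vector_derivative g t) (at t)"
proof -
  define J where "J t = (LBINT s=ereal 0..ereal t. g s)" for t
  have "(J has_vector_derivative g t) (at t)" for t
  proof -
    have "(J has_vector_derivative g t) (at t within {-\<bar>t\<bar>-1..\<bar>t\<bar>+1})"
      unfolding J_def
      by (intro interval_integral_FTC2 continuous_on_subset[OF assms]) auto
    then have "(J has_vector_derivative g t) (at t within {-\<bar>t\<bar>-1<..<\<bar>t\<bar>+1})"
      by (rule has_vector_derivative_within_subset) auto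
    then show ?thesis
      by (subst (asm) at_within_open) auto
  qed
  moreover have "J 0 = 0" by (simp add: J_def)
  ultimately show ?thesis using that by blast
qed

text \<open>
  Against the weight \<open>exp (L \<bar>t\<bar>)\<close>, integration gains a factor \<open>1/L\<close>. This gain makes the Picard
  map a contraction on the whole real line at once.
\<close>

lemma antiderivative_exp_bound:
  fixes J :: "real \<Rightarrow> 'a::real_normed_vector"
  assumes J0: "J 0 = 0" and J: "\<And>t. (J has_vector_derivative g t) (at t)"
    and B: "0 \<le> B" and L: "0 < L" and g: "\<And>t. norm (g t) \<le> B * exp (L * \<bar>t\<bar>)"
  shows "norm (J t) \<le> B / L * exp (L * \<bar>t\<bar>)"
proof -
  have fwd: "norm (J t) \<le> B / L * exp (L * t)"
    if J0: "J 0 = 0" and J: "\<And>t. (J has_vector_derivative g t) (at t)"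
    and g: "\<And>t. norm (g t) \<le> B * exp (L * \<bar>t\<bar>)" and t: "0 \<le> t" for J g :: "real \<Rightarrow> 'a" and t
  proof (cases "t = 0")
    case True
    then show ?thesis using J0 B L by simp
  next
    case False
    then have "0 < t" using t by simp
    then have "norm (J t - J 0) \<le> B / L * exp (L * t) - B / L * exp (L * 0)"
    proof (rule differentiable_bound_general[where f' = g and \<phi>' = "\<lambda>t. B * exp (L * t)"])
      show "continuous_on {0..t} J"
        by (meson J continuous_at_imp_continuous_on has_vector_derivative_continuous)
      show "continuous_on {0..t} (\<lambda>a. B / L * exp (L * a))"
        by (intro continuous_intros)
    next
      fix s :: real assume "0 < s" "s < t"
      show "(J has_vector_derivative g s) (at s)" by (rule J)
      show "((\<lambda>a. B / L * exp (L * a)) has_vector_derivative B * exp (L * s)) (at s)"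
        unfolding has_real_derivative_iff_has_vector_derivative[symmetric]
        using L by (auto intro!: derivative_eq_intros)
      show "norm (g s) \<le> B * exp (L * s)" using g[of s] \<open>0 < s\<close> by simp
    qed
    also have "\<dots> \<le> B / L * exp (L * t)" using B L by simp
    finally show ?thesis using J0 by simp
  qed
  show ?thesis
  proof (cases "0 \<le> t")
    case True
    then show ?thesis using fwd[OF J0 J g] by simp
  next
    case False
    have "norm ((\<lambda>t. J (0 - t)) (- t)) \<le> B / L * exp (L * - t)"
    proof (rule fwd[where g = "\<lambda>t. - g (0 - t)"])
      have "solves (\<lambda>t _. g t) J" using J by (simp add: solves_def)
      from solves_reverse[OF this, of 0]
      show "((\<lambda>t. J (0 - t)) has_vector_derivative - g (0 - t)) (at t)" for t
        by (simp add: solves_def)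
      show "norm (- g (0 - t)) \<le> B * exp (L * \<bar>t\<bar>)" for t using g[of "-t"] by simp
    qed (use J0 False in auto)
    then show ?thesis using False by simp
  qed
qed

text \<open>
  The Picard map contracts by \<open>1/2\<close> in the norm \<open>sup exp (- 2 L \<bar>t\<bar>) \<bar>x(t)\<bar>\<close>. Writing
  \<open>x = w \<phi>\<close> with \<open>w(t) = exp (2 L \<bar>t\<bar>)\<close> transports this norm to the supremum norm of the Banach
  space of bounded continuous functions, so one fixed point argument yields a global solution.
\<close>

lemma lipschitz_ivp_at_0:
  fixes G :: "real \<Rightarrow> 'a::euclidean_space \<Rightarrow> 'a"
  assumes L: "0 < L" and lip: "\<And>t u v. norm (G t u - G t v) \<le> L * norm (u - v)"
    and cont: "continuous_on UNIV (\<lambda>(t, u). G t u)"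
    and bound: "\<And>t. norm (G t 0) \<le> K"
  shows "\<exists>x. solves G x \<and> x 0 = x0"
proof -
  define w where "w t = exp (2 * L * \<bar>t\<bar>)" for t :: real
  have w_pos: "0 < w t" and w_ge1: "1 \<le> w t" for t
    using L by (auto simp: w_def)
  have w_cont: "continuous_on UNIV w"
    unfolding w_def by (intro continuous_intros)
  have K: "0 \<le> K" using bound[of 0] norm_ge_zero order_trans by blast
  have g_cont: "continuous_on UNIV (\<lambda>t. G t (w t *\<^sub>R apply_bcontfun \<phi> t))" for \<phi>
    using continuous_on_compose2[OF cont, of UNIV "\<lambda>t. (t, w t *\<^sub>R apply_bcontfun \<phi> t)"]
    by (simp add: continuous_intros w_cont)
  have "\<exists>J. J 0 = 0 \<and> (\<forall>t. (J has_vector_derivative G t (w t *\<^sub>R apply_bcontfun \<phi> t)) (at t))"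
    for \<phi>
    using continuous_antiderivative[OF g_cont[of \<phi>]] by metis
  then obtain J where J0: "J \<phi> 0 = 0"
    and J: "(J \<phi> has_vector_derivative G t (w t *\<^sub>R apply_bcontfun \<phi> t)) (at t)" for \<phi> t
    by metis
  have J_cont: "continuous_on UNIV (J \<phi>)" for \<phi>
    by (meson J continuous_at_imp_continuous_on has_vector_derivative_continuous)
  have J_bound: "norm (J \<phi> t) \<le> (K + L * norm \<phi>) / (2 * L) * w t" for \<phi> t
    unfolding w_def
  proof (rule antiderivative_exp_bound[OF J0 J])
    fix t
    have "norm (G t (w t *\<^sub>R apply_bcontfun \<phi> t))
        \<le> norm (G t 0) + L * norm (w t *\<^sub>R apply_bcontfun \<phi> t)"
      using lip[of t "w t *\<^sub>R apply_bcontfun \<phi> t" 0]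
        norm_triangle_ineq2[of "G t (w t *\<^sub>R apply_bcontfun \<phi> t)" "G t 0"] by simp
    also have "\<dots> \<le> K * w t + L * (w t * norm \<phi>)"
      using bound[of t] w_ge1[of t] w_pos[of t] L norm_bounded[of \<phi> t] K
      by (intro add_mono mult_left_mono) (auto intro: order_trans[of _ "K * 1"] mult_left_mono)
    finally show "norm (G t (w t *\<^sub>R apply_bcontfun \<phi> t)) \<le> (K + L * norm \<phi>) * exp (2 * L * \<bar>t\<bar>)"
      by (simp add: w_def algebra_simps)
  qed (use K L in auto)
  have J_diff: "norm (J \<phi> t - J \<psi> t) \<le> dist \<phi> \<psi> / 2 * w t" for \<phi> \<psi> t
  proof -
    have "norm (J \<phi> t - J \<psi> t) \<le> (L * dist \<phi> \<psi>) / (2 * L) * exp (2 * L * \<bar>t\<bar>)"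
    proof (rule antiderivative_exp_bound[where J = "\<lambda>t. J \<phi> t - J \<psi> t"])
      fix t
      have "norm (G t (w t *\<^sub>R apply_bcontfun \<phi> t) - G t (w t *\<^sub>R apply_bcontfun \<psi> t))
          \<le> L * norm (w t *\<^sub>R (apply_bcontfun \<phi> t - apply_bcontfun \<psi> t))"
        using lip by (simp add: scaleR_diff_right)
      also have "\<dots> = L * (w t * dist (apply_bcontfun \<phi> t) (apply_bcontfun \<psi> t))"
        using w_pos[of t] by (simp add: dist_norm)
      also have "\<dots> \<le> L * (w t * dist \<phi> \<psi>)"
        using L w_pos[of t] dist_bounded[of \<phi> t \<psi>] by (intro mult_left_mono) auto
      finally show "norm (G t (w t *\<^sub>R apply_bcontfun \<phi> t) - G t (w t *\<^sub>R apply_bcontfun \<psi> t))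
          \<le> L * dist \<phi> \<psi> * exp (2 * L * \<bar>t\<bar>)"
        by (simp add: w_def algebra_simps)
    qed (use J0 J L in \<open>auto intro: has_vector_derivative_diff\<close>)
    then show ?thesis using L by (simp add: w_def)
  qed
  define S where "S \<phi> = Bcontfun (\<lambda>t. (1 / w t) *\<^sub>R (x0 + J \<phi> t))" for \<phi>
  have S: "apply_bcontfun (S \<phi>) t = (1 / w t) *\<^sub>R (x0 + J \<phi> t)" for \<phi> t
  proof -
    have "(\<lambda>t. (1 / w t) *\<^sub>R (x0 + J \<phi> t)) \<in> bcontfun"
    proof (rule bcontfun_normI)
      show "continuous_on UNIV (\<lambda>t. (1 / w t) *\<^sub>R (x0 + J \<phi> t))"
        using w_pos by (intro continuous_intros J_cont w_cont) (auto simp: less_imp_neq[symmetric])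
      fix t
      have "norm (x0 + J \<phi> t) \<le> norm x0 * w t + (K + L * norm \<phi>) / (2 * L) * w t"
        using w_ge1[of t] J_bound[of \<phi> t] mult_left_mono[OF w_ge1[of t], of "norm x0"]
        by (intro order_trans[OF norm_triangle_ineq] add_mono) auto
      also have "\<dots> = w t * (norm x0 + (K + L * norm \<phi>) / (2 * L))"
        by (simp add: algebra_simps)
      finally show "norm ((1 / w t) *\<^sub>R (x0 + J \<phi> t)) \<le> norm x0 + (K + L * norm \<phi>) / (2 * L)"
        using w_pos[of t] by (simp add: divide_le_eq mult.commute)
    qed
    then show ?thesis unfolding S_def by (simp add: Bcontfun_inverse)
  qed
  have "\<exists>!\<phi>. S \<phi> = \<phi>"
  proof (rule banach_fix_type[where c = "1/2"])
    show "\<forall>\<phi> \<psi>. dist (S \<phi>) (S \<psi>) \<le> 1/2 * dist \<phi> \<psi>"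
    proof (intro allI)
      fix \<phi> \<psi> :: "real \<Rightarrow>\<^sub>C 'a"
      show "dist (S \<phi>) (S \<psi>) \<le> 1/2 * dist \<phi> \<psi>"
      proof (rule dist_bound)
        fix t
        have "dist (apply_bcontfun (S \<phi>) t) (apply_bcontfun (S \<psi>) t) = norm (J \<phi> t - J \<psi> t) / w t"
          using w_pos[of t] by (simp add: S dist_norm scaleR_diff_right[symmetric])
        also have "\<dots> \<le> 1/2 * dist \<phi> \<psi>"
          using J_diff[of \<phi> t \<psi>] w_pos[of t] by (simp add: divide_le_eq)
        finally show "dist (apply_bcontfun (S \<phi>) t) (apply_bcontfun (S \<psi>) t) \<le> 1/2 * dist \<phi> \<psi>" .
      qed
    qed
  qed auto
  then obtain \<phi> where \<phi>: "S \<phi> = \<phi>" by blast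
  define x where "x t = x0 + J \<phi> t" for t
  have x: "x t = w t *\<^sub>R apply_bcontfun \<phi> t" for t
    using S[of \<phi> t] w_pos[of t] by (simp add: \<phi> x_def)
  have "solves G x"
    unfolding solves_def
  proof
    fix t
    have "(x has_vector_derivative 0 + G t (w t *\<^sub>R apply_bcontfun \<phi> t)) (at t)"
      unfolding x_def by (intro has_vector_derivative_add J has_vector_derivative_const)
    then show "(x has_vector_derivative G t (x t)) (at t)" by (simp add: x)
  qed
  moreover have "x 0 = x0" by (simp add: x_def J0)
  ultimately show ?thesis by blast
qed

lemma lipschitz_ivp:
  fixes G :: "real \<Rightarrow> 'a::euclidean_space \<Rightarrow> 'a"
  assumes lip: "\<And>t u v. norm (G t u - G t v) \<le> L * norm (u - v)"
    and cont: "continuous_on UNIV (\<lambda>(t, u). G t u)"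
    and bound: "\<And>t. norm (G t 0) \<le> K"
  obtains x where "solves G x" "x s = x0"
proof -
  have "\<exists>x. solves (\<lambda>t. G (t + s)) x \<and> x 0 = x0"
  proof (rule lipschitz_ivp_at_0[where L = "\<bar>L\<bar> + 1"])
    show "norm (G (t + s) u - G (t + s) v) \<le> (\<bar>L\<bar> + 1) * norm (u - v)" for t u v
      by (rule order_trans[OF lip mult_right_mono]) auto
    have "continuous_on UNIV ((\<lambda>(t, u). G t u) \<circ> (\<lambda>p. (fst p + s, snd p)))"
      by (intro continuous_on_compose continuous_on_subset[OF cont] continuous_intros) auto
    then show "continuous_on UNIV (\<lambda>(t, u). G (t + s) u)"
      by (simp add: o_def split_def)
  qed (use bound in auto)
  then obtain x where x: "solves (\<lambda>t. G (t + s)) x" "x 0 = x0" by blast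
  have "solves G (\<lambda>t. x (t + - s))" using solves_shift[OF x(1), of "-s"] by simp
  with that[of "\<lambda>t. x (t + - s)"] show thesis using x(2) by simp
qed

section \<open>Hill's equation\<close>

text \<open>
  The first-order form of \<open>z'' + P(t) z = 0\<close>.
\<close>

definition hill :: "(real \<Rightarrow> real) \<Rightarrow> real \<Rightarrow> real \<times> real \<Rightarrow> real \<times> real" where
  "hill P t \<zeta> = (snd \<zeta>, - P t * fst \<zeta>)"

lemma norm_planar_le:
  fixes d :: "real \<times> real"
  shows "\<bar>fst d\<bar> \<le> norm d" and "\<bar>snd d\<bar> \<le> norm d" and "norm d \<le> \<bar>fst d\<bar> + \<bar>snd d\<bar>"
  using norm_fst_le[of "fst d" "snd d"] norm_snd_le[of "snd d" "fst d"]
    norm_Pair_le[of "fst d" "snd d"] by auto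

lemma hill_diff: "hill P t u - hill P t v = hill P t (u - v)"
  by (simp add: hill_def prod_eq_iff algebra_simps)

lemma norm_hill_le:
  assumes "\<bar>P t\<bar> \<le> K"
  shows "norm (hill P t \<zeta>) \<le> (1 + K) * norm \<zeta>"
proof -
  have "norm (hill P t \<zeta>) \<le> \<bar>snd \<zeta>\<bar> + \<bar>P t\<bar> * \<bar>fst \<zeta>\<bar>"
    using norm_planar_le(3)[of "hill P t \<zeta>"] by (simp add: hill_def abs_mult)
  also have "\<dots> \<le> norm \<zeta> + K * norm \<zeta>"
    using assms by (intro add_mono mult_mono norm_planar_le) auto
  finally show ?thesis by (simp add: algebra_simps)
qed

lemma hill_lipschitz:
  assumes "\<bar>P t\<bar> \<le> K"
  shows "norm (hill P t u - hill P t v) \<le> (1 + K) * norm (u - v)"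
  unfolding hill_diff using norm_hill_le[where P = P, OF assms] .

lemma continuous_on_hill:
  assumes "continuous_on UNIV P"
  shows "continuous_on UNIV (\<lambda>(t, u). hill P t u)"
proof -
  have "continuous_on UNIV (\<lambda>x::real \<times> real \<times> real. P (fst x))"
    by (rule continuous_on_compose2[OF assms]) (auto intro: continuous_intros)
  then show ?thesis
    unfolding hill_def split_def by (intro continuous_intros)
qed

lemma hill_ivp:
  assumes "continuous_on UNIV P" and "\<And>t. \<bar>P t\<bar> \<le> K"
  obtains \<zeta> where "solves (hill P) \<zeta>" "\<zeta> s = \<zeta>0"
proof (rule lipschitz_ivp[where G = "hill P" and L = "1 + K" and K = 0])
  show "norm (hill P t 0) \<le> 0" for t by (simp add: hill_def)
qed (auto intro: hill_lipschitz continuous_on_hill assms that)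

lemma hill_combination:
  assumes "solves (hill P) \<zeta>" and "solves (hill P) \<xi>"
  shows "solves (hill P) (\<lambda>t. a *\<^sub>R \<zeta> t + b *\<^sub>R \<xi> t)"
  unfolding solves_def
proof
  fix t
  have "((\<lambda>t. a *\<^sub>R \<zeta> t + b *\<^sub>R \<xi> t) has_vector_derivative
      (a *\<^sub>R hill P t (\<zeta> t) + b *\<^sub>R hill P t (\<xi> t))) (at t)"
    using bounded_linear.has_vector_derivative[OF bounded_linear_scaleR_right solvesD[OF assms(1)], of a t]
      bounded_linear.has_vector_derivative[OF bounded_linear_scaleR_right solvesD[OF assms(2)], of b t]
    by (rule has_vector_derivative_add)
  moreover have "a *\<^sub>R hill P t (\<zeta> t) + b *\<^sub>R hill P t (\<xi> t) = hill P t (a *\<^sub>R \<zeta> t + b *\<^sub>R \<xi> t)"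
    by (simp add: hill_def algebra_simps)
  ultimately show "((\<lambda>t. a *\<^sub>R \<zeta> t + b *\<^sub>R \<xi> t) has_vector_derivative
      hill P t (a *\<^sub>R \<zeta> t + b *\<^sub>R \<xi> t)) (at t)" by simp
qed

lemma hill_components:
  assumes "solves (hill P) \<zeta>"
  shows "((\<lambda>t. fst (\<zeta> t)) has_real_derivative snd (\<zeta> t)) (at t)"
    and "((\<lambda>t. snd (\<zeta> t)) has_real_derivative - P t * fst (\<zeta> t)) (at t)"
  using bounded_linear.has_vector_derivative[OF bounded_linear_fst solvesD[OF assms], of t]
    bounded_linear.has_vector_derivative[OF bounded_linear_snd solvesD[OF assms], of t]
  by (simp_all add: hill_def has_real_derivative_iff_has_vector_derivative)

lemma hill_growth:
  assumes K: "\<And>t. \<bar>P t\<bar> \<le> K" and \<zeta>: "solves (hill P) \<zeta>"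
  shows "norm (\<zeta> t) \<le> exp ((2 + K) * \<bar>t - s\<bar>) * norm (\<zeta> s)"
proof -
  have K0: "0 \<le> K" using K[of 0] by linarith
  have "solves (hill P) (\<lambda>_. 0)"
    by (auto simp: solves_def hill_def zero_prod_def[symmetric])
  from solution_growth[OF _ _ \<zeta> this, of "1 + K" t s] show ?thesis
    using K0 hill_lipschitz[where P = P, OF K] by (simp add: algebra_simps)
qed

lemma hill_unique:
  assumes "\<And>t. \<bar>P t\<bar> \<le> K" and "solves (hill P) \<zeta>" and "solves (hill P) \<xi>" and "\<zeta> s = \<xi> s"
  shows "\<zeta> t = \<xi> t"
proof (rule solution_unique[OF _ _ assms(2-4)])
  show "0 \<le> 1 + K" using assms(1)[of 0] by linarith
qed (use hill_lipschitz[where P = P, OF assms(1)] in auto)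

lemma hill_wronskian:
  assumes \<zeta>: "solves (hill P) \<zeta>" and \<xi>: "solves (hill P) \<xi>"
  shows "fst (\<zeta> t) * snd (\<xi> t) - snd (\<zeta> t) * fst (\<xi> t)
    = fst (\<zeta> s) * snd (\<xi> s) - snd (\<zeta> s) * fst (\<xi> s)"
proof -
  have "((\<lambda>t. fst (\<zeta> t) * snd (\<xi> t) - snd (\<zeta> t) * fst (\<xi> t)) has_real_derivative 0) (at t)" for t
    by (rule derivative_eq_intros hill_components[OF \<zeta>] hill_components[OF \<xi>] refl)+ simp
  then show ?thesis
    using DERIV_isconst_all by blast
qed

text \<open>
  The monodromy matrix has determinant one by the Wronskian identity, so Cayley and Hamilton give
  the recurrence at the base point \<open>s\<close>. The difference of its two sides is again a solution, hence
  vanishes at all times: the trace computed at one phase governs the samples at every phase.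
\<close>

lemma hill_period_recurrence:
  assumes K: "\<And>t. \<bar>P t\<bar> \<le> K" and per: "\<And>t. P (t + T) = P t"
    and \<zeta>1: "solves (hill P) \<zeta>1" "\<zeta>1 s = (1, 0)"
    and \<zeta>2: "solves (hill P) \<zeta>2" "\<zeta>2 s = (0, 1)"
    and \<zeta>: "solves (hill P) \<zeta>"
  defines "\<tau> \<equiv> fst (\<zeta>1 (s + T)) + snd (\<zeta>2 (s + T))"
  shows "\<zeta> (t + 2 * T) = \<tau> *\<^sub>R \<zeta> (t + T) - \<zeta> t"
proof -
  have shift: "solves (hill P) (\<lambda>t. \<xi> (t + T))" if "solves (hill P) \<xi>" for \<xi>
  proof -
    have "(\<lambda>t. hill P (t + T)) = hill P" by (simp add: hill_def per fun_eq_iff)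
    then show ?thesis using solves_shift[OF that, of T] by simp
  qed
  have rep: "\<xi> t = fst (\<xi> s) *\<^sub>R \<zeta>1 t + snd (\<xi> s) *\<^sub>R \<zeta>2 t" if "solves (hill P) \<xi>" for \<xi> t
    by (rule hill_unique[OF K that hill_combination[OF \<zeta>1(1) \<zeta>2(1)], where s = s])
      (simp add: \<zeta>1 \<zeta>2 prod_eq_iff)
  have det: "fst (\<zeta>1 (s + T)) * snd (\<zeta>2 (s + T)) - snd (\<zeta>1 (s + T)) * fst (\<zeta>2 (s + T)) = 1"
    using hill_wronskian[OF \<zeta>1(1) \<zeta>2(1), of "s + T" s] by (simp add: \<zeta>1 \<zeta>2)
  \<comment> \<open>The unit factors present \<open>D\<close> as a nested instance of \<open>hill_combination\<close>.\<close>
  define D where "D t = 1 *\<^sub>R \<zeta> (t + T + T) + 1 *\<^sub>R ((- \<tau>) *\<^sub>R \<zeta> (t + T) + 1 *\<^sub>R \<zeta> t)" for t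
  have "solves (hill P) D"
    unfolding D_def by (intro hill_combination shift \<zeta> shift[OF shift, OF \<zeta>, simplified])
  moreover have "solves (hill P) (\<lambda>_. 0)"
    by (auto simp: solves_def hill_def zero_prod_def[symmetric])
  moreover have "D s = 0"
  proof -
    have 1: "\<zeta> (s + T) = fst (\<zeta> s) *\<^sub>R \<zeta>1 (s + T) + snd (\<zeta> s) *\<^sub>R \<zeta>2 (s + T)"
      by (rule rep[OF \<zeta>])
    have 2: "\<zeta> (s + T + T) = fst (\<zeta> (s + T)) *\<^sub>R \<zeta>1 (s + T) + snd (\<zeta> (s + T)) *\<^sub>R \<zeta>2 (s + T)"
      using rep[OF shift[OF \<zeta>], of "s + T"] by simp
    obtain a c b d where M: "\<zeta>1 (s + T) = (a, c)" "\<zeta>2 (s + T) = (b, d)" by (metis surj_pair)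
    obtain p q where z: "\<zeta> s = (p, q)" by (metis surj_pair)
    have det': "a * d - c * b = 1" using det by (simp add: M)
    have "(p * a + q * b) * a + (p * c + q * d) * b - (a + d) * (p * a + q * b) + p
        = p * (1 - (a * d - c * b))" by (simp add: algebra_simps)
    moreover have "(p * a + q * b) * c + (p * c + q * d) * d - (a + d) * (p * c + q * d) + q
        = q * (1 - (a * d - c * b))" by (simp add: algebra_simps)
    ultimately have "D s = (p * (1 - (a * d - c * b)), q * (1 - (a * d - c * b)))"
      unfolding D_def 2 1 \<tau>_def M z by (simp add: prod_eq_iff algebra_simps)
    then show ?thesis using det' by (simp add: prod_eq_iff)
  qed
  ultimately have "D t = 0"
    by (rule hill_unique[where P = P and \<zeta> = D and \<xi> = "\<lambda>_. 0" and s = s, OF K])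
  then have "\<zeta> (t + T + T) = \<tau> *\<^sub>R \<zeta> (t + T) - \<zeta> t"
    unfolding D_def eq_neg_iff_add_eq_0[symmetric] by simp
  moreover have "t + 2 * T = t + T + T" by simp
  ultimately show ?thesis by (simp only:)
qed

section \<open>Escape from an orbit with hyperbolic transverse Hill equation\<close>

text \<open>
  Writing the second force as \<open>Q(y,z) z\<close> makes the plane \<open>z = w = 0\<close> visibly invariant and displays
  the coefficient of the Hill equation along it.
\<close>

definition second_order_pair ::
  "(real \<Rightarrow> real \<Rightarrow> real) \<Rightarrow> (real \<Rightarrow> real \<Rightarrow> real)
    \<Rightarrow> real \<times> real \<times> real \<times> real \<Rightarrow> real \<times> real \<times> real \<times> real" where
  "second_order_pair H Q = (\<lambda>(y, v, z, w). (v, - H y z, w, - Q y z * z))"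

definition transverse :: "real \<times> real \<times> real \<times> real \<Rightarrow> real \<times> real" where
  "transverse p = snd (snd p)"

lemma bounded_linear_transverse: "bounded_linear transverse"
  unfolding transverse_def
  by (intro bounded_linear_compose[OF bounded_linear_snd bounded_linear_snd])

lemma norm_transverse_le: "norm (transverse p) \<le> norm p"
proof -
  obtain y v q where "p = (y, v, q)" by (metis surj_pair)
  then show ?thesis
    using norm_snd_le[of "(v, q)" y] norm_snd_le[of q v] by (simp add: transverse_def)
qed

lemma dist_outer_le:
  "dist (fst p, fst (transverse p)) (fst p', fst (transverse p')) \<le> dist p p'"
proof -
  obtain y v z w y' v' z' w' where "p = (y, v, z, w)" "p' = (y', v', z', w')"
    by (metis surj_pair)
  then show ?thesis
    by (simp add: dist_Pair_Pair transverse_def real_sqrt_le_iff)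
qed

text \<open>
  This holds exactly and arbitrarily far from the invariant plane: the transverse component solves a
  linear equation whose coefficient is read off from the trajectory itself. Linearisation
  is thereby replaced by a comparison of two coefficients.
\<close>

lemma solves_transverse:
  assumes "solves (\<lambda>_. second_order_pair H Q) Y"
  shows "solves (hill (\<lambda>t. Q (fst (Y t)) (fst (transverse (Y t))))) (\<lambda>t. transverse (Y t))"
  unfolding solves_def
proof
  fix t
  have "((\<lambda>t. transverse (Y t)) has_vector_derivative transverse (second_order_pair H Q (Y t))) (at t)"
    by (rule bounded_linear.has_vector_derivative[OF bounded_linear_transverse solvesD[OF assms]])
  also have "transverse (second_order_pair H Q (Y t))
      = hill (\<lambda>t. Q (fst (Y t)) (fst (transverse (Y t)))) t (transverse (Y t))"
    by (auto simp: second_order_pair_def transverse_def hill_def split_def)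
  finally show "((\<lambda>t. transverse (Y t)) has_vector_derivative
      hill (\<lambda>t. Q (fst (Y t)) (fst (transverse (Y t)))) t (transverse (Y t))) (at t)" .
qed

lemma solves_continuous: "solves G x \<Longrightarrow> continuous_on S x"
  by (meson continuous_at_imp_continuous_on has_vector_derivative_continuous solves_def)

text \<open>
  A trajectory passing close to the orbit at phase \<open>s\<close> stays close to it for a time \<open>S\<close>, so the
  two Hill coefficients differ little and Gronwall applies to the transverse components. The
  error is relative to the size of the transverse component, which is what allows the estimate to
  be iterated along a trajectory that approaches or leaves the plane.
\<close>

lemma transverse_shadowing:
  fixes H Q :: "real \<Rightarrow> real \<Rightarrow> real"
  defines "F \<equiv> second_order_pair H Q"
  assumes L: "0 \<le> L" "\<And>p p'. norm (F p - F p') \<le> L * norm (p - p')"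
    and Q_cont: "continuous_on UNIV (\<lambda>(y, z). Q y z)" and K: "\<And>y z. \<bar>Q y z\<bar> \<le> K"
    and X: "solves (\<lambda>_. F) X" and X_eq: "\<And>t. transverse (X t) = 0"
    and B: "\<And>t. \<bar>fst (X t)\<bar> \<le> B"
    and S: "0 \<le> S" and \<eta>: "0 < \<eta>"
  obtains \<delta> where "0 < \<delta>"
    and "\<And>Y \<zeta> s t r. solves (\<lambda>_. F) Y \<Longrightarrow> dist (Y t) (X s) < \<delta> \<Longrightarrow>
      solves (hill (\<lambda>t. Q (fst (X t)) 0)) \<zeta> \<Longrightarrow> \<zeta> s = transverse (Y t) \<Longrightarrow> r \<in> {0..S} \<Longrightarrow>
      norm (transverse (Y (t + r)) - \<zeta> (s + r)) \<le> \<eta> * norm (transverse (Y t))"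
proof -
  have K0: "0 \<le> K" using K[of 0 0] by linarith
  \<comment> \<open>\<open>E\<close> bounds the growth of the Hill solution and \<open>E2\<close> is the Gronwall factor; the admissible
    difference \<open>\<eta>1\<close> of the coefficients is chosen so that the final estimate closes with \<open>\<eta>\<close>.\<close>
  define E where "E = exp ((2 + K) * S)"
  define E2 where "E2 = exp ((2 * (1 + K) + 1) * S)"
  have E: "1 \<le> E" "1 \<le> E2" using K0 S by (auto simp: E_def E2_def)
  define \<eta>1 where "\<eta>1 = \<eta> / (E2 * (S + 1) * E)"
  have \<eta>1: "0 < \<eta>1" using \<eta> E S by (simp add: \<eta>1_def)
  define C where "C = {-B-1..B+1} \<times> {-1..1::real}"
  have "uniformly_continuous_on C (\<lambda>(y, z). Q y z)"
    by (intro compact_uniformly_continuous continuous_on_subset[OF Q_cont])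
      (auto simp: C_def intro: compact_Times)
  then obtain d0 where d0: "0 < d0"
    and Q_unif: "\<And>p p'. p \<in> C \<Longrightarrow> p' \<in> C \<Longrightarrow> dist p' p < d0
      \<Longrightarrow> \<bar>(case p' of (y, z) \<Rightarrow> Q y z) - (case p of (y, z) \<Rightarrow> Q y z)\<bar> < \<eta>1"
    unfolding uniformly_continuous_on_def dist_real_def using \<eta>1 by metis
  define d where "d = min d0 1"
  have d: "0 < d" using d0 by (simp add: d_def)
  have Q_close: "\<bar>Q y z - Q u 0\<bar> < \<eta>1" if "\<bar>u\<bar> \<le> B" "dist (y, z) (u, 0) < d" for y z u
  proof -
    have "\<bar>y - u\<bar> < 1" "\<bar>z\<bar> < 1"
      using that(2) dist_fst_le[of "(y, z)" "(u, 0)"] dist_snd_le[of "(y, z)" "(u, 0::real)"]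
      by (auto simp: d_def dist_real_def)
    with that(1) have "u \<in> {-B-1..B+1}" "y \<in> {-B-1..B+1}" "z \<in> {-1..1}"
      by (auto simp: abs_le_iff abs_less_iff)
    then show ?thesis
      using Q_unif[of "(u, 0)" "(y, z)"] that unfolding C_def d_def by force
  qed
  define \<delta> where "\<delta> = d / exp ((L + 1) * S)"
  show thesis
  proof (rule that)
    show "0 < \<delta>" using d by (simp add: \<delta>_def)
    fix Y :: "real \<Rightarrow> real \<times> real \<times> real \<times> real" and \<zeta> s t r
    assume Y: "solves (\<lambda>_. F) Y" and close: "dist (Y t) (X s) < \<delta>"
      and \<zeta>: "solves (hill (\<lambda>t. Q (fst (X t)) 0)) \<zeta>" and \<zeta>s: "\<zeta> s = transverse (Y t)"
      and r: "r \<in> {0..S}"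
    define N where "N = norm (transverse (Y t))"
    have stay: "dist (Y (t + a)) (X (s + a)) < d" if "a \<in> {0..S}" for a
    proof -
      have "norm (Y (a + t) - X (a + s)) \<le> exp ((L + 1) * \<bar>a - 0\<bar>) * norm (Y (0 + t) - X (0 + s))"
        by (rule solution_growth[OF L solves_shift[OF Y] solves_shift[OF X]])
      also have "\<dots> \<le> exp ((L + 1) * S) * norm (Y (0 + t) - X (0 + s))"
        using that L(1) by (intro mult_right_mono) (auto intro: mult_left_mono)
      also have "\<dots> < exp ((L + 1) * S) * \<delta>"
        using close by (simp add: dist_norm)
      also have "\<dots> = d" by (simp add: \<delta>_def)
      finally show ?thesis by (simp add: dist_norm add.commute)
    qed
    define P where "P a = Q (fst (Y (t + a))) (fst (transverse (Y (t + a))))" for a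
    define P0 where "P0 a = Q (fst (X (s + a))) 0" for a
    have P_close: "\<bar>P a - P0 a\<bar> < \<eta>1" if "a \<in> {0..S}" for a
      unfolding P_def P0_def
      using order.strict_trans1[OF dist_outer_le stay[OF that]]
      by (intro Q_close B) (simp add: X_eq)
    have P_cont: "continuous_on A P" "continuous_on A P0" for A
    proof -
      have c: "continuous_on A (\<lambda>a. Z (c + a))" if "continuous_on UNIV Z" for Z :: "real \<Rightarrow> real \<times> real \<times> real \<times> real" and c
        using continuous_on_compose2[OF that, of A "\<lambda>a. c + a"] by (simp add: continuous_intros)
      have tr: "continuous_on A (\<lambda>a. fst (transverse (Z (c + a))))" if "continuous_on UNIV Z" for Z :: "real \<Rightarrow> real \<times> real \<times> real \<times> real" and c
        by (intro continuous_intros bounded_linear.continuous_on[OF bounded_linear_transverse] c that)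
      show "continuous_on A P"
        unfolding P_def
        using continuous_on_compose2[OF Q_cont, of A "\<lambda>a. (fst (Y (t + a)), fst (transverse (Y (t + a))))"]
        by (simp add: continuous_on_Pair continuous_on_fst c tr solves_continuous[OF Y])
      show "continuous_on A P0"
        unfolding P0_def
        using continuous_on_compose2[OF Q_cont, of A "\<lambda>a. (fst (X (s + a)), 0)"]
        by (simp add: continuous_on_Pair continuous_on_fst c solves_continuous[OF X])
    qed
    define e where "e a = (0::real, (P a - P0 a) * fst (\<zeta> (s + a)))" for a
    have \<zeta>_cont: "continuous_on A (\<lambda>a. \<zeta> (s + a))" for A
      using continuous_on_compose2[OF solves_continuous[OF \<zeta>, of UNIV], of A "\<lambda>a. s + a"]
      by (simp add: continuous_intros)
    have e_cont: "continuous_on A e" for A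
      unfolding e_def by (intro continuous_intros P_cont \<zeta>_cont)
    have e_le: "norm (e a) \<le> \<eta>1 * (E * N)" if a: "a \<in> {0..S}" for a
    proof -
      have "norm (\<zeta> (s + a)) \<le> exp ((2 + K) * \<bar>(s + a) - s\<bar>) * norm (\<zeta> s)"
        by (rule hill_growth[OF _ \<zeta>]) (rule K)
      also have "\<dots> \<le> E * N"
        unfolding E_def N_def \<zeta>s using a K0 by (intro mult_right_mono) (auto intro: mult_left_mono)
      finally have "\<bar>fst (\<zeta> (s + a))\<bar> \<le> E * N"
        using norm_planar_le(1)[of "\<zeta> (s + a)"] by linarith
      moreover have "norm (e a) = \<bar>P a - P0 a\<bar> * \<bar>fst (\<zeta> (s + a))\<bar>"
        by (simp add: e_def norm_prod_def abs_mult)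
      ultimately show ?thesis
        using P_close[OF a] by (auto intro!: mult_mono)
    qed
    have "(norm (transverse (Y (t + r)) - \<zeta> (s + r)))\<^sup>2
      \<le> exp ((2 * (1 + K) + 1) * (r - 0)) * ((norm (transverse (Y (t + 0)) - \<zeta> (s + 0)))\<^sup>2
          + integral {0..r} (\<lambda>a. (norm (e a))\<^sup>2))"
    proof (rule gronwall_perturbed[where G = "hill P"])
      show "0 \<le> r" "0 \<le> 1 + K" using r K0 by auto
      fix a
      have *: "(\<lambda>a. transverse (Y (t + a))) = (\<lambda>a. transverse (Y (a + t)))"
        by (simp add: add.commute)
      show "((\<lambda>a. transverse (Y (t + a))) has_vector_derivative hill P a (transverse (Y (t + a)))) (at a)"
        using solvesD[OF solves_shift[OF solves_transverse[OF Y[unfolded F_def]], of t], of a]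
        by (simp add: hill_def P_def add.commute)
      have eq: "hill P a (\<zeta> (s + a)) + e a = hill (\<lambda>t. Q (fst (X t)) 0) (a + s) (\<zeta> (a + s))"
        by (simp add: hill_def e_def P0_def add.commute algebra_simps)
      show "((\<lambda>a. \<zeta> (s + a)) has_vector_derivative hill P a (\<zeta> (s + a)) + e a) (at a)"
        unfolding eq using solvesD[OF solves_shift[OF \<zeta>, of s], of a] by (simp add: hill_def add.commute)
      show "norm (hill P a (transverse (Y (t + a))) - hill P a (\<zeta> (s + a)))
          \<le> (1 + K) * norm (transverse (Y (t + a)) - \<zeta> (s + a))"
        by (rule hill_lipschitz) (simp add: P_def K)
    qed (rule e_cont)
    also have "integral {0..r} (\<lambda>a. (norm (e a))\<^sup>2) \<le> integral {0..r} (\<lambda>a. (\<eta>1 * (E * N))\<^sup>2)"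
      using r by (intro integral_le integrable_continuous_real continuous_intros e_cont power_mono e_le) auto
    also have "\<dots> = r * (\<eta>1 * (E * N))\<^sup>2" using r by simp
    finally have "(norm (transverse (Y (t + r)) - \<zeta> (s + r)))\<^sup>2
        \<le> exp ((2 * (1 + K) + 1) * r) * (r * (\<eta>1 * (E * N))\<^sup>2)"
      by (simp add: \<zeta>s)
    also have "\<dots> \<le> E2 * ((S + 1) * (\<eta>1 * (E * N))\<^sup>2)"
      unfolding E2_def using r K0 by (intro mult_mono) (auto intro: mult_left_mono)
    also have "\<dots> \<le> E2\<^sup>2 * ((S + 1)\<^sup>2 * (\<eta>1 * (E * N))\<^sup>2)"
      using E S by (intro mult_mono) (auto simp: power2_eq_square)
    also have "\<dots> = (\<eta> * N)\<^sup>2"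
      using E S by (simp add: \<eta>1_def power_mult_distrib power_divide)
    finally have "norm (transverse (Y (t + r)) - \<zeta> (s + r)) \<le> \<eta> * N"
      by (rule power2_le_imp_le) (use \<eta> in \<open>simp add: N_def\<close>)
    then show "norm (transverse (Y (t + r)) - \<zeta> (s + r)) \<le> \<eta> * norm (transverse (Y t))"
      by (simp add: N_def)
  qed
qed

lemma continuous_on_lipschitz:
  fixes F :: "'a::real_normed_vector \<Rightarrow> 'b::real_normed_vector"
  assumes "0 \<le> L" and "\<And>p p'. norm (F p - F p') \<le> L * norm (p - p')"
  shows "continuous_on S F"
  using lipschitz_on_continuous_on[of L S F] assms
  by (auto simp: lipschitz_on_def dist_norm)

text \<open>
  Suppose that a trajectory starting at a small transverse displacement stays in the tube \<open>W\<close>.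
  Its transverse samples \<open>N n\<close> at multiples of the period then satisfy
  \<open>N (n + 2) \<ge> \<bar>\<tau>\<bar> N (n + 1) - (1 + small) N n\<close>, whatever phase the trajectory has drifted to. Once
  \<open>N 1 \<ge> N 0 > 0\<close>, this forces \<open>N\<close> to grow geometrically, since \<open>\<bar>\<tau>\<bar> - 1 > 1\<close>. The first
  inequality is arranged by the direction of the displacement: of the two diagonal entries of the
  monodromy matrix one has absolute value at least \<open>\<bar>\<tau>\<bar>/2\<close>, and the corresponding basis vector is
  stretched.
\<close>

theorem unstable_of_hyperbolic_hill:
  fixes H Q :: "real \<Rightarrow> real \<Rightarrow> real"
  defines "F \<equiv> second_order_pair H Q"
  assumes L: "0 \<le> L" "\<And>p p'. norm (F p - F p') \<le> L * norm (p - p')"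
    and Q_cont: "continuous_on UNIV (\<lambda>(y, z). Q y z)" and K: "\<And>y z. \<bar>Q y z\<bar> \<le> K"
    and X: "ode_solution F X" and X_eq: "\<And>t. transverse (X t) = 0"
    and T: "0 < T" and per: "\<And>t. X (t + T) = X t"
    and \<zeta>1: "solves (hill (\<lambda>t. Q (fst (X t)) 0)) \<zeta>1" "\<zeta>1 s = (1, 0)"
    and \<zeta>2: "solves (hill (\<lambda>t. Q (fst (X t)) 0)) \<zeta>2" "\<zeta>2 s = (0, 1)"
    and hyp: "\<bar>fst (\<zeta>1 (s + T)) + snd (\<zeta>2 (s + T))\<bar> > 2"
  shows "unstable_periodic_solution F X"
proof -
  define P where "P t = Q (fst (X t)) 0" for t
  have X': "solves (\<lambda>_. F) X" using X by (simp add: ode_solution_def solves_def)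
  note Z1 = \<zeta>1[folded P_def[abs_def]] and Z2 = \<zeta>2[folded P_def[abs_def]]
  have P_K: "\<bar>P t\<bar> \<le> K" for t by (simp add: P_def K)
  have P_per: "P (t + T) = P t" for t by (simp add: P_def per)
  have P_cont: "continuous_on UNIV P"
    unfolding P_def
    using continuous_on_compose2[OF Q_cont, of UNIV "\<lambda>t. (fst (X t), 0)"]
    by (simp add: continuous_on_Pair continuous_on_fst solves_continuous[OF X'])
  define \<tau> where "\<tau> = fst (\<zeta>1 (s + T)) + snd (\<zeta>2 (s + T))"
  have \<tau>: "2 < \<bar>\<tau>\<bar>" using hyp by (simp add: \<tau>_def)
  \<comment> \<open>The shadowing error enters the recurrence multiplied by \<open>1 + \<bar>\<tau>\<bar>\<close>; with this choice it
    consumes a quarter of the margin \<open>\<bar>\<tau>\<bar> - 2\<close>.\<close>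
  define \<eta> where "\<eta> = (\<bar>\<tau>\<bar> - 2) / (4 * (1 + \<bar>\<tau>\<bar>))"
  have \<eta>: "0 < \<eta>" using \<tau> by (simp add: \<eta>_def)
  have "1 + \<bar>\<tau>\<bar> \<noteq> 0" by linarith
  then have \<eta>_mult: "\<eta> * (1 + \<bar>\<tau>\<bar>) = (\<bar>\<tau>\<bar> - 2) / 4"
    unfolding \<eta>_def by (metis divide_divide_eq_left mult.commute nonzero_mult_div_cancel_left times_divide_eq_right)
  have \<eta>_le: "\<eta> \<le> (\<bar>\<tau>\<bar> - 2) / 4"
    unfolding \<eta>_mult[symmetric] using \<eta> by (simp add: mult_le_cancel_left1)
  obtain B where B: "\<And>t. \<bar>fst (X t)\<bar> \<le> B"
  proof -
    have "compact ((\<lambda>t. fst (X t)) ` {0..T})"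
      by (rule compact_continuous_image[OF continuous_on_fst[OF solves_continuous[OF X']] compact_Icc])
    from compact_imp_bounded[OF this]
    obtain B where "\<forall>y \<in> (\<lambda>t. fst (X t)) ` {0..T}. norm y \<le> B"
      unfolding bounded_iff ..
    then have B: "\<bar>fst (X t)\<bar> \<le> B" if "t \<in> {0..T}" for t
      using that by auto
    interpret periodic_fun_simple X T by standard (rule per)
    have "\<bar>fst (X t)\<bar> \<le> B" for t
    proof -
      define m where "m = \<lfloor>t / T\<rfloor>"
      have "X t = X (t - of_int m * T)" by (simp add: minus_of_int)
      moreover have "t - of_int m * T \<in> {0..T}"
        using floor_divide_lower[OF T, of t] floor_divide_upper[OF T, of t]
        by (simp add: m_def algebra_simps)
      ultimately show ?thesis using B by simp
    qed
    then show thesis by (rule that)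
  qed
  have two_T: "0 \<le> 2 * T" using T by simp
  obtain \<delta> where \<delta>: "0 < \<delta>"
    and shadow: "\<And>Y \<zeta> s t r. solves (\<lambda>_. F) Y \<Longrightarrow> dist (Y t) (X s) < \<delta> \<Longrightarrow>
      solves (hill P) \<zeta> \<Longrightarrow> \<zeta> s = transverse (Y t) \<Longrightarrow> r \<in> {0..2 * T} \<Longrightarrow>
      norm (transverse (Y (t + r)) - \<zeta> (s + r)) \<le> \<eta> * norm (transverse (Y t))"
    by (rule transverse_shadowing[OF L(1) L(2)[unfolded F_def] Q_cont K X'[unfolded F_def] X_eq B two_T \<eta>,
      folded F_def P_def[abs_def]]) (rule that)
  define W where "W = (\<Union>t. ball (X t) \<delta>)"
  obtain z0 \<xi> where z0: "norm z0 = 1" and \<xi>: "solves (hill P) \<xi>" "\<xi> s = z0"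
    and \<xi>_grow: "norm (\<xi> (s + T)) \<ge> \<bar>\<tau>\<bar> / 2"
  proof (cases "\<bar>fst (\<zeta>1 (s + T))\<bar> \<ge> \<bar>\<tau>\<bar> / 2")
    case True
    then have "norm (\<zeta>1 (s + T)) \<ge> \<bar>\<tau>\<bar> / 2"
      using norm_planar_le(1)[of "\<zeta>1 (s + T)"] by linarith
    with Z1 show ?thesis by (intro that[of "(1, 0)" \<zeta>1]) (simp_all add: norm_prod_def)
  next
    case False
    then have "\<bar>snd (\<zeta>2 (s + T))\<bar> \<ge> \<bar>\<tau>\<bar> / 2"
      using abs_triangle_ineq[of "fst (\<zeta>1 (s + T))" "snd (\<zeta>2 (s + T))"] unfolding \<tau>_def by argo
    then have "norm (\<zeta>2 (s + T)) \<ge> \<bar>\<tau>\<bar> / 2"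
      using norm_planar_le(2)[of "\<zeta>2 (s + T)"] by linarith
    with Z2 show ?thesis by (intro that[of "(0, 1)" \<zeta>2]) (simp_all add: norm_prod_def)
  qed
  have escape: "\<exists>t>0. Y t \<notin> W"
    if Y: "solves (\<lambda>_. F) Y" and Y0: "Y 0 = X s + (0, 0, \<kappa> *\<^sub>R z0)" and \<kappa>: "0 < \<kappa>" "\<kappa> < \<delta>" for Y \<kappa>
  proof (rule ccontr)
    assume "\<not> (\<exists>t>0. Y t \<notin> W)"
    then have stay: "Y t \<in> W" if "0 < t" for t using that by blast
    define N where "N n = norm (transverse (Y (real n * T)))" for n
    have tr0: "transverse (Y 0) = \<kappa> *\<^sub>R z0"
      using X_eq[of s] by (simp add: Y0 transverse_def)
    have N0: "N 0 = \<kappa>" using tr0 z0 \<kappa> by (simp add: N_def)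
    have close0: "dist (Y 0) (X s) < \<delta>"
      using \<kappa> z0 by (simp add: Y0 dist_norm norm_Pair)
    have close: "\<exists>s. dist (Y t) (X s) < \<delta>" if "0 \<le> t" for t
    proof (cases "t = 0")
      case False
      then have "Y t \<in> W" using that by (intro stay) simp
      then show ?thesis by (auto simp: W_def dist_commute)
    qed (use close0 in auto)
    have tri: "norm (p + q + r - s) \<le> norm p + norm q + norm r + norm s" for p q r s :: "real \<times> real"
      using norm_triangle_ineq4[of "p + q + r" s] norm_triangle_ineq[of "p + q" r]
        norm_triangle_ineq[of p q] by linarith
    have step: "N (Suc (Suc n)) \<ge> \<bar>\<tau>\<bar> * N (Suc n) - (1 + \<eta> * (1 + \<bar>\<tau>\<bar>)) * N n" for n
    proof -
      define t where "t = real n * T"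
      obtain s' where s': "dist (Y t) (X s') < \<delta>" using close[of t] T by (auto simp: t_def)
      obtain \<zeta> where \<zeta>: "solves (hill P) \<zeta>" "\<zeta> s' = transverse (Y t)"
        using hill_ivp[OF P_cont P_K] by metis
      have 1: "norm (transverse (Y (t + T)) - \<zeta> (s' + T)) \<le> \<eta> * N n"
        using shadow[OF Y s' \<zeta>, of T] T by (simp add: N_def t_def)
      have 2: "norm (transverse (Y (t + 2 * T)) - \<zeta> (s' + 2 * T)) \<le> \<eta> * N n"
        using shadow[OF Y s' \<zeta>, of "2 * T"] T by (simp add: N_def t_def)
      have rec: "\<zeta> (s' + 2 * T) = \<tau> *\<^sub>R \<zeta> (s' + T) - \<zeta> s'"
        unfolding \<tau>_def by (rule hill_period_recurrence[OF P_K P_per Z1 Z2 \<zeta>(1)])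
      have "\<tau> *\<^sub>R transverse (Y (t + T)) = transverse (Y (t + 2 * T)) + \<zeta> s'
          + \<tau> *\<^sub>R (transverse (Y (t + T)) - \<zeta> (s' + T)) - (transverse (Y (t + 2 * T)) - \<zeta> (s' + 2 * T))"
        unfolding rec by (simp add: algebra_simps)
      then have "norm (\<tau> *\<^sub>R transverse (Y (t + T))) \<le> norm (transverse (Y (t + 2 * T))) + norm (\<zeta> s')
          + norm (\<tau> *\<^sub>R (transverse (Y (t + T)) - \<zeta> (s' + T)))
          + norm (transverse (Y (t + 2 * T)) - \<zeta> (s' + 2 * T))"
        by (simp only: tri)
      moreover have "norm (\<tau> *\<^sub>R (transverse (Y (t + T)) - \<zeta> (s' + T))) \<le> \<bar>\<tau>\<bar> * (\<eta> * N n)"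
        using 1 by (simp add: mult_left_mono)
      moreover have "t + 2 * T = real (Suc (Suc n)) * T" "t + T = real (Suc n) * T"
        by (simp_all add: t_def algebra_simps)
      moreover have "norm (\<zeta> s') = N n" by (simp add: \<zeta> N_def t_def)
      ultimately show ?thesis using 2 by (simp add: N_def algebra_simps)
    qed
    have first: "N 1 \<ge> N 0"
    proof -
      have "solves (hill P) (\<lambda>t. \<kappa> *\<^sub>R \<xi> t + 0 *\<^sub>R \<xi> t)" by (rule hill_combination[OF \<xi>(1) \<xi>(1)])
      from shadow[OF Y close0 this, of T]
      have "norm (transverse (Y T) - \<kappa> *\<^sub>R \<xi> (s + T)) \<le> \<eta> * \<kappa>"
        using T tr0 \<xi>(2) N0 by (simp add: N_def)
      then have "norm (\<kappa> *\<^sub>R \<xi> (s + T)) \<le> norm (transverse (Y T)) + \<eta> * \<kappa>"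
        using norm_triangle_ineq2[of "\<kappa> *\<^sub>R \<xi> (s + T)" "transverse (Y T)"]
        by (simp add: norm_minus_commute)
      moreover have "norm (\<kappa> *\<^sub>R \<xi> (s + T)) \<ge> \<kappa> * (\<bar>\<tau>\<bar> / 2)"
        using \<xi>_grow \<kappa> by simp
      moreover have "\<eta> * \<kappa> \<le> (\<bar>\<tau>\<bar> - 2) / 4 * \<kappa>"
        using \<eta>_le \<kappa> by (intro mult_right_mono) auto
      moreover have "0 \<le> (\<bar>\<tau>\<bar> - 2) / 4 * \<kappa>" using \<tau> \<kappa> by simp
      ultimately have "N 1 \<ge> \<kappa>" by (simp add: N_def algebra_simps)
      then show ?thesis using N0 by simp
    qed
    define \<rho> where "\<rho> = 1 + 3 / 4 * (\<bar>\<tau>\<bar> - 2)"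
    have \<rho>: "1 < \<rho>" using \<tau> by (simp add: \<rho>_def)
    have growth: "N n \<le> N (Suc n) \<and> \<kappa> * \<rho> ^ n \<le> N (Suc n)" for n
    proof (induction n)
      case 0
      then show ?case using first N0 by simp
    next
      case (Suc n)
      have "(1 + \<eta> * (1 + \<bar>\<tau>\<bar>)) * N n \<le> (1 + (\<bar>\<tau>\<bar> - 2) / 4) * N (Suc n)"
        unfolding \<eta>_mult using Suc \<tau> by (intro mult_left_mono) auto
      note error_bound = this
      have *: "\<rho> * N (Suc n) \<le> N (Suc (Suc n))"
      proof -
        have "\<rho> * N (Suc n) = \<bar>\<tau>\<bar> * N (Suc n) - (1 + (\<bar>\<tau>\<bar> - 2) / 4) * N (Suc n)"
          by (simp add: \<rho>_def field_simps)
        with step[of n] error_bound show ?thesis by linarith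
      qed
      have "\<rho> * (\<kappa> * \<rho> ^ n) \<le> \<rho> * N (Suc n)"
        using Suc \<rho> by (intro mult_left_mono) auto
      moreover have "1 * N (Suc n) \<le> \<rho> * N (Suc n)"
        using \<rho> by (intro mult_right_mono) (auto simp: N_def)
      ultimately show ?case using * by (simp add: algebra_simps)
    qed
    have "N n < \<delta>" for n
    proof -
      obtain s' where "dist (Y (real n * T)) (X s') < \<delta>" using close[of "real n * T"] T by auto
      moreover have "transverse (Y (real n * T) - X s') = transverse (Y (real n * T))"
        using X_eq[of s'] by (simp add: transverse_def)
      ultimately show ?thesis
        using norm_transverse_le[of "Y (real n * T) - X s'"] by (simp add: N_def dist_norm)
    qed
    then have "\<rho> ^ n < \<delta> / \<kappa>" for n
      using growth[of n] \<kappa> by (simp add: field_simps) (meson order.strict_trans1)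
    moreover obtain n where "\<delta> / \<kappa> < \<rho> ^ n" using real_arch_pow[OF \<rho>] by blast
    ultimately show False by (meson less_asym)
  qed
  have "\<exists>Y. ode_solution F Y \<and> (\<exists>p\<in>range X. dist (Y 0) p < \<epsilon>) \<and> (\<exists>t>0. Y t \<notin> W)" if "0 < \<epsilon>" for \<epsilon>
  proof -
    define \<kappa> where "\<kappa> = min \<epsilon> \<delta> / 2"
    have \<kappa>: "0 < \<kappa>" "\<kappa> < \<delta>" "\<kappa> < \<epsilon>" using \<delta> that by (auto simp: \<kappa>_def)
    have "continuous_on UNIV (\<lambda>x::real \<times> real \<times> real \<times> real \<times> real. F (snd x))"
      by (rule continuous_on_compose2[OF continuous_on_lipschitz[OF L, of UNIV]])
        (auto intro: continuous_intros)
    then have "continuous_on UNIV (\<lambda>(t::real, u). F u)" by (simp add: split_def)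
    then obtain Y where Y: "solves (\<lambda>_. F) Y" "Y 0 = X s + (0, 0, \<kappa> *\<^sub>R z0)"
      using lipschitz_ivp[where G = "\<lambda>_. F", OF L(2), of "norm (F 0)"] by (metis order_refl)
    have "dist (Y 0) (X s) < \<epsilon>"
      using \<kappa> z0 by (simp add: Y dist_norm norm_Pair)
    with escape[OF Y \<kappa>(1,2)] Y(1) show ?thesis
      by (auto simp: ode_solution_def solves_def)
  qed
  moreover have "open W" "range X \<subseteq> W" using \<delta> by (auto simp: W_def)
  ultimately show ?thesis
    unfolding unstable_periodic_solution_def using X T per by blast
qed

section \<open>Passing to the limit in differential equations\<close>

lemma integrable_bounded_interval:
  fixes F :: "real \<Rightarrow> real"
  assumes "F \<in> borel_measurable borel" and "\<And>x. x \<in> {a..b} \<Longrightarrow> \<bar>F x\<bar> \<le> B"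
  shows "set_integrable lborel {a..b} F"
  unfolding set_integrable_def
  using assms by (intro integrableI_bounded_set_indicator[where B = B]) (auto simp: emeasure_lborel_Icc_eq)

text \<open>
  Dominated convergence for the integral over a compact interval, with a countable exceptional
  set: the integrands below may fail to converge at the end points, or where a sine takes one of
  finitely many values.
\<close>

lemma integral_tendsto_bounded:
  fixes F :: "nat \<Rightarrow> real \<Rightarrow> real"
  assumes F: "\<And>n. F n \<in> borel_measurable borel" and G: "G \<in> borel_measurable borel"
    and B: "\<And>n x. x \<in> {a..b} \<Longrightarrow> \<bar>F n x\<bar> \<le> B"
    and N: "countable N" and lim: "\<And>x. x \<in> {a..b} - N \<Longrightarrow> (\<lambda>n. F n x) \<longlonglongrightarrow> G x"
  shows "(\<lambda>n. integral {a..b} (F n)) \<longlonglongrightarrow> integral {a..b} G"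
proof -
  have N_null: "AE x in lborel. x \<notin> N"
    by (intro AE_not_in countable_imp_null_set_lborel N)
  have [measurable]: "F n \<in> borel_measurable borel" "G \<in> borel_measurable borel" for n
    by (rule F, rule G)
  have AE_lim: "AE x in lborel. (\<lambda>n. indicator {a..b} x *\<^sub>R F n x) \<longlonglongrightarrow> indicator {a..b} x *\<^sub>R G x"
    using N_null by eventually_elim (auto simp: indicator_def intro: lim)
  have dom: "integrable lborel (\<lambda>x. indicator {a..b} x *\<^sub>R B)"
    by (rule integrableI_bounded_set_indicator[where B = "\<bar>B\<bar>"]) (auto simp: emeasure_lborel_Icc_eq)
  have AE_B: "AE x in lborel. norm (indicator {a..b} x *\<^sub>R F n x) \<le> indicator {a..b} x *\<^sub>R B" for n
    using B by (auto simp: indicator_def)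
  have G_int: "set_integrable lborel {a..b} G"
    unfolding set_integrable_def
    by (rule integrable_dominated_convergence[OF _ _ dom AE_lim AE_B]) auto
  have F_int: "set_integrable lborel {a..b} (F n)" for n
    by (rule integrable_bounded_interval[OF F B])
  have "(\<lambda>n. LINT x:{a..b}|lborel. F n x) \<longlonglongrightarrow> (LINT x:{a..b}|lborel. G x)"
    unfolding set_lebesgue_integral_def
    by (rule integral_dominated_convergence[OF _ _ dom AE_lim AE_B]) auto
  then show ?thesis
    by (simp add: set_borel_integral_eq_integral(2)[OF F_int] set_borel_integral_eq_integral(2)[OF G_int])
qed

text \<open>
  The vector fields \<open>G q\<close> need to converge only along the one trajectory \<open>W\<close>, pointwise in time and away
  from the end points: taking \<open>W\<close> as the perturbed solution in Gronwall's inequality, the error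
  \<open>G0 t (W t) - G q t (W t)\<close> does not involve \<open>X q\<close>, and its mean square tends to zero by dominated
  convergence.
\<close>

lemma solutions_tendsto:
  fixes G :: "real \<Rightarrow> real \<Rightarrow> 'a::real_inner \<Rightarrow> 'a"
  assumes ac: "a \<le> c" and L: "0 \<le> L"
    and lip: "\<And>q t u v. norm (G q t u - G q t v) \<le> L * norm (u - v)"
    and X: "\<And>q. solves (G q) (X q)" and W: "solves G0 W"
    and contG: "\<And>q. continuous_on UNIV (\<lambda>t. G q t (W t))" and cont0: "continuous_on UNIV (\<lambda>t. G0 t (W t))"
    and lim: "\<And>t. a < t \<Longrightarrow> t < c \<Longrightarrow> ((\<lambda>q. G q t (W t)) \<longlongrightarrow> G0 t (W t)) at_top"
    and B: "\<And>q t. t \<in> {a..c} \<Longrightarrow> norm (G q t (W t)) \<le> B"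
    and init: "((\<lambda>q. X q a) \<longlongrightarrow> W a) at_top"
  shows "((\<lambda>q. X q c) \<longlongrightarrow> W c) at_top"
proof -
  define e where "e q t = G0 t (W t) - G q t (W t)" for q t
  have e_cont: "continuous_on A (e q)" for q A
    unfolding e_def by (intro continuous_intros continuous_on_subset[OF contG] continuous_on_subset[OF cont0]) auto
  have "compact ((\<lambda>t. G0 t (W t)) ` {a..c})"
    by (rule compact_continuous_image[OF continuous_on_subset[OF cont0] compact_Icc]) simp
  from compact_imp_bounded[OF this] obtain B0 where "\<forall>y \<in> (\<lambda>t. G0 t (W t)) ` {a..c}. norm y \<le> B0"
    unfolding bounded_iff ..
  then have B0: "norm (G0 t (W t)) \<le> B0" if "t \<in> {a..c}" for t using that by simp
  have int0: "((\<lambda>q. integral {a..c} (\<lambda>t. (norm (e q t))\<^sup>2)) \<longlongrightarrow> 0) at_top"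
  proof (rule tendsto_at_topI_sequentially)
    fix Q :: "nat \<Rightarrow> real" assume Q: "filterlim Q at_top sequentially"
    have "(\<lambda>n. integral {a..c} (\<lambda>t. (norm (e (Q n) t))\<^sup>2)) \<longlonglongrightarrow> integral {a..c} (\<lambda>t. 0)"
    proof (rule integral_tendsto_bounded[where N = "{a, c}"])
      show "(\<lambda>t. (norm (e (Q n) t))\<^sup>2) \<in> borel_measurable borel" for n
        by (intro borel_measurable_continuous_onI continuous_intros e_cont)
      show "\<bar>(norm (e (Q n) t))\<^sup>2\<bar> \<le> (B0 + B)\<^sup>2" if "t \<in> {a..c}" for n t
        using norm_triangle_ineq4[of "G0 t (W t)" "G (Q n) t (W t)"] B0[OF that] B[OF that, of "Q n"]
        by (simp add: e_def power_mono)
      show "(\<lambda>n. (norm (e (Q n) t))\<^sup>2) \<longlonglongrightarrow> 0" if "t \<in> {a..c} - {a, c}" for t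
      proof -
        have "(\<lambda>n. G (Q n) t (W t)) \<longlonglongrightarrow> G0 t (W t)"
          using filterlim_compose[OF lim Q, of t] that by auto
        then have "(\<lambda>n. e (Q n) t) \<longlonglongrightarrow> G0 t (W t) - G0 t (W t)"
          unfolding e_def by (intro tendsto_intros)
        then have "(\<lambda>n. (norm (e (Q n) t))\<^sup>2) \<longlonglongrightarrow> (norm (0::'a))\<^sup>2"
          by (intro tendsto_intros) simp
        then show ?thesis by simp
      qed
    qed auto
    then show "(\<lambda>n. integral {a..c} (\<lambda>t. (norm (e (Q n) t))\<^sup>2)) \<longlonglongrightarrow> 0" by simp
  qed
  have "((\<lambda>q. (norm (X q c - W c))\<^sup>2) \<longlongrightarrow> 0) at_top"
  proof (rule tendsto_sandwich[where f = "\<lambda>_. 0"])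
    show "\<forall>\<^sub>F q in at_top. (norm (X q c - W c))\<^sup>2 \<le> exp ((2 * L + 1) * (c - a)) *
        ((norm (X q a - W a))\<^sup>2 + integral {a..c} (\<lambda>t. (norm (e q t))\<^sup>2))"
    proof (rule always_eventually, rule allI)
      fix q
      show "(norm (X q c - W c))\<^sup>2 \<le> exp ((2 * L + 1) * (c - a)) *
        ((norm (X q a - W a))\<^sup>2 + integral {a..c} (\<lambda>t. (norm (e q t))\<^sup>2))"
        using solvesD[OF X] solvesD[OF W]
        by (intro gronwall_perturbed[where G = "G q"] ac L lip e_cont) (auto simp: e_def)
    qed
    have "((\<lambda>q. exp ((2 * L + 1) * (c - a)) *
        ((norm (X q a - W a))\<^sup>2 + integral {a..c} (\<lambda>t. (norm (e q t))\<^sup>2)))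
        \<longlongrightarrow> exp ((2 * L + 1) * (c - a)) * ((norm (W a - W a))\<^sup>2 + 0)) at_top"
      by (intro tendsto_intros init int0)
    then show "((\<lambda>q. exp ((2 * L + 1) * (c - a)) *
        ((norm (X q a - W a))\<^sup>2 + integral {a..c} (\<lambda>t. (norm (e q t))\<^sup>2))) \<longlongrightarrow> 0) at_top" by simp
  qed (auto intro: tendsto_const)
  then have "((\<lambda>q. sqrt ((norm (X q c - W c))\<^sup>2)) \<longlongrightarrow> sqrt 0) at_top"
    by (rule tendsto_real_sqrt)
  then have "((\<lambda>q. norm (X q c - W c)) \<longlongrightarrow> 0) at_top" by simp
  then show ?thesis
    using Lim_null tendsto_norm_zero_iff by blast
qed

text \<open>
  The solution of \<open>z'' + A\<^sup>2 z = 0\<close> with value and velocity \<open>z\<close> at time \<open>s\<close>.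
\<close>

definition harmonic :: "real \<Rightarrow> real \<Rightarrow> real \<times> real \<Rightarrow> real \<Rightarrow> real \<times> real" where
  "harmonic A s z t = (fst z * cos (A * (t - s)) + snd z * sin (A * (t - s)) / A,
     - A * fst z * sin (A * (t - s)) + snd z * cos (A * (t - s)))"

lemma harmonic_start [simp]: "harmonic A s z s = z"
  by (simp add: harmonic_def)

lemma solves_harmonic:
  assumes "A \<noteq> 0"
  shows "solves (hill (\<lambda>_. A\<^sup>2)) (harmonic A s z)"
  unfolding solves_def
proof
  fix t
  have 1: "((\<lambda>t. fst z * cos (A * (t - s)) + snd z * sin (A * (t - s)) / A)
      has_real_derivative snd (harmonic A s z t)) (at t)"
    using assms by (auto intro!: derivative_eq_intros simp: harmonic_def field_simps)
  have 2: "((\<lambda>t. - A * fst z * sin (A * (t - s)) + snd z * cos (A * (t - s)))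
      has_real_derivative - A\<^sup>2 * fst (harmonic A s z t)) (at t)"
    using assms by (auto intro!: derivative_eq_intros simp: harmonic_def field_simps power2_eq_square)
  have eq: "harmonic A s z = (\<lambda>t. (fst z * cos (A * (t - s)) + snd z * sin (A * (t - s)) / A,
     - A * fst z * sin (A * (t - s)) + snd z * cos (A * (t - s))))"
    by (simp add: harmonic_def fun_eq_iff)
  then show "(harmonic A s z has_vector_derivative hill (\<lambda>_. A\<^sup>2) t (harmonic A s z t)) (at t)"
    unfolding hill_def
    using has_vector_derivative_Pair[OF 1[unfolded has_real_derivative_iff_has_vector_derivative]
      2[unfolded has_real_derivative_iff_has_vector_derivative]] by simp
qed

lemma hill_tendsto_harmonic:
  fixes P :: "real \<Rightarrow> real \<Rightarrow> real"
  assumes ac: "a \<le> c" and A: "A \<noteq> 0"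
    and P_cont: "\<And>q. continuous_on UNIV (P q)" and K: "\<And>q t. \<bar>P q t\<bar> \<le> K"
    and lim: "\<And>t. a < t \<Longrightarrow> t < c \<Longrightarrow> ((\<lambda>q. P q t) \<longlongrightarrow> A\<^sup>2) at_top"
    and Z: "\<And>q. solves (hill (P q)) (Z q)" and init: "((\<lambda>q. Z q a) \<longlongrightarrow> z) at_top"
  shows "((\<lambda>q. Z q c) \<longlongrightarrow> harmonic A a z c) at_top"
proof -
  have K0: "0 \<le> K" using K[of 0 0] by linarith
  have W: "solves (hill (\<lambda>_. A\<^sup>2)) (harmonic A a z)" by (rule solves_harmonic[OF A])
  have W_cont: "continuous_on S (harmonic A a z)" for S by (rule solves_continuous[OF W])
  have "compact (harmonic A a z ` {a..c})"
    by (rule compact_continuous_image[OF W_cont compact_Icc])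
  from compact_imp_bounded[OF this] obtain B where "\<forall>y \<in> harmonic A a z ` {a..c}. norm y \<le> B"
    unfolding bounded_iff ..
  then have B: "norm (harmonic A a z t) \<le> B" if "t \<in> {a..c}" for t using that by simp
  show ?thesis
  proof (rule solutions_tendsto[where G = "\<lambda>q. hill (P q)" and L = "1 + K" and B = "(1 + K) * B", OF ac _ _ Z W])
    show "norm (hill (P q) t u - hill (P q) t v) \<le> (1 + K) * norm (u - v)" for q t u v
      by (rule hill_lipschitz[where P = "P q", OF K])
    show "continuous_on UNIV (\<lambda>t. hill (P q) t (harmonic A a z t))" for q
      unfolding hill_def by (intro continuous_intros P_cont W_cont)
    show "continuous_on UNIV (\<lambda>t. hill (\<lambda>_. A\<^sup>2) t (harmonic A a z t))"
      unfolding hill_def by (intro continuous_intros W_cont)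
    show "((\<lambda>q. hill (P q) t (harmonic A a z t)) \<longlongrightarrow> hill (\<lambda>_. A\<^sup>2) t (harmonic A a z t)) at_top"
      if "a < t" "t < c" for t
      unfolding hill_def by (intro tendsto_intros lim that)
    show "norm (hill (P q) t (harmonic A a z t)) \<le> (1 + K) * B" if "t \<in> {a..c}" for q t
      using norm_hill_le[where P = "P q", OF K] B[OF that] K0
      by (meson mult_left_mono order_trans add_nonneg_nonneg zero_le_one)
  qed (use K0 init in auto)
qed

section \<open>Oscillators at large amplitude\<close>

definition osc :: "(real \<Rightarrow> real) \<Rightarrow> real \<times> real \<Rightarrow> real \<times> real" where
  "osc h \<xi> = (snd \<xi>, - h (fst \<xi>))"

lemma osc_lipschitz:
  assumes "0 \<le> L" and "\<And>x y. \<bar>h x - h y\<bar> \<le> L * \<bar>x - y\<bar>"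
  shows "norm (osc h u - osc h v) \<le> (1 + L) * norm (u - v)"
proof -
  have "norm (osc h u - osc h v) \<le> \<bar>snd (u - v)\<bar> + \<bar>h (fst u) - h (fst v)\<bar>"
    using norm_planar_le(3)[of "osc h u - osc h v"] by (simp add: osc_def)
  also have "\<dots> \<le> norm (u - v) + L * norm (u - v)"
    using assms norm_planar_le(1,2)[of "u - v"]
    by (intro add_mono) (auto intro: order_trans[OF assms(2)] mult_left_mono)
  finally show ?thesis by (simp add: algebra_simps)
qed

lemma osc_components:
  assumes "solves (\<lambda>_. osc h) \<xi>"
  shows "((\<lambda>t. fst (\<xi> t)) has_real_derivative snd (\<xi> t)) (at t)"
    and "((\<lambda>t. snd (\<xi> t)) has_real_derivative - h (fst (\<xi> t))) (at t)"
  using bounded_linear.has_vector_derivative[OF bounded_linear_fst solvesD[OF assms], of t]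
    bounded_linear.has_vector_derivative[OF bounded_linear_snd solvesD[OF assms], of t]
  by (simp_all add: osc_def has_real_derivative_iff_has_vector_derivative)

lemma osc_solvesI:
  assumes "\<And>t. (x has_real_derivative v t) (at t)" and "\<And>t. (v has_real_derivative - h (x t)) (at t)"
  shows "solves (\<lambda>_. osc h) (\<lambda>t. (x t, v t))"
  unfolding solves_def
proof
  fix t
  show "((\<lambda>t. (x t, v t)) has_vector_derivative osc h (x t, v t)) (at t)"
    unfolding osc_def fst_conv snd_conv
    by (intro has_vector_derivative_Pair assms[unfolded has_real_derivative_iff_has_vector_derivative])
qed

lemma osc_reflect:
  assumes "solves (\<lambda>_. osc h) \<xi>"
  shows "solves (\<lambda>_. osc h) (\<lambda>t. (fst (\<xi> (s - t)), - snd (\<xi> (s - t))))"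
proof (rule osc_solvesI)
  fix t
  have s: "((\<lambda>t. s - t) has_real_derivative - 1) (at t)" by (auto intro!: derivative_eq_intros)
  show "((\<lambda>t. fst (\<xi> (s - t))) has_real_derivative - snd (\<xi> (s - t))) (at t)"
    using DERIV_chain2[OF osc_components(1)[OF assms] s] by simp
  show "((\<lambda>t. - snd (\<xi> (s - t))) has_real_derivative - h (fst (\<xi> (s - t)))) (at t)"
    using DERIV_minus[OF DERIV_chain2[OF osc_components(2)[OF assms] s]] by simp
qed

text \<open>
  For \<open>q = 0\<close> both sides are constantly zero by \<open>x / 0 = 0\<close>, so that the rescaled family may be
  indexed by all real \<open>q\<close>.
\<close>

lemma osc_scale:
  assumes "solves (\<lambda>_. osc h) \<xi>" and "h 0 = 0"
  shows "solves (\<lambda>_. osc (\<lambda>x. h (q * x) / q)) (\<lambda>t. (fst (\<xi> t) / q, snd (\<xi> t) / q))"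
proof (rule osc_solvesI)
  fix t
  show "((\<lambda>t. fst (\<xi> t) / q) has_real_derivative snd (\<xi> t) / q) (at t)"
    by (rule DERIV_cdivide[OF osc_components(1)[OF assms(1)]])
  show "((\<lambda>t. snd (\<xi> t) / q) has_real_derivative - (h (q * (fst (\<xi> t) / q)) / q)) (at t)"
    using DERIV_cdivide[OF osc_components(2)[OF assms(1)], where c = q and x = t] assms(2)
    by (cases "q = 0") auto
qed

text \<open>
  The reflected motion passes through the turning point with the same data.
\<close>

lemma osc_symmetric:
  assumes L: "0 \<le> L" and lip: "\<And>x y. \<bar>h x - h y\<bar> \<le> L * \<bar>x - y\<bar>"
    and \<xi>: "solves (\<lambda>_. osc h) \<xi>" and s: "snd (\<xi> s) = 0"
  shows "\<xi> (2 * s - t) = (fst (\<xi> t), - snd (\<xi> t))"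
proof -
  have "(fst (\<xi> (2 * s - t')), - snd (\<xi> (2 * s - t'))) = \<xi> t'" for t'
    by (rule solution_unique[OF _ osc_lipschitz[OF L lip] osc_reflect[OF \<xi>] \<xi>, where s = s])
      (use L s in \<open>simp_all add: prod_eq_iff\<close>)
  from this[of "2 * s - t"] show ?thesis by (auto simp: prod_eq_iff)
qed

text \<open>
  The reflections at two turning points \<open>0\<close> and \<open>s\<close> compose to the translation by \<open>2 s\<close>. Any turning
  point other than \<open>0\<close> therefore yields a period.
\<close>

lemma osc_periodic:
  assumes L: "0 \<le> L" and lip: "\<And>x y. \<bar>h x - h y\<bar> \<le> L * \<bar>x - y\<bar>"
    and \<xi>: "solves (\<lambda>_. osc h) \<xi>" and "snd (\<xi> 0) = 0" and "snd (\<xi> s) = 0"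
  shows "\<xi> (t + 2 * s) = \<xi> t"
  using osc_symmetric[OF L lip \<xi> assms(4), of t] osc_symmetric[OF L lip \<xi> assms(5), of "- t"]
  by (simp add: add.commute)

lemma osc_ivp:
  assumes "0 \<le> L" and "\<And>x y. \<bar>h x - h y\<bar> \<le> L * \<bar>x - y\<bar>"
  obtains \<xi> where "solves (\<lambda>_. osc h) \<xi>" "\<xi> s = x0"
proof (rule lipschitz_ivp[where G = "\<lambda>_. osc h" and L = "1 + L" and K = "norm (osc h 0)"])
  show "norm (osc h u - osc h v) \<le> (1 + L) * norm (u - v)" for u v
    by (rule osc_lipschitz[OF assms])
  have "continuous_on UNIV (osc h)"
    by (rule continuous_on_lipschitz[of "1 + L"]) (use assms osc_lipschitz[OF assms] in auto)
  from continuous_on_compose2[OF this continuous_on_snd[OF continuous_on_id, of UNIV]]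
  show "continuous_on UNIV (\<lambda>(t::real, u). osc h u)" by (simp add: split_def)
qed (use that in auto)

lemma quotient_limit_at_top:
  fixes h :: "real \<Rightarrow> real"
  assumes "((\<lambda>y. h y / y) \<longlongrightarrow> l) at_top" and "0 < x"
  shows "((\<lambda>q. h (q * x) / q) \<longlongrightarrow> l * x) at_top"
proof -
  have "filterlim (\<lambda>q. q * x) at_top at_top"
    using assms(2) by (simp add: filterlim_tendsto_pos_mult_at_top filterlim_at_top_mult_tendsto_pos
        [OF tendsto_const _ filterlim_ident])
  from filterlim_compose[OF assms(1) this]
  have "((\<lambda>q. h (q * x) / (q * x) * x) \<longlongrightarrow> l * x) at_top" by (intro tendsto_intros)
  then show ?thesis using assms(2) by simp
qed

lemma quotient_limit_at_bot:
  fixes h :: "real \<Rightarrow> real"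
  assumes "((\<lambda>y. h y / y) \<longlongrightarrow> l) at_bot" and "x < 0"
  shows "((\<lambda>q. h (q * x) / q) \<longlongrightarrow> l * x) at_top"
proof -
  have "filterlim (\<lambda>q. q * x) at_bot at_top"
    using filterlim_tendsto_neg_mult_at_bot[OF tendsto_const assms(2) filterlim_ident]
    by (simp add: mult.commute)
  from filterlim_compose[OF assms(1) this]
  have "((\<lambda>q. h (q * x) / (q * x) * x) \<longlongrightarrow> l * x) at_top" by (intro tendsto_intros)
  then show ?thesis using assms(2) by simp
qed

text \<open>
  The limit is required on the limiting arc only. The limiting force is harmonic on each side
  of zero with its own frequency, so this applies to one half wave at a time.
\<close>

lemma osc_tendsto_harmonic:
  fixes g :: "real \<Rightarrow> real \<Rightarrow> real"
  assumes ac: "a \<le> c" and \<omega>: "\<omega> \<noteq> 0" and L: "0 \<le> L"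
    and lip: "\<And>q x y. \<bar>g q x - g q y\<bar> \<le> L * \<bar>x - y\<bar>" and g0: "\<And>q. g q 0 = 0"
    and lim: "\<And>t. a < t \<Longrightarrow> t < c \<Longrightarrow>
      ((\<lambda>q. g q (fst (harmonic \<omega> a z t))) \<longlongrightarrow> \<omega>\<^sup>2 * fst (harmonic \<omega> a z t)) at_top"
    and X: "\<And>q. solves (\<lambda>_. osc (g q)) (X q)" and init: "((\<lambda>q. X q a) \<longlongrightarrow> z) at_top"
  shows "((\<lambda>q. X q c) \<longlongrightarrow> harmonic \<omega> a z c) at_top"
proof -
  have W: "solves (hill (\<lambda>_. \<omega>\<^sup>2)) (harmonic \<omega> a z)" by (rule solves_harmonic[OF \<omega>])
  have W_cont: "continuous_on S (harmonic \<omega> a z)" for S by (rule solves_continuous[OF W])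
  have "compact (harmonic \<omega> a z ` {a..c})"
    by (rule compact_continuous_image[OF W_cont compact_Icc])
  from compact_imp_bounded[OF this] obtain B where "\<forall>y \<in> harmonic \<omega> a z ` {a..c}. norm y \<le> B"
    unfolding bounded_iff ..
  then have B: "norm (harmonic \<omega> a z t) \<le> B" if "t \<in> {a..c}" for t using that by simp
  show ?thesis
  proof (rule solutions_tendsto[where G = "\<lambda>q _. osc (g q)" and L = "1 + L" and B = "(1 + L) * B", OF ac _ _ X W])
    show *: "norm (osc (g q) u - osc (g q) v) \<le> (1 + L) * norm (u - v)" for q t u v
      by (rule osc_lipschitz[OF L lip])
    have "continuous_on UNIV (osc (g q))" for q
      by (rule continuous_on_lipschitz[of "1 + L"]) (use L * in auto)
    from continuous_on_compose2[OF this W_cont]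
    show "continuous_on UNIV (\<lambda>t. osc (g q) (harmonic \<omega> a z t))" for q by simp
    show "continuous_on UNIV (\<lambda>t. hill (\<lambda>_. \<omega>\<^sup>2) t (harmonic \<omega> a z t))"
      unfolding hill_def by (intro continuous_intros W_cont)
    show "((\<lambda>q. osc (g q) (harmonic \<omega> a z t)) \<longlongrightarrow> hill (\<lambda>_. \<omega>\<^sup>2) t (harmonic \<omega> a z t)) at_top"
      if "a < t" "t < c" for t
      unfolding hill_def osc_def using lim[OF that] by (auto intro!: tendsto_eq_intros)
    show "norm (osc (g q) (harmonic \<omega> a z t)) \<le> (1 + L) * B" if "t \<in> {a..c}" for q t
    proof -
      have "osc (g q) 0 = 0" by (simp add: osc_def g0 prod_eq_iff)
      then have "norm (osc (g q) (harmonic \<omega> a z t)) \<le> (1 + L) * norm (harmonic \<omega> a z t)"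
        using *[of q "harmonic \<omega> a z t" 0] by simp
      also have "\<dots> \<le> (1 + L) * B" using L B[OF that] by (intro mult_left_mono) auto
      finally show ?thesis .
    qed
  qed (use L init in auto)
qed

lemma hill_lipschitz_in_time:
  assumes K: "\<And>t. \<bar>P t\<bar> \<le> K" and \<zeta>: "solves (hill P) \<zeta>"
    and R: "\<bar>t - s\<bar> \<le> R" "\<bar>t' - s\<bar> \<le> R"
  shows "norm (\<zeta> t - \<zeta> t') \<le> (1 + K) * exp ((2 + K) * R) * norm (\<zeta> s) * \<bar>t - t'\<bar>"
proof -
  have K0: "0 \<le> K" using K[of 0] by linarith
  define C where "C = (1 + K) * exp ((2 + K) * R) * norm (\<zeta> s)"
  have bound: "norm (\<zeta> v - \<zeta> u) \<le> C * v - C * u" if "u < v" "\<bar>u - s\<bar> \<le> R" "\<bar>v - s\<bar> \<le> R" for u v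
  proof (rule differentiable_bound_general[OF \<open>u < v\<close>, where f' = "\<lambda>t. hill P t (\<zeta> t)" and \<phi>' = "\<lambda>_. C"])
    show "continuous_on {u..v} \<zeta>" by (rule solves_continuous[OF \<zeta>])
    show "(\<zeta> has_vector_derivative hill P x (\<zeta> x)) (at x)" for x by (rule solvesD[OF \<zeta>])
    show "((\<lambda>t. C * t) has_vector_derivative C) (at x)" for x
      unfolding has_real_derivative_iff_has_vector_derivative[symmetric]
      by (auto intro!: derivative_eq_intros)
    fix x assume "u < x" "x < v"
    then have x: "\<bar>x - s\<bar> \<le> R" using that by linarith
    have "norm (\<zeta> x) \<le> exp ((2 + K) * \<bar>x - s\<bar>) * norm (\<zeta> s)" by (rule hill_growth[OF K \<zeta>])
    also have "\<dots> \<le> exp ((2 + K) * R) * norm (\<zeta> s)"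
      using x K0 by (intro mult_right_mono) (auto intro: mult_left_mono)
    finally have "(1 + K) * norm (\<zeta> x) \<le> (1 + K) * (exp ((2 + K) * R) * norm (\<zeta> s))"
      using K0 by (intro mult_left_mono) auto
    then show "norm (hill P x (\<zeta> x)) \<le> C"
      using norm_hill_le[where P = P and t = x, OF K, of "\<zeta> x"] by (simp add: C_def mult.assoc)
  qed (intro continuous_intros)
  have "norm (\<zeta> t - \<zeta> t') \<le> C * \<bar>t - t'\<bar>"
  proof (cases t t' rule: linorder_cases)
    case less
    then show ?thesis using bound[OF less R]
      by (simp add: norm_minus_commute right_diff_distrib)
  next
    case greater
    then show ?thesis using bound[OF greater R(2,1)] by (simp add: right_diff_distrib)
  qed simp
  then show ?thesis by (simp add: C_def)
qed

lemma tendsto_fst_snd_iff: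
  fixes f :: "'a \<Rightarrow> real \<times> real"
  shows "(f \<longlongrightarrow> l) F \<longleftrightarrow> ((\<lambda>x. fst (f x)) \<longlongrightarrow> fst l) F \<and> ((\<lambda>x. snd (f x)) \<longlongrightarrow> snd l) F"
proof
  assume "((\<lambda>x. fst (f x)) \<longlongrightarrow> fst l) F \<and> ((\<lambda>x. snd (f x)) \<longlongrightarrow> snd l) F"
  then have "((\<lambda>x. (fst (f x), snd (f x))) \<longlongrightarrow> (fst l, snd l)) F"
    by (intro tendsto_Pair) auto
  then show "(f \<longlongrightarrow> l) F" by simp
qed (auto intro: tendsto_fst tendsto_snd)

text \<open>
  The monodromy matrix is taken from \<open>s = - \<pi>/(2 \<omega>p)\<close>, a zero of the limiting
  oscillation, so that the limiting period consists of exactly two pieces: with \<open>b = \<pi>/(2 \<omega>p)\<close> and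
  \<open>e = b + \<pi>/\<omega>m\<close>, a positive arc on \<open>(-b, b)\<close> and a negative arc on \<open>(b, e)\<close>. The period \<open>T\<close> itself depends on \<open>q\<close>; it is located by a sign
  change of the velocity near the minimum of the limiting motion, and the Hill solutions are
  Lipschitz in time uniformly in \<open>q\<close>, so replacing \<open>s + T\<close> by \<open>e\<close> costs little.
\<close>

theorem large_amplitude_hill_trace:
  fixes h P :: "real \<Rightarrow> real" and \<omega>p \<omega>m Ap Am :: real
  defines "s \<equiv> - (pi / (2 * \<omega>p))"
  defines "\<tau>0 \<equiv> 2 * (cos (Ap / \<omega>p * pi) * cos (Am / \<omega>m * pi)
      - (Ap / Am + Am / Ap) / 2 * sin (Ap / \<omega>p * pi) * sin (Am / \<omega>m * pi))"
  assumes pos: "0 < \<omega>p" "0 < \<omega>m" "0 < Ap" "0 < Am"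
    and L: "0 \<le> L" and lip: "\<And>x y. \<bar>h x - h y\<bar> \<le> L * \<bar>x - y\<bar>" and h0: "h 0 = 0"
    and h_top: "((\<lambda>y. h y / y) \<longlongrightarrow> \<omega>p\<^sup>2) at_top" and h_bot: "((\<lambda>y. h y / y) \<longlongrightarrow> \<omega>m\<^sup>2) at_bot"
    and P_cont: "continuous_on UNIV P" and K: "\<And>y. \<bar>P y\<bar> \<le> K"
    and P_top: "(P \<longlongrightarrow> Ap\<^sup>2) at_top" and P_bot: "(P \<longlongrightarrow> Am\<^sup>2) at_bot"
    and \<xi>: "\<And>q. solves (\<lambda>_. osc h) (\<xi> q)" and \<xi>0: "\<And>q. \<xi> q 0 = (q, 0)"
    and Z1: "\<And>q. solves (hill (\<lambda>t. P (fst (\<xi> q t)))) (Z1 q)" "\<And>q. Z1 q s = (1, 0)"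
    and Z2: "\<And>q. solves (hill (\<lambda>t. P (fst (\<xi> q t)))) (Z2 q)" "\<And>q. Z2 q s = (0, 1)"
    and \<epsilon>: "0 < \<epsilon>"
  shows "\<forall>\<^sub>F q in at_top. \<exists>T>0. (\<forall>t. \<xi> q (t + T) = \<xi> q t) \<and>
    \<bar>fst (Z1 q (s + T)) + snd (Z2 q (s + T)) - \<tau>0\<bar> < \<epsilon>"
proof -
  define b where "b = pi / (2 * \<omega>p)"
  define e where "e = b + pi / \<omega>m"
  have b: "0 < b" and be: "b < e" and s: "s = - b"
    using pos by (auto simp: b_def e_def s_def)
  have K0: "0 \<le> K" using K[of 0] by linarith
  define g where "g q x = h (q * x) / q" for q x
  have g_lip: "\<bar>g q x - g q y\<bar> \<le> L * \<bar>x - y\<bar>" for q x y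
  proof (cases "q = 0")
    case False
    have "\<bar>g q x - g q y\<bar> = \<bar>h (q * x) - h (q * y)\<bar> / \<bar>q\<bar>"
      by (simp add: g_def diff_divide_distrib[symmetric])
    also have "\<dots> \<le> L * \<bar>q * x - q * y\<bar> / \<bar>q\<bar>" by (intro divide_right_mono lip) auto
    also have "\<dots> = L * \<bar>x - y\<bar>"
      using False by (simp add: right_diff_distrib[symmetric] abs_mult)
    finally show ?thesis .
  qed (use L in \<open>simp add: g_def\<close>)
  have g0: "g q 0 = 0" for q by (simp add: g_def h0)
  define U where "U q t = (fst (\<xi> q t) / q, snd (\<xi> q t) / q)" for q t
  have U: "solves (\<lambda>_. osc (g q)) (U q)" for q
    using osc_scale[OF \<xi> h0, of q q] unfolding U_def g_def by simp
  have \<xi>_U: "fst (\<xi> q t) = q * fst (U q t)" "snd (\<xi> q t) = q * snd (U q t)" if "0 < q" for q t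
    using that by (auto simp: U_def)
  have U0: "((\<lambda>q. U q 0) \<longlongrightarrow> (1, 0)) at_top"
  proof (rule tendsto_eventually)
    show "\<forall>\<^sub>F q in at_top. U q 0 = (1, 0)"
      using eventually_gt_at_top[of 0] by eventually_elim (simp add: U_def \<xi>0)
  qed
  have cos_pos: "0 < cos (\<omega>p * t)" if "\<bar>t\<bar> < b" for t
  proof -
    have "\<bar>\<omega>p * t\<bar> < pi / 2"
      using that pos(1) by (simp add: b_def abs_mult field_simps)
    then show ?thesis by (intro cos_gt_zero_pi) auto
  qed
  have arc_p: "harmonic \<omega>p 0 (1, 0) t = (cos (\<omega>p * t), - \<omega>p * sin (\<omega>p * t))" for t
    by (simp add: harmonic_def)
  have U_fwd: "((\<lambda>q. U q t) \<longlongrightarrow> harmonic \<omega>p 0 (1, 0) t) at_top" if t: "0 \<le> t" "t \<le> b" for t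
  proof (rule osc_tendsto_harmonic[where g = g, OF t(1) _ L g_lip g0 _ U U0])
    fix r assume r: "0 < r" "r < t"
    then have "0 < cos (\<omega>p * r)" using t by (intro cos_pos) auto
    from quotient_limit_at_top[OF h_top this]
    show "((\<lambda>q. g q (fst (harmonic \<omega>p 0 (1, 0) r))) \<longlongrightarrow> \<omega>p\<^sup>2 * fst (harmonic \<omega>p 0 (1, 0) r)) at_top"
      by (simp add: g_def arc_p)
  qed (use pos in auto)
  \<comment> \<open>The motion is even in time, which covers the part of the positive arc before time zero.\<close>
  have U_p: "((\<lambda>q. fst (U q t)) \<longlongrightarrow> cos (\<omega>p * t)) at_top" if "\<bar>t\<bar> \<le> b" for t
  proof (cases "0 \<le> t")
    case True
    then show ?thesis using U_fwd[of t] that by (simp add: tendsto_fst_snd_iff arc_p)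
  next
    case False
    have "fst (U q t) = fst (U q (- t))" for q
      using osc_symmetric[OF L lip \<xi>, of q 0 t] by (simp add: \<xi>0 U_def)
    then show ?thesis using U_fwd[of "- t"] that False by (simp add: tendsto_fst_snd_iff arc_p)
  qed
  have Ub: "((\<lambda>q. U q b) \<longlongrightarrow> (0, - \<omega>p)) at_top"
  proof -
    have "\<omega>p * b = pi / 2" using pos by (simp add: b_def)
    then have "harmonic \<omega>p 0 (1, 0) b = (0, - \<omega>p)" unfolding arc_p by (simp only: cos_pi_half sin_pi_half) simp
    then show ?thesis using U_fwd[of b] b by simp
  qed
  have arc_m: "harmonic \<omega>m b (0, - \<omega>p) t
      = (- (\<omega>p / \<omega>m * sin (\<omega>m * (t - b))), - (\<omega>p * cos (\<omega>m * (t - b))))" for t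
    by (simp add: harmonic_def)
  have sin_pos: "0 < \<omega>p / \<omega>m * sin (\<omega>m * (t - b))" if "b < t" "t < e" for t
    using that pos by (intro mult_pos_pos divide_pos_pos sin_gt_zero) (auto simp: e_def field_simps)
  have U_m: "((\<lambda>q. U q t) \<longlongrightarrow> harmonic \<omega>m b (0, - \<omega>p) t) at_top" if t: "b \<le> t" "t \<le> e" for t
  proof (rule osc_tendsto_harmonic[where g = g, OF t(1) _ L g_lip g0 _ U Ub])
    fix r assume r: "b < r" "r < t"
    then have "fst (harmonic \<omega>m b (0, - \<omega>p) r) < 0" using sin_pos[of r] t by (simp add: arc_m)
    from quotient_limit_at_bot[OF h_bot this]
    show "((\<lambda>q. g q (fst (harmonic \<omega>m b (0, - \<omega>p) r))) \<longlongrightarrow> \<omega>m\<^sup>2 * fst (harmonic \<omega>m b (0, - \<omega>p) r)) at_top"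
      by (simp add: g_def)
  qed (use pos in auto)
  define p where "p q t = P (fst (\<xi> q t))" for q t
  have p_cont: "continuous_on UNIV (p q)" for q
    unfolding p_def
    by (rule continuous_on_compose2[OF P_cont continuous_on_fst[OF solves_continuous[OF \<xi>]]]) auto
  have p_K: "\<bar>p q t\<bar> \<le> K" for q t by (simp add: p_def K)
  have p_eq: "\<forall>\<^sub>F q in at_top. P (q * fst (U q t)) = p q t" for t
    using eventually_gt_at_top[of 0] by eventually_elim (simp add: p_def \<xi>_U)
  have p_plus: "((\<lambda>q. p q t) \<longlongrightarrow> Ap\<^sup>2) at_top" if "- b < t" "t < b" for t
  proof -
    have "filterlim (\<lambda>q. fst (U q t) * q) at_top at_top"
      using U_p[of t] cos_pos[of t] that
      by (intro filterlim_tendsto_pos_mult_at_top[where c = "cos (\<omega>p * t)"] filterlim_ident) auto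
    from filterlim_compose[OF P_top this] show ?thesis
      using p_eq[of t] by (auto simp: mult.commute elim: Lim_transform_eventually)
  qed
  have p_minus: "((\<lambda>q. p q t) \<longlongrightarrow> Am\<^sup>2) at_top" if "b < t" "t < e" for t
  proof -
    have "((\<lambda>q. fst (U q t)) \<longlongrightarrow> - (\<omega>p / \<omega>m * sin (\<omega>m * (t - b)))) at_top"
      using U_m[of t] that by (simp add: tendsto_fst_snd_iff arc_m)
    then have "filterlim (\<lambda>q. fst (U q t) * q) at_bot at_top"
      by (rule filterlim_tendsto_neg_mult_at_bot) (use sin_pos[OF that] in \<open>auto simp: filterlim_ident\<close>)
    from filterlim_compose[OF P_bot this] show ?thesis
      using p_eq[of t] by (auto simp: mult.commute elim: Lim_transform_eventually)
  qed
  have hill_lim: "((\<lambda>q. Z q e) \<longlongrightarrow> harmonic Am b (harmonic Ap s z b) e) at_top"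
    if Z: "\<And>q. solves (hill (p q)) (Z q)" "\<And>q. Z q s = z" for Z z
  proof (rule hill_tendsto_harmonic[OF _ _ p_cont p_K p_minus Z(1)])
    show "((\<lambda>q. Z q b) \<longlongrightarrow> harmonic Ap s z b) at_top"
      by (rule hill_tendsto_harmonic[OF _ _ p_cont p_K p_plus Z(1)]) (use b pos in \<open>auto simp: s Z(2)[unfolded s]\<close>)
  qed (use be pos in auto)
  have Z1': "solves (hill (p q)) (Z1 q)" and Z2': "solves (hill (p q)) (Z2 q)" for q
    using Z1(1)[of q] Z2(1)[of q] by (simp_all add: p_def[abs_def])
  have trace_lim: "((\<lambda>q. fst (Z1 q e) + snd (Z2 q e)) \<longlongrightarrow> \<tau>0) at_top"
  proof -
    have "((\<lambda>q. fst (Z1 q e) + snd (Z2 q e)) \<longlongrightarrow>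
        fst (harmonic Am b (harmonic Ap s (1, 0) b) e) + snd (harmonic Am b (harmonic Ap s (0, 1) b) e)) at_top"
      by (intro tendsto_intros hill_lim Z1' Z1(2) Z2' Z2(2))
    also have "fst (harmonic Am b (harmonic Ap s (1, 0) b) e) + snd (harmonic Am b (harmonic Ap s (0, 1) b) e) = \<tau>0"
    proof -
      have phases: "Ap * (b - s) = Ap / \<omega>p * pi" "Am * (e - b) = Am / \<omega>m * pi"
        using pos by (auto simp: s b_def e_def)
      show ?thesis
        unfolding harmonic_def \<tau>0_def phases fst_conv snd_conv using pos by (simp add: field_simps)
    qed
    finally show ?thesis .
  qed
  \<comment> \<open>The limiting motion has its minimum at \<open>m\<close>, half a period after the start. Its velocity
    changes sign there, so the rescaled motion has a turning point within \<open>\<sigma>\<close> of \<open>m\<close>.\<close>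
  define T0 where "T0 = e - s"
  define m where "m = b + pi / (2 * \<omega>m)"
  have m: "b < m" "m < e" "T0 = 2 * m" using pos by (auto simp: m_def e_def T0_def s field_simps)
  have period: "\<forall>\<^sub>F q in at_top. \<exists>T>0. (\<forall>t. \<xi> q (t + T) = \<xi> q t) \<and> \<bar>T - T0\<bar> \<le> 2 * \<sigma>"
    if \<sigma>: "0 < \<sigma>" "\<sigma> < pi / (2 * \<omega>m)" for \<sigma>
  proof -
    have em: "e - m = pi / (2 * \<omega>m)" "m - b = pi / (2 * \<omega>m)" using pos by (auto simp: e_def m_def field_simps)
    have wm: "\<omega>m * (m - b) = pi / 2" using pos by (simp add: m_def)
    have w\<sigma>: "0 < \<omega>m * \<sigma>" "\<omega>m * \<sigma> < pi / 2" using \<sigma> pos by (auto simp: field_simps)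
    have l: "((\<lambda>q. snd (U q (m - \<sigma>))) \<longlongrightarrow> - (\<omega>p * cos (\<omega>m * (m - \<sigma> - b)))) at_top"
      using U_m[of "m - \<sigma>"] \<sigma> em m by (simp add: tendsto_fst_snd_iff arc_m)
    have r: "((\<lambda>q. snd (U q (m + \<sigma>))) \<longlongrightarrow> - (\<omega>p * cos (\<omega>m * (m + \<sigma> - b)))) at_top"
      using U_m[of "m + \<sigma>"] \<sigma> em m by (simp add: tendsto_fst_snd_iff arc_m)
    have "cos (\<omega>m * (m - \<sigma> - b)) = sin (\<omega>m * \<sigma>)"
    proof -
      have "\<omega>m * (m - \<sigma> - b) = pi / 2 - \<omega>m * \<sigma>" unfolding wm[symmetric] by (simp add: algebra_simps)
      then show ?thesis by (simp add: cos_diff)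
    qed
    moreover have "cos (\<omega>m * (m + \<sigma> - b)) = - sin (\<omega>m * \<sigma>)"
    proof -
      have "\<omega>m * (m + \<sigma> - b) = pi / 2 + \<omega>m * \<sigma>" unfolding wm[symmetric] by (simp add: algebra_simps)
      then show ?thesis by (simp add: cos_add)
    qed
    moreover have "0 < sin (\<omega>m * \<sigma>)" using w\<sigma> by (intro sin_gt_zero) auto
    ultimately have "\<forall>\<^sub>F q in at_top. snd (U q (m - \<sigma>)) < 0" "\<forall>\<^sub>F q in at_top. 0 < snd (U q (m + \<sigma>))"
      using order_tendstoD(2)[OF l, of 0] order_tendstoD(1)[OF r, of 0] pos by auto
    then show ?thesis
      using eventually_gt_at_top[of 0]
    proof eventually_elim
      case (elim q)
      have "continuous_on {m - \<sigma>..m + \<sigma>} (\<lambda>t. snd (\<xi> q t))"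
        by (rule continuous_on_snd[OF solves_continuous[OF \<xi>]])
      then have "\<exists>x\<ge>m - \<sigma>. x \<le> m + \<sigma> \<and> snd (\<xi> q x) = 0"
        using elim \<sigma> by (intro IVT') (auto simp: \<xi>_U mult_less_0_iff intro: less_imp_le mult_nonneg_nonpos)
      then obtain x where x: "m - \<sigma> \<le> x" "x \<le> m + \<sigma>" "snd (\<xi> q x) = 0" by blast
      have "0 < x" using x(1) \<sigma> em(2) b by linarith
      moreover have "\<xi> q (t + 2 * x) = \<xi> q t" for t
        by (rule osc_periodic[OF L lip \<xi>]) (auto simp: \<xi>0 x)
      moreover have "\<bar>2 * x - T0\<bar> \<le> 2 * \<sigma>" using x m(3) by linarith
      ultimately show ?case by (intro exI[of _ "2 * x"]) auto
    qed
  qed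
  \<comment> \<open>\<open>R\<close> bounds the distance from \<open>s\<close> of both end points, and \<open>C\<close> is the Lipschitz constant in
    time of the Hill solutions within that distance.\<close>
  define R where "R = T0 + 2 * (pi / (2 * \<omega>m))"
  define C where "C = (1 + K) * exp ((2 + K) * R)"
  have C: "0 < C" using K0 by (simp add: C_def)
  define \<sigma> where "\<sigma> = min (pi / (4 * \<omega>m)) (\<epsilon> / (8 * C))"
  have \<sigma>: "0 < \<sigma>" "\<sigma> < pi / (2 * \<omega>m)" "8 * C * \<sigma> \<le> \<epsilon>"
  proof -
    show "0 < \<sigma>" using pos \<epsilon> C by (simp add: \<sigma>_def)
    have "pi / (4 * \<omega>m) < pi / (2 * \<omega>m)" using pos by (simp add: field_simps)
    then show "\<sigma> < pi / (2 * \<omega>m)" by (simp add: \<sigma>_def)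
    have "\<sigma> \<le> \<epsilon> / (8 * C)" by (simp add: \<sigma>_def)
    then show "8 * C * \<sigma> \<le> \<epsilon>" using C by (simp add: field_simps)
  qed
  have "\<forall>\<^sub>F q in at_top. \<bar>fst (Z1 q e) + snd (Z2 q e) - \<tau>0\<bar> < \<epsilon> / 2"
    using tendstoD[OF trace_lim, of "\<epsilon> / 2"] \<epsilon> by (simp add: dist_real_def)
  with period[OF \<sigma>(1,2)] show ?thesis
  proof eventually_elim
    case (elim q)
    then obtain T where T: "0 < T" "\<And>t. \<xi> q (t + T) = \<xi> q t" "\<bar>T - T0\<bar> \<le> 2 * \<sigma>" by blast
    have close: "norm (Z (s + T) - Z e) \<le> C * (2 * \<sigma>)"
      if Z: "solves (hill (p q)) Z" "norm (Z s) = 1" for Z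
    proof -
      have "norm (Z (s + T) - Z e) \<le> (1 + K) * exp ((2 + K) * R) * norm (Z s) * \<bar>s + T - e\<bar>"
      proof (rule hill_lipschitz_in_time[OF p_K Z(1)])
        show "\<bar>s + T - s\<bar> \<le> R" "\<bar>e - s\<bar> \<le> R"
          using T(1,3) \<sigma>(1,2) m b by (auto simp: R_def T0_def)
      qed
      also have "\<dots> \<le> C * (2 * \<sigma>)"
        unfolding C_def[symmetric] Z(2) using T(3) C by (simp add: T0_def add.commute add_diff_eq)
      finally show ?thesis .
    qed
    have "\<bar>fst (Z1 q (s + T)) - fst (Z1 q e)\<bar> \<le> C * (2 * \<sigma>)"
      using close[OF Z1'] norm_planar_le(1)[of "Z1 q (s + T) - Z1 q e"] by (simp add: Z1(2) norm_Pair)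
    moreover have "\<bar>snd (Z2 q (s + T)) - snd (Z2 q e)\<bar> \<le> C * (2 * \<sigma>)"
      using close[OF Z2'] norm_planar_le(2)[of "Z2 q (s + T) - Z2 q e"] by (simp add: Z2(2) norm_Pair)
    ultimately have "\<bar>fst (Z1 q (s + T)) + snd (Z2 q (s + T)) - \<tau>0\<bar> < \<epsilon>"
      using elim(2) \<sigma>(3) by linarith
    with T show ?case by blast
  qed
qed

section \<open>The average of a squared sine over the positive arches of another\<close>

lemma sin_arch_pos:
  fixes j i :: nat
  assumes "0 < j" and "2 * real i * pi / real j < x" and "x < (2 * real i + 1) * pi / real j"
  shows "0 < sin (real j * x)"
proof -
  have "sin (real j * x) = sin (real j * x - 2 * real i * pi)"
    by (simp add: sin_diff)
  also have "\<dots> > 0"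
    using assms by (intro sin_gt_zero) (auto simp: field_simps)
  finally show ?thesis .
qed

lemma sin_arch_nonpos:
  fixes j i :: nat
  assumes "0 < j" and "(2 * real i + 1) * pi / real j \<le> x" and "x \<le> (2 * real i + 2) * pi / real j"
  shows "sin (real j * x) \<le> 0"
proof -
  have "sin (real j * x) = - sin (real j * x - 2 * real i * pi - pi)"
    by (simp add: sin_diff)
  also have "\<dots> \<le> 0"
    unfolding neg_le_0_iff_le using assms by (intro sin_ge_zero) (auto simp: field_simps)
  finally show ?thesis .
qed

text \<open>
  The positive arches of \<open>sin jx\<close> are the intervals from \<open>2 i \<pi>/j\<close> to \<open>(2 i + 1) \<pi>/j\<close>; the induction
  adds one negative and one positive arch at a time.
\<close>

lemma has_integral_positive_arches:
  fixes G \<Gamma> :: "real \<Rightarrow> real" and j :: nat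
  assumes j: "0 < j" and \<Gamma>: "\<And>x. (\<Gamma> has_real_derivative G x) (at x)"
  shows "((\<lambda>x. if 0 < sin (real j * x) then G x else 0) has_integral
      (\<Sum>i\<le>n. \<Gamma> ((2 * real i + 1) * pi / real j) - \<Gamma> (2 * real i * pi / real j)))
      {0..(2 * real n + 1) * pi / real j}"
proof -
  let ?g = "\<lambda>x. if 0 < sin (real j * x) then G x else 0"
  have pos: "(?g has_integral (\<Gamma> ((2 * real i + 1) * pi / real j) - \<Gamma> (2 * real i * pi / real j)))
      {2 * real i * pi / real j..(2 * real i + 1) * pi / real j}" for i :: nat
  proof (rule has_integral_spike_finite[where f = G and
        S = "{2 * real i * pi / real j, (2 * real i + 1) * pi / real j}"])
    show "(G has_integral (\<Gamma> ((2 * real i + 1) * pi / real j) - \<Gamma> (2 * real i * pi / real j)))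
      {2 * real i * pi / real j..(2 * real i + 1) * pi / real j}"
      by (rule fundamental_theorem_of_calculus)
        (use \<Gamma> j in \<open>auto simp: has_real_derivative_iff_has_vector_derivative[symmetric]
          intro: has_field_derivative_at_within divide_right_mono\<close>)
  qed (use sin_arch_pos[OF j, of i] in auto)
  have neg: "(?g has_integral 0) {(2 * real i + 1) * pi / real j..(2 * real i + 2) * pi / real j}" for i :: nat
    by (rule has_integral_is_0) (use sin_arch_nonpos[OF j, of i] in fastforce)
  show ?thesis
  proof (induction n)
    case 0
    show ?case using pos[of 0] by simp
  next
    case (Suc n)
    have 1: "(?g has_integral (\<Sum>i\<le>n. \<Gamma> ((2 * real i + 1) * pi / real j) - \<Gamma> (2 * real i * pi / real j)) + 0)
        {0..(2 * real n + 2) * pi / real j}"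
      by (rule has_integral_combine[OF _ _ Suc neg]) (use j in \<open>auto intro!: divide_right_mono\<close>)
    have "(?g has_integral ((\<Sum>i\<le>n. \<Gamma> ((2 * real i + 1) * pi / real j) - \<Gamma> (2 * real i * pi / real j)) + 0)
        + (\<Gamma> ((2 * real (Suc n) + 1) * pi / real j) - \<Gamma> (2 * real (Suc n) * pi / real j)))
        {0..(2 * real (Suc n) + 1) * pi / real j}"
    proof (rule has_integral_combine[OF _ _ _ pos])
      show "(?g has_integral (\<Sum>i\<le>n. \<Gamma> ((2 * real i + 1) * pi / real j) - \<Gamma> (2 * real i * pi / real j)) + 0)
        {0..2 * real (Suc n) * pi / real j}"
        using 1 by (simp add: algebra_simps)
    qed (use j in \<open>auto intro!: divide_right_mono\<close>)
    then show ?case by simp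
  qed
qed

text \<open>
  Multiplication by \<open>2 cos h\<close> makes the sum telescope, as
  \<open>2 cos h sin a = sin (a + h) + sin (a - h)\<close>.
\<close>

lemma alternating_sine_sum:
  fixes h :: real
  shows "cos h * (\<Sum>i\<le>n. sin ((2 * real i + 1) * (2 * h)) - sin (2 * real i * (2 * h)))
    = (sin h + sin ((4 * real n + 3) * h)) / 2"
proof (induction n)
  case 0
  have "sin (2 * h + h) + sin (2 * h - h) = 2 * (sin (2 * h) * cos h)"
    unfolding sin_add sin_diff by simp
  moreover have "2 * h + h = 3 * h" "2 * h - h = h" by simp_all
  ultimately have "sin (3 * h) + sin h = 2 * (sin (2 * h) * cos h)" by (simp only:)
  then show ?case by (simp add: algebra_simps)
next
  case (Suc n)
  define a where "a = (4 * real n + 5) * h"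
  have "cos h * (sin (a + h) - sin (a - h)) = cos a * (2 * sin h * cos h)"
    by (simp add: sin_add sin_diff)
  also have "\<dots> = cos a * sin (2 * h)" by (simp only: sin_double)
  also have "\<dots> = (sin (a + 2 * h) - sin (a - 2 * h)) / 2"
    unfolding sin_add sin_diff by simp
  finally have *: "cos h * (sin (a + h) - sin (a - h)) = (sin (a + 2 * h) - sin (a - 2 * h)) / 2" .
  have "a + h = (2 * real (Suc n) + 1) * (2 * h)" "a - h = 2 * real (Suc n) * (2 * h)"
    "a + 2 * h = (4 * real (Suc n) + 3) * h" "a - 2 * h = (4 * real n + 3) * h"
    by (simp_all add: a_def algebra_simps)
  from *[unfolded this] Suc show ?case by (simp only: sum.atMost_Suc distrib_left) (simp add: field_simps)
qed

text \<open>
  A zero would give \<open>2 k = i j\<close> with \<open>i\<close> odd, which parity excludes.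
\<close>

lemma cos_odd_fraction_nonzero:
  assumes "odd (j::nat)"
  shows "cos (pi * real k / real j) \<noteq> 0"
proof
  assume "cos (pi * real k / real j) = 0"
  then obtain i :: int where i: "odd i" "pi * real k / real j = of_int i * (pi / 2)"
    unfolding cos_zero_iff_int by blast
  have j: "0 < j" using assms by (auto intro: Nat.gr0I)
  have "pi * (2 * real k) = pi * (of_int i * real j)"
    using i(2) j by (simp add: field_simps)
  then have "2 * real k = of_int i * real j" by (simp only: mult_left_cancel[OF pi_neq_zero])
  then have "of_int (2 * int k) = (of_int (i * int j) :: real)" by simp
  then have "2 * int k = i * int j" by (simp only: of_int_eq_iff)
  then have "even (i * int j)" by (metis dvd_triv_left)
  with i(1) assms show False by simp
qed

lemma sine_square_derivative:
  fixes k :: nat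
  assumes "0 < k"
  shows "((\<lambda>x. x / 2 - sin (2 * real k * x) / (4 * real k)) has_real_derivative (sin (real k * x))\<^sup>2) (at x)"
proof -
  have "cos (2 * (real k * x)) = 1 - 2 * (sin (real k * x))\<^sup>2" by (rule cos_double_sin)
  then have "1 / 2 - cos (2 * real k * x) * (2 * real k) / (4 * real k) = (sin (real k * x))\<^sup>2"
    using assms by (simp add: mult.assoc field_simps)
  then show ?thesis
    using assms by (auto intro!: derivative_eq_intros)
qed

lemma has_integral_sine_square:
  assumes "0 < (k::nat)"
  shows "((\<lambda>x. (sin (real k * x))\<^sup>2) has_integral pi / 2) {0..pi}"
proof -
  have "((\<lambda>x. (sin (real k * x))\<^sup>2) has_integral
      ((pi / 2 - sin (2 * real k * pi) / (4 * real k)) - (0 / 2 - sin (2 * real k * 0) / (4 * real k)))) {0..pi}"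
    by (rule fundamental_theorem_of_calculus)
      (use sine_square_derivative[OF assms] in \<open>auto simp: has_real_derivative_iff_has_vector_derivative[symmetric]
          intro: has_field_derivative_at_within\<close>)
  then show ?thesis by simp
qed

text \<open>
  The primitive \<open>x/2 - sin (2 k x)/(4 k)\<close>, summed over the \<open>(j + 1)/2\<close> positive arches in \<open>[0, \<pi>]\<close>,
  leaves an alternating sum of sines. Multiplied by \<open>cos h\<close>, \<open>h = \<pi> k/j\<close>, that sum telescopes to
  \<open>sin h\<close>, because the last term \<open>sin (2 k \<pi> + h)\<close> equals the first. This is the origin of the
  tangent in \<open>eps\<close>.
\<close>

lemma has_integral_positive_sine_square:
  fixes j k :: nat
  assumes j: "odd j" and k: "0 < k"
  shows "((\<lambda>x. if 0 < sin (real j * x) then (sin (real k * x))\<^sup>2 else 0) has_integral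
    pi / 4 * (1 + eps j k)) {0..pi}"
proof -
  obtain n where n: "j = 2 * n + 1" using j by (rule oddE)
  then have j0: "0 < j" and rj: "real j = 2 * real n + 1" by auto
  define h where "h = pi * real k / real j"
  define S where "S = (\<Sum>i\<le>n. sin ((2 * real i + 1) * (2 * h)) - sin (2 * real i * (2 * h)))"
  have "sin ((4 * real n + 3) * h) = sin h"
  proof -
    have "(4 * real n + 3) * h = 2 * (real j * h) + h" by (simp add: rj algebra_simps)
    also have "\<dots> = 2 * real k * pi + h" using j0 by (simp add: h_def)
    finally show ?thesis by (simp add: sin_add)
  qed
  then have "cos h * S = sin h" using alternating_sine_sum[of h n] by (simp add: S_def)
  then have S: "S = tan h"
    using cos_odd_fraction_nonzero[OF j, of k] by (simp add: tan_def h_def[symmetric] field_simps)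
  let ?\<Gamma> = "\<lambda>x. x / 2 - sin (2 * real k * x) / (4 * real k)"
  have "(\<Sum>i\<le>n. ?\<Gamma> ((2 * real i + 1) * pi / real j) - ?\<Gamma> (2 * real i * pi / real j))
      = (\<Sum>i\<le>n. pi / (2 * real j)
          - (sin ((2 * real i + 1) * (2 * h)) - sin (2 * real i * (2 * h))) / (4 * real k))"
  proof (rule sum.cong[OF refl])
    fix i
    have "2 * real k * ((2 * real i + 1) * pi / real j) = (2 * real i + 1) * (2 * h)"
      "2 * real k * (2 * real i * pi / real j) = 2 * real i * (2 * h)"
      by (simp_all add: h_def)
    then show "?\<Gamma> ((2 * real i + 1) * pi / real j) - ?\<Gamma> (2 * real i * pi / real j)
      = pi / (2 * real j) - (sin ((2 * real i + 1) * (2 * h)) - sin (2 * real i * (2 * h))) / (4 * real k)"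
      using j0 k by (simp only:) (simp add: field_simps)
  qed
  also have "\<dots> = real (n + 1) * (pi / (2 * real j)) - S / (4 * real k)"
    unfolding sum_subtractf[of "\<lambda>_. pi / (2 * real j)"] sum_divide_distrib[symmetric] S_def by simp
  also have "real (n + 1) = (real j + 1) / 2" by (simp add: rj)
  also have "(real j + 1) / 2 * (pi / (2 * real j)) - S / (4 * real k) = pi / 4 * (1 + eps j k)"
    using j0 k unfolding S eps_def h_def by (simp add: field_simps)
  finally have total: "(\<Sum>i\<le>n. ?\<Gamma> ((2 * real i + 1) * pi / real j) - ?\<Gamma> (2 * real i * pi / real j))
      = pi / 4 * (1 + eps j k)" .
  have end_point: "(2 * real n + 1) * pi / real j = pi" using j0 by (simp add: rj[symmetric])
  show ?thesis
    using has_integral_positive_arches[OF j0 sine_square_derivative[OF k], of n]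
    unfolding total end_point .
qed

text \<open>
  Since \<open>tan \<pi> = 0\<close>, the constant \<open>1/j\<close> in \<open>\<omega>\<^sub>\<plusminus>\<close> is the case \<open>k = j\<close> of the constant in \<open>A\<^sub>\<plusminus>\<close>,
  and one integral serves for both.
\<close>

lemma eps_diagonal: "0 < j \<Longrightarrow> eps j j = 1 / real j"
  by (simp add: eps_def)

lemma eps_range:
  assumes "odd j" and "0 < k"
  shows "- 1 \<le> eps j k" and "eps j k \<le> 1"
proof -
  note I = has_integral_positive_sine_square[OF assms]
  have "0 \<le> pi / 4 * (1 + eps j k)"
    by (rule has_integral_nonneg[OF I]) auto
  then show "- 1 \<le> eps j k" using pi_gt_zero by (auto simp: zero_le_mult_iff)
  have "pi / 4 * (1 + eps j k) \<le> pi / 2"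
    by (rule has_integral_le[OF I has_integral_sine_square[OF assms(2)]]) auto
  then have "pi * (1 + eps j k) \<le> pi * 2" by simp
  then show "eps j k \<le> 1" by (simp only: mult_le_cancel_left_pos[OF pi_gt_zero])
qed

section \<open>The restoring force and its mode averages\<close>

lemma locally_bounded_imp_bounded_Icc:
  fixes f :: "real \<Rightarrow> real"
  assumes "\<And>x. \<exists>B. \<forall>\<^sub>F y in nhds x. \<bar>f y\<bar> \<le> B"
  shows "\<exists>B. \<forall>x\<in>{a..b}. \<bar>f x\<bar> \<le> B"
proof -
  obtain B where B: "\<And>x. \<forall>\<^sub>F y in nhds x. \<bar>f y\<bar> \<le> B x" using assms by metis
  then obtain U where U: "\<And>x. open (U x)" "\<And>x. x \<in> U x" "\<And>x y. y \<in> U x \<Longrightarrow> \<bar>f y\<bar> \<le> B x"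
    unfolding eventually_nhds by metis
  have "{a..b} \<subseteq> (\<Union>x\<in>{a..b}. U x)" using U(2) by blast
  then obtain D where D: "finite D" "{a..b} \<subseteq> (\<Union>x\<in>D. U x)"
    by (rule compactE_image[OF compact_Icc U(1)])
  have "\<bar>f y\<bar> \<le> (\<Sum>x\<in>D. \<bar>B x\<bar>)" if y: "y \<in> {a..b}" for y
  proof -
    obtain x where x: "x \<in> D" "y \<in> U x" using D(2) y by blast
    have "\<bar>f y\<bar> \<le> \<bar>B x\<bar>" using U(3)[OF x(2)] by linarith
    also have "\<dots> \<le> (\<Sum>x\<in>D. \<bar>B x\<bar>)"
      using D(1) x(1) by (intro member_le_sum) auto
    finally show ?thesis .
  qed
  then show ?thesis by blast
qed

text \<open>
  The exceptional sets in the averages over \<open>x\<close> are finite unions of such level sets.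
\<close>

lemma countable_sin_level:
  fixes j :: nat and c :: real
  assumes "j > 0"
  shows "countable {x. sin (real j * x) = c}"
proof (cases "\<exists>x0. sin (real j * x0) = c")
  case True
  then obtain x0 where x0: "sin (real j * x0) = c" by blast
  have "x \<in> (\<lambda>n::int. (real j * x0 + 2 * of_int n * pi) / real j) ` UNIV
      \<union> (\<lambda>n::int. (- (real j * x0) + (2 * of_int n + 1) * pi) / real j) ` UNIV"
    if "sin (real j * x) = c" for x
  proof -
    from that x0 have "sin (real j * x) = sin (real j * x0)" by simp
    then obtain n :: int where "real j * x = real j * x0 + 2 * of_int n * pi
        \<or> real j * x = - (real j * x0) + (2 * of_int n + 1) * pi"
      unfolding sin_eq by (auto elim!: Ints_cases)
    then have "x = (real j * x0 + 2 * of_int n * pi) / real j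
        \<or> x = (- (real j * x0) + (2 * of_int n + 1) * pi) / real j"
      using assms by (metis nonzero_mult_div_cancel_left of_nat_0_eq_iff less_irrefl_nat)
    then show ?thesis by blast
  qed
  then have "{x. sin (real j * x) = c} \<subseteq> (\<lambda>n::int. (real j * x0 + 2 * of_int n * pi) / real j) ` UNIV
      \<union> (\<lambda>n::int. (- (real j * x0) + (2 * of_int n + 1) * pi) / real j) ` UNIV" by blast
  then show ?thesis by (rule countable_subset) auto
qed auto

locale asymmetric_force =
  fixes f :: "real \<Rightarrow> real" and R :: "real set" and M :: real
  assumes f_cont: "continuous_on UNIV f"
    and f_zero: "f 0 = 0"
    and R_finite: "finite R"
    and R_zero: "0 \<notin> R"
    and f_diff: "\<And>r. r \<notin> R \<Longrightarrow> f differentiable (at r)"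
    and f_C1: "continuous_on (- R) (deriv f)"
    and f_left: "\<And>r. r \<in> R \<Longrightarrow> \<exists>l. (deriv f \<longlongrightarrow> l) (at_left r)"
    and f_right: "\<And>r. r \<in> R \<Longrightarrow> \<exists>l. (deriv f \<longlongrightarrow> l) (at_right r)"
    and f_minus: "(deriv f \<longlongrightarrow> 0) at_bot"
    and f_plus: "(deriv f \<longlongrightarrow> M) at_top"
begin

lemma open_smooth: "open (- R)"
  using R_finite by (simp add: finite_imp_closed open_Compl)

lemma f_deriv: "r \<notin> R \<Longrightarrow> (f has_real_derivative deriv f r) (at r)"
  using f_diff[of r] DERIV_deriv_iff_real_differentiable by blast

lemma isCont_deriv: "r \<notin> R \<Longrightarrow> isCont (deriv f) r"
  using f_C1 open_smooth by (simp add: continuous_on_eq_continuous_at)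

lemma eventually_bounded_of_tendsto:
  fixes g :: "real \<Rightarrow> real"
  assumes "(g \<longlongrightarrow> l) F"
  shows "\<forall>\<^sub>F y in F. \<bar>g y\<bar> \<le> \<bar>l\<bar> + 1"
  using tendstoD[OF assms, of 1] by (auto simp: dist_real_def elim!: eventually_mono)

text \<open>
  One-sided limits exist at every point, at smooth points by continuity.
\<close>

lemma deriv_locally_bounded: "\<exists>B. \<forall>\<^sub>F y in nhds x. \<bar>deriv f y\<bar> \<le> B"
proof -
  obtain l r where l: "(deriv f \<longlongrightarrow> l) (at_left x)" and r: "(deriv f \<longlongrightarrow> r) (at_right x)"
  proof (cases "x \<in> R")
    case True
    then show ?thesis using that f_left f_right by metis
  next
    case False
    then have "(deriv f \<longlongrightarrow> deriv f x) (at x)" using isCont_deriv by (simp add: isCont_def)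
    then show ?thesis using that filterlim_at_split by blast
  qed
  define B where "B = \<bar>l\<bar> + \<bar>r\<bar> + \<bar>deriv f x\<bar> + 1"
  have "\<forall>\<^sub>F y in at_left x. \<bar>deriv f y\<bar> \<le> B" "\<forall>\<^sub>F y in at_right x. \<bar>deriv f y\<bar> \<le> B"
    using eventually_bounded_of_tendsto[OF l] eventually_bounded_of_tendsto[OF r]
    by (auto simp: B_def elim!: eventually_mono)
  then have "\<forall>\<^sub>F y in at x. \<bar>deriv f y\<bar> \<le> B"
    by (simp add: at_eq_sup_left_right eventually_sup)
  then have "\<forall>\<^sub>F y in nhds x. \<bar>deriv f y\<bar> \<le> B"
    by (subst eventually_nhds_conv_at) (simp add: B_def)
  then show ?thesis ..
qed

lemma deriv_bounded: "\<exists>L\<ge>0. \<forall>x. \<bar>deriv f x\<bar> \<le> L"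
proof -
  obtain b where b: "\<And>y. b \<le> y \<Longrightarrow> \<bar>deriv f y\<bar> \<le> \<bar>M\<bar> + 1"
    using eventually_bounded_of_tendsto[OF f_plus] unfolding eventually_at_top_linorder by blast
  obtain a where a: "\<And>y. y \<le> a \<Longrightarrow> \<bar>deriv f y\<bar> \<le> 1"
    using eventually_bounded_of_tendsto[OF f_minus] unfolding eventually_at_bot_linorder by auto
  obtain B where B: "\<And>x. x \<in> {a..b} \<Longrightarrow> \<bar>deriv f x\<bar> \<le> B"
    using locally_bounded_imp_bounded_Icc[of "deriv f" a b] deriv_locally_bounded by blast
  have "\<bar>deriv f x\<bar> \<le> \<bar>M\<bar> + 1 + \<bar>B\<bar>" for x
    using a[of x] b[of x] B[of x] by (cases "x \<le> a"; cases "b \<le> x") auto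
  then show ?thesis by (intro exI[of _ "\<bar>M\<bar> + 1 + \<bar>B\<bar>"]) auto
qed

definition slope_bound :: real where
  "slope_bound = (SOME L. L \<ge> 0 \<and> (\<forall>x. \<bar>deriv f x\<bar> \<le> L))"

lemma slope_bound: "0 \<le> slope_bound" "\<bar>deriv f x\<bar> \<le> slope_bound"
  using someI_ex[OF deriv_bounded] unfolding slope_bound_def by auto

text \<open>
  The fundamental theorem of calculus tolerates the finitely many corners of \<open>f\<close>.
\<close>

lemma f_lipschitz: "\<bar>f x - f y\<bar> \<le> slope_bound * \<bar>x - y\<bar>"
proof -
  have *: "\<bar>f y - f x\<bar> \<le> slope_bound * (y - x)" if "x \<le> y" for x y
  proof -
    have "(deriv f has_integral (f y - f x)) (cbox x y)"
      unfolding cbox_interval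
      by (rule fundamental_theorem_of_calculus_interior_strong[OF R_finite that])
        (use f_deriv in \<open>auto simp: has_real_derivative_iff_has_vector_derivative[symmetric]
          intro: continuous_on_subset[OF f_cont]\<close>)
    from has_integral_bound[OF slope_bound(1) this] show ?thesis
      using slope_bound(2) that by simp
  qed
  show ?thesis using *[of x y] *[of y x] by (cases "x \<le> y") (auto simp: abs_minus_commute)
qed

lemma f_abs_le: "\<bar>f x\<bar> \<le> slope_bound * \<bar>x\<bar>"
  using f_lipschitz[of x 0] by (simp add: f_zero)

lemma deriv_measurable: "deriv f \<in> borel_measurable borel"
  using borel_measurable_continuous_countable_exceptions[OF countable_finite[OF R_finite] f_C1] .

lemma eventually_smooth:
  "\<forall>\<^sub>F x in at_top. x \<notin> R" "\<forall>\<^sub>F x in at_bot. x \<notin> R"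
proof -
  have "\<forall>\<^sub>F x in at_top. \<forall>r\<in>R. x \<noteq> r" "\<forall>\<^sub>F x in at_bot. \<forall>r\<in>R. x \<noteq> r"
    by (auto intro!: eventually_ball_finite[OF R_finite]
      intro: eventually_mono[OF eventually_gt_at_top] eventually_mono[OF eventually_gt_at_bot])
  then show "\<forall>\<^sub>F x in at_top. x \<notin> R" "\<forall>\<^sub>F x in at_bot. x \<notin> R"
    by (auto elim!: eventually_mono)
qed

lemma f_quotient_top: "((\<lambda>x. f x / x) \<longlongrightarrow> M) at_top"
proof (rule lhospital_at_top_at_top[where f' = "deriv f" and g' = "\<lambda>_. 1"])
  show "\<forall>\<^sub>F x in at_top. (f has_real_derivative deriv f x) (at x)"
    using eventually_smooth(1) by eventually_elim (rule f_deriv)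
qed (use f_plus in \<open>auto simp: filterlim_ident\<close>)

lemma f_quotient_bot: "((\<lambda>x. f x / x) \<longlongrightarrow> 0) at_bot"
proof -
  have "((\<lambda>x. (- f (- x)) / x) \<longlongrightarrow> 0) at_top"
  proof (rule lhospital_at_top_at_top[where f' = "\<lambda>x. deriv f (- x)" and g' = "\<lambda>_. 1"])
    have "\<forall>\<^sub>F x in at_top. - x \<notin> R"
      using eventually_smooth(2) unfolding at_bot_mirror eventually_filtermap .
    then show "\<forall>\<^sub>F x in at_top. ((\<lambda>x. - f (- x)) has_real_derivative deriv f (- x)) (at x)"
    proof eventually_elim
      case (elim x)
      have "((\<lambda>x. - x) has_real_derivative - 1) (at x)" by (auto intro!: derivative_eq_intros)
      from DERIV_minus[OF DERIV_chain2[OF f_deriv[OF elim] this]] show ?case by simp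
    qed
    show "((\<lambda>x. deriv f (- x) / 1) \<longlongrightarrow> 0) at_top"
      using f_minus by (simp add: filterlim_at_bot_mirror)
  qed (auto simp: filterlim_ident)
  then show ?thesis by (simp add: filterlim_at_bot_mirror)
qed

text \<open>
  The symmetric difference quotient of \<open>f\<close>, completed by the derivative at increment zero. Dividing
  \<open>\<psi>\<^sub>2\<close> by \<open>z\<close> produces exactly these quotients under the integral.
\<close>

definition central_slope :: "real \<Rightarrow> real \<Rightarrow> real" where
  "central_slope a d = (if d = 0 then deriv f a else (f (a + d) - f (a - d)) / (2 * d))"

lemma central_slope_bounded: "\<bar>central_slope a d\<bar> \<le> slope_bound"
proof (cases "d = 0")
  case False
  have "\<bar>f (a + d) - f (a - d)\<bar> \<le> slope_bound * \<bar>2 * d\<bar>"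
    using f_lipschitz[of "a + d" "a - d"] by simp
  then show ?thesis using False by (simp add: central_slope_def divide_le_eq)
qed (simp add: central_slope_def slope_bound)

lemma central_slope_mult: "2 * d * central_slope a d = f (a + d) - f (a - d)"
  by (simp add: central_slope_def)

lemma central_slope_measurable [measurable]:
  "A \<in> borel_measurable borel \<Longrightarrow> D \<in> borel_measurable borel \<Longrightarrow>
    (\<lambda>x. central_slope (A x) (D x)) \<in> borel_measurable borel"
proof -
  assume [measurable]: "A \<in> borel_measurable borel" "D \<in> borel_measurable borel"
  have [measurable]: "f \<in> borel_measurable borel" "deriv f \<in> borel_measurable borel"
    by (rule borel_measurable_continuous_onI[OF f_cont], rule deriv_measurable)
  show ?thesis unfolding central_slope_def by measurable
qed

lemma central_slope_near:
  assumes "{a - \<bar>d\<bar>..a + \<bar>d\<bar>} \<subseteq> - R"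
  obtains \<xi> where "\<xi> \<in> {a - \<bar>d\<bar>..a + \<bar>d\<bar>}" "central_slope a d = deriv f \<xi>"
proof (cases "d = 0")
  case True
  then show ?thesis using that[of a] by (simp add: central_slope_def)
next
  case False
  have "\<exists>\<xi>. a - \<bar>d\<bar> < \<xi> \<and> \<xi> < a + \<bar>d\<bar> \<and> f (a + \<bar>d\<bar>) - f (a - \<bar>d\<bar>) = (a + \<bar>d\<bar> - (a - \<bar>d\<bar>)) * deriv f \<xi>"
    using False assms by (intro MVT2) (auto intro!: f_deriv)
  then obtain \<xi> where \<xi>: "a - \<bar>d\<bar> < \<xi>" "\<xi> < a + \<bar>d\<bar>"
    and eq: "f (a + \<bar>d\<bar>) - f (a - \<bar>d\<bar>) = 2 * \<bar>d\<bar> * deriv f \<xi>" by auto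
  have "central_slope a d = deriv f \<xi>"
    using eq False by (cases "0 < d") (auto simp: central_slope_def abs_if field_simps)
  then show ?thesis using that[of \<xi>] \<xi> by auto
qed

text \<open>
  For vanishing increment the quotient is a value of \<open>f'\<close> at a nearby point by the mean value
  theorem, and \<open>f'\<close> is continuous outside \<open>R\<close>.
\<close>

lemma central_slope_tendsto:
  assumes A: "(A \<longlongrightarrow> a) F" and D: "(D \<longlongrightarrow> d) F" and a: "a \<notin> R"
  shows "((\<lambda>x. central_slope (A x) (D x)) \<longlongrightarrow> central_slope a d) F"
proof (cases "d = 0")
  case False
  have f_lim: "((\<lambda>x. f (X x)) \<longlongrightarrow> f l) F" if "(X \<longlongrightarrow> l) F" for X l
    using continuous_on_tendsto_compose[OF f_cont that] by simp
  have "((\<lambda>x. (f (A x + D x) - f (A x - D x)) / (2 * D x)) \<longlongrightarrow> (f (a + d) - f (a - d)) / (2 * d)) F"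
    using False by (intro tendsto_intros f_lim A D) auto
  moreover have "\<forall>\<^sub>F x in F. D x \<noteq> 0"
    using tendsto_imp_eventually_ne[OF D False] .
  ultimately show ?thesis
    using False by (auto simp: central_slope_def elim!: Lim_transform_eventually eventually_mono)
next
  case True
  show ?thesis
  proof (rule tendstoI)
    fix e :: real assume e: "0 < e"
    have "(deriv f \<longlongrightarrow> deriv f a) (nhds a)"
      using isCont_deriv[OF a] by (simp add: isCont_def tendsto_at_iff_tendsto_nhds)
    from eventually_conj[OF eventually_nhds_in_open[OF open_smooth] tendstoD[OF this e]] a
    have "\<forall>\<^sub>F y in nhds a. y \<in> - R \<and> dist (deriv f y) (deriv f a) < e" by simp
    then obtain r where r: "0 < r" "\<And>y. dist y a < r \<Longrightarrow> y \<in> - R \<and> dist (deriv f y) (deriv f a) < e"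
      unfolding eventually_nhds_metric by blast
    have "\<forall>\<^sub>F x in F. dist (A x) a < r / 2" "\<forall>\<^sub>F x in F. dist (D x) 0 < r / 2"
      using tendstoD[OF A, of "r / 2"] tendstoD[OF D, of "r / 2"] r(1) True by auto
    then show "\<forall>\<^sub>F x in F. dist (central_slope (A x) (D x)) (central_slope a d) < e"
    proof eventually_elim
      case (elim x)
      have near: "dist y a < r" if "y \<in> {A x - \<bar>D x\<bar>..A x + \<bar>D x\<bar>}" for y
      proof -
        have "\<bar>y - A x\<bar> \<le> \<bar>D x\<bar>" using that by auto
        then show ?thesis
          using elim abs_triangle_ineq[of "y - A x" "A x - a"] by (simp add: dist_real_def)
      qed
      then have "{A x - \<bar>D x\<bar>..A x + \<bar>D x\<bar>} \<subseteq> - R" using r(2) by blast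
      then obtain \<xi> where "\<xi> \<in> {A x - \<bar>D x\<bar>..A x + \<bar>D x\<bar>}" "central_slope (A x) (D x) = deriv f \<xi>"
        by (rule central_slope_near)
      then show ?case using r(2)[OF near, of \<xi>] True by (simp add: central_slope_def)
    qed
  qed
qed

end

lemma abs_integral_le:
  fixes F :: "real \<Rightarrow> real"
  assumes "a \<le> b" and "0 \<le> B" and "\<And>x. x \<in> {a..b} \<Longrightarrow> \<bar>F x\<bar> \<le> B"
  shows "\<bar>integral {a..b} F\<bar> \<le> B * (b - a)"
proof (cases "F integrable_on {a..b}")
  case True
  then have "(F has_integral integral {a..b} F) (cbox a b)"
    by (simp add: cbox_interval has_integral_integral[symmetric])
  from has_integral_bound[OF assms(2) this] assms show ?thesis by simp
qed (use assms in \<open>simp add: not_integrable_integral\<close>)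

text \<open>
  As \<open>y \<rightarrow> +\<infinity>\<close> the factor \<open>\<phi>(y sin jx)\<close> tends to \<open>M\<close> where \<open>sin jx > 0\<close> and to zero where
  \<open>sin jx < 0\<close>; as \<open>y \<rightarrow> -\<infinity>\<close> the two cases are exchanged. The lemma is applied to \<open>f'\<close>, giving the transverse stiffness at large amplitude, and
  with \<open>k = j\<close> to \<open>f(r)/r\<close>, giving \<open>\<psi>\<^sub>1(y,0)/y\<close>.
\<close>

lemma weighted_average_limits:
  fixes \<phi> :: "real \<Rightarrow> real" and j k :: nat
  assumes meas: "\<phi> \<in> borel_measurable borel" and B: "\<And>r. \<bar>\<phi> r\<bar> \<le> B"
    and top: "(\<phi> \<longlongrightarrow> M) at_top" and bot: "(\<phi> \<longlongrightarrow> 0) at_bot"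
    and j: "odd j" and k: "0 < k"
  shows "((\<lambda>y. 4 / pi * integral {0..pi} (\<lambda>x. \<phi> (y * sin (real j * x)) * (sin (real k * x))\<^sup>2))
      \<longlongrightarrow> M * (1 + eps j k)) at_top"
    and "((\<lambda>y. 4 / pi * integral {0..pi} (\<lambda>x. \<phi> (y * sin (real j * x)) * (sin (real k * x))\<^sup>2))
      \<longlongrightarrow> M * (1 - eps j k)) at_bot"
proof -
  have j0: "0 < j" using j by (auto intro: Nat.gr0I)
  have B0: "0 \<le> B" using B[of 0] by linarith
  define H where "H x = (if 0 < sin (real j * x) then (sin (real k * x))\<^sup>2 else 0)" for x
  have H: "(H has_integral pi / 4 * (1 + eps j k)) {0..pi}"
    unfolding H_def by (rule has_integral_positive_sine_square[OF j k])
  note [measurable] = meas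
  have F_meas: "(\<lambda>x. \<phi> (y * sin (real j * x)) * (sin (real k * x))\<^sup>2) \<in> borel_measurable borel" for y
    by measurable
  have F_le: "\<bar>\<phi> (y * sin (real j * x)) * (sin (real k * x))\<^sup>2\<bar> \<le> B" for x y
  proof -
    have "\<bar>\<phi> (y * sin (real j * x)) * (sin (real k * x))\<^sup>2\<bar> \<le> B * 1"
      unfolding abs_mult using B B0 abs_square_le_1[of "sin (real k * x)"]
      by (intro mult_mono) auto
    then show ?thesis by simp
  qed
  have N: "countable {x. sin (real j * x) = 0}" by (rule countable_sin_level[OF j0])
  have H_meas: "H \<in> borel_measurable borel" unfolding H_def by measurable
  show "((\<lambda>y. 4 / pi * integral {0..pi} (\<lambda>x. \<phi> (y * sin (real j * x)) * (sin (real k * x))\<^sup>2))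
      \<longlongrightarrow> M * (1 + eps j k)) at_top"
  proof (rule tendsto_at_topI_sequentially)
    fix Q :: "nat \<Rightarrow> real" assume Q: "filterlim Q at_top sequentially"
    have "(\<lambda>n. integral {0..pi} (\<lambda>x. \<phi> (Q n * sin (real j * x)) * (sin (real k * x))\<^sup>2))
        \<longlonglongrightarrow> integral {0..pi} (\<lambda>x. M * H x)"
    proof (rule integral_tendsto_bounded[OF F_meas _ F_le N])
      show "(\<lambda>x. M * H x) \<in> borel_measurable borel" using H_meas by measurable
      fix x assume x: "x \<in> {0..pi} - {x. sin (real j * x) = 0}"
      then consider "0 < sin (real j * x)" | "sin (real j * x) < 0" by fastforce
      then show "(\<lambda>n. \<phi> (Q n * sin (real j * x)) * (sin (real k * x))\<^sup>2) \<longlonglongrightarrow> M * H x"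
      proof cases
        case 1
        have "filterlim (\<lambda>n. sin (real j * x) * Q n) at_top sequentially"
          by (rule filterlim_tendsto_pos_mult_at_top[OF tendsto_const 1 Q])
        from tendsto_mult[OF filterlim_compose[OF top this] tendsto_const[of "(sin (real k * x))\<^sup>2"]]
        show ?thesis using 1 by (simp add: H_def mult.commute)
      next
        case 2
        have "filterlim (\<lambda>n. sin (real j * x) * Q n) at_bot sequentially"
          by (rule filterlim_tendsto_neg_mult_at_bot[OF tendsto_const 2 Q])
        from tendsto_mult[OF filterlim_compose[OF bot this] tendsto_const]
        show ?thesis using 2 by (simp add: H_def mult.commute)
      qed
    qed
    from tendsto_mult[OF tendsto_const[of "4 / pi"] this]
    show "(\<lambda>n. 4 / pi * integral {0..pi} (\<lambda>x. \<phi> (Q n * sin (real j * x)) * (sin (real k * x))\<^sup>2))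
        \<longlonglongrightarrow> M * (1 + eps j k)"
      by (simp add: integral_unique[OF H])
  qed
  show "((\<lambda>y. 4 / pi * integral {0..pi} (\<lambda>x. \<phi> (y * sin (real j * x)) * (sin (real k * x))\<^sup>2))
      \<longlongrightarrow> M * (1 - eps j k)) at_bot"
    unfolding filterlim_at_bot_mirror
  proof (rule tendsto_at_topI_sequentially)
    fix Q :: "nat \<Rightarrow> real" assume Q: "filterlim Q at_top sequentially"
    have "(\<lambda>n. integral {0..pi} (\<lambda>x. \<phi> (- Q n * sin (real j * x)) * (sin (real k * x))\<^sup>2))
        \<longlonglongrightarrow> integral {0..pi} (\<lambda>x. M * ((sin (real k * x))\<^sup>2 - H x))"
    proof (rule integral_tendsto_bounded[OF F_meas _ F_le N])
      show "(\<lambda>x. M * ((sin (real k * x))\<^sup>2 - H x)) \<in> borel_measurable borel" using H_meas by measurable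
      fix x assume x: "x \<in> {0..pi} - {x. sin (real j * x) = 0}"
      then consider "0 < sin (real j * x)" | "sin (real j * x) < 0" by fastforce
      then show "(\<lambda>n. \<phi> (- Q n * sin (real j * x)) * (sin (real k * x))\<^sup>2) \<longlonglongrightarrow> M * ((sin (real k * x))\<^sup>2 - H x)"
      proof cases
        case 1
        then have "filterlim (\<lambda>n. - sin (real j * x) * Q n) at_bot sequentially"
          by (intro filterlim_tendsto_neg_mult_at_bot[OF tendsto_const _ Q]) auto
        from tendsto_mult[OF filterlim_compose[OF bot this] tendsto_const]
        show ?thesis using 1 by (simp add: H_def mult.commute)
      next
        case 2
        then have "filterlim (\<lambda>n. - sin (real j * x) * Q n) at_top sequentially"
          by (intro filterlim_tendsto_pos_mult_at_top[OF tendsto_const _ Q]) auto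
        from tendsto_mult[OF filterlim_compose[OF top this] tendsto_const[of "(sin (real k * x))\<^sup>2"]]
        show ?thesis using 2 by (simp add: H_def mult.commute)
      qed
    qed
    from tendsto_mult[OF tendsto_const[of "4 / pi"] this]
    have "(\<lambda>n. 4 / pi * integral {0..pi} (\<lambda>x. \<phi> (- Q n * sin (real j * x)) * (sin (real k * x))\<^sup>2))
        \<longlonglongrightarrow> 4 / pi * (M * (pi / 2 - pi / 4 * (1 + eps j k)))"
      using integral_unique[OF has_integral_mult_right[OF has_integral_diff[OF has_integral_sine_square[OF k] H], of M]]
      by (simp only:)
    also have "4 / pi * (M * (pi / 2 - pi / 4 * (1 + eps j k))) = M * (1 - eps j k)"
      by (simp add: field_simps)
    finally show "(\<lambda>n. 4 / pi * integral {0..pi} (\<lambda>x. \<phi> (- Q n * sin (real j * x)) * (sin (real k * x))\<^sup>2))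
        \<longlonglongrightarrow> M * (1 - eps j k)" .
  qed
qed

context asymmetric_force
begin

lemma continuous_on_f_modes [continuous_intros]:
  "continuous_on S (\<lambda>x. f (y * sin (real j * x) + z * sin (real k * x)))"
  "continuous_on S (\<lambda>x. f (y * sin (real j * x) - z * sin (real k * x)))"
  by (rule continuous_on_compose2[OF f_cont]; auto intro!: continuous_intros)+

lemma f_modes_diff:
  assumes "\<bar>a\<bar> \<le> 1" "\<bar>b\<bar> \<le> 1"
  shows "\<bar>f (y * a + z * b) - f (y' * a + z' * b)\<bar> \<le> slope_bound * (\<bar>y - y'\<bar> + \<bar>z - z'\<bar>)"
    and "\<bar>f (y * a - z * b) - f (y' * a - z' * b)\<bar> \<le> slope_bound * (\<bar>y - y'\<bar> + \<bar>z - z'\<bar>)"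
proof -
  have ya: "\<bar>(y - y') * a\<bar> \<le> \<bar>y - y'\<bar>" and zb: "\<bar>(z - z') * b\<bar> \<le> \<bar>z - z'\<bar>"
    using assms by (simp_all add: abs_mult mult_left_le)
  have "\<bar>(y * a + z * b) - (y' * a + z' * b)\<bar> \<le> \<bar>y - y'\<bar> + \<bar>z - z'\<bar>"
    using abs_triangle_ineq[of "(y - y') * a" "(z - z') * b"] ya zb by (simp add: algebra_simps)
  then show "\<bar>f (y * a + z * b) - f (y' * a + z' * b)\<bar> \<le> slope_bound * (\<bar>y - y'\<bar> + \<bar>z - z'\<bar>)"
    using order_trans[OF f_lipschitz mult_left_mono[OF _ slope_bound(1)]] by blast
  have "\<bar>(y * a - z * b) - (y' * a - z' * b)\<bar> \<le> \<bar>y - y'\<bar> + \<bar>z - z'\<bar>"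
    using abs_triangle_ineq4[of "(y - y') * a" "(z - z') * b"] ya zb by (simp add: algebra_simps)
  then show "\<bar>f (y * a - z * b) - f (y' * a - z' * b)\<bar> \<le> slope_bound * (\<bar>y - y'\<bar> + \<bar>z - z'\<bar>)"
    using order_trans[OF f_lipschitz mult_left_mono[OF _ slope_bound(1)]] by blast
qed

lemma mode_average_lipschitz:
  fixes F :: "real \<Rightarrow> real \<Rightarrow> real \<Rightarrow> real"
  assumes cont: "\<And>y z. continuous_on {0..pi} (F y z)"
    and F: "\<And>x. \<bar>F y z x - F y' z' x\<bar> \<le> 2 * slope_bound * (\<bar>y - y'\<bar> + \<bar>z - z'\<bar>)"
  shows "\<bar>2 / pi * integral {0..pi} (F y z) - 2 / pi * integral {0..pi} (F y' z')\<bar>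
    \<le> 4 * slope_bound * (\<bar>y - y'\<bar> + \<bar>z - z'\<bar>)"
proof -
  have "integral {0..pi} (F y z) - integral {0..pi} (F y' z') = integral {0..pi} (\<lambda>x. F y z x - F y' z' x)"
    by (intro integral_diff[symmetric] integrable_continuous_real cont)
  moreover have "\<bar>integral {0..pi} (\<lambda>x. F y z x - F y' z' x)\<bar>
      \<le> (2 * slope_bound * (\<bar>y - y'\<bar> + \<bar>z - z'\<bar>)) * (pi - 0)"
    using slope_bound(1) by (intro abs_integral_le F) auto
  ultimately have "\<bar>2 / pi * (integral {0..pi} (F y z) - integral {0..pi} (F y' z'))\<bar>
      \<le> 2 / pi * ((2 * slope_bound * (\<bar>y - y'\<bar> + \<bar>z - z'\<bar>)) * pi)"
    unfolding abs_mult by (intro mult_mono) auto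
  then show ?thesis by (simp add: right_diff_distrib)
qed

lemma psi_lipschitz:
  "\<bar>psi1 f j k y z - psi1 f j k y' z'\<bar> \<le> 4 * slope_bound * (\<bar>y - y'\<bar> + \<bar>z - z'\<bar>)"
  "\<bar>psi2 f j k y z - psi2 f j k y' z'\<bar> \<le> 4 * slope_bound * (\<bar>y - y'\<bar> + \<bar>z - z'\<bar>)"
proof -
  have *: "\<bar>(p + e * r) * s - (p' + e * r') * s\<bar> \<le> 2 * D" if "\<bar>p - p'\<bar> \<le> D" "\<bar>r - r'\<bar> \<le> D" "\<bar>s\<bar> \<le> 1" "\<bar>e\<bar> = 1"
    for p p' r r' s D e :: real
  proof -
    have "\<bar>(p + e * r) * s - (p' + e * r') * s\<bar> = \<bar>(p - p') + e * (r - r')\<bar> * \<bar>s\<bar>"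
      by (simp add: abs_mult[symmetric] algebra_simps)
    also have "\<dots> \<le> \<bar>(p - p') + e * (r - r')\<bar> * 1" using that by (intro mult_left_mono) auto
    also have "\<dots> \<le> \<bar>p - p'\<bar> + \<bar>e * (r - r')\<bar>" by simp
    also have "\<dots> \<le> 2 * D" using that by (simp add: abs_mult)
    finally show ?thesis .
  qed
  show "\<bar>psi1 f j k y z - psi1 f j k y' z'\<bar> \<le> 4 * slope_bound * (\<bar>y - y'\<bar> + \<bar>z - z'\<bar>)"
    unfolding psi1_def
    using *[where e = 1 and s = "sin (real j * x)" for x, OF f_modes_diff(1,2)]
    by (intro mode_average_lipschitz[where F = "\<lambda>y z x. (f (y * sin (real j * x) + z * sin (real k * x))
      + f (y * sin (real j * x) - z * sin (real k * x))) * sin (real j * x)"] continuous_intros)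
      (simp add: mult.assoc)
  show "\<bar>psi2 f j k y z - psi2 f j k y' z'\<bar> \<le> 4 * slope_bound * (\<bar>y - y'\<bar> + \<bar>z - z'\<bar>)"
    unfolding psi2_def
    using *[where e = "-1" and s = "sin (real k * x)" for x, OF f_modes_diff(1,2)]
    by (intro mode_average_lipschitz[where F = "\<lambda>y z x. (f (y * sin (real j * x) + z * sin (real k * x))
      - f (y * sin (real j * x) - z * sin (real k * x))) * sin (real k * x)"] continuous_intros)
      (simp add: mult.assoc)
qed

text \<open>
  The quotient \<open>\<psi>\<^sub>2(y,z)/z\<close>, extended by the partial derivative of \<open>\<psi>\<^sub>2\<close> in \<open>z\<close> at \<open>z = 0\<close>.
\<close>

definition stiffness :: "nat \<Rightarrow> nat \<Rightarrow> real \<Rightarrow> real \<Rightarrow> real" where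
  "stiffness j k y z = 4 / pi * integral {0..pi}
     (\<lambda>x. central_slope (y * sin (real j * x)) (z * sin (real k * x)) * (sin (real k * x))\<^sup>2)"

lemma psi2_eq_stiffness: "psi2 f j k y z = z * stiffness j k y z"
proof -
  have "(\<lambda>x. (f (y * sin (real j * x) + z * sin (real k * x))
      - f (y * sin (real j * x) - z * sin (real k * x))) * sin (real k * x))
    = (\<lambda>x. (2 * z) *\<^sub>R (central_slope (y * sin (real j * x)) (z * sin (real k * x)) * (sin (real k * x))\<^sup>2))"
    unfolding central_slope_mult[symmetric] by (simp add: power2_eq_square algebra_simps)
  then show ?thesis
    unfolding psi2_def stiffness_def by (simp only: integral_cmul) simp
qed

lemma stiffness_integrand_le:
  "\<bar>central_slope a d * (sin x)\<^sup>2\<bar> \<le> slope_bound"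
proof -
  have "\<bar>central_slope a d * (sin x)\<^sup>2\<bar> \<le> slope_bound * 1"
    unfolding abs_mult using central_slope_bounded slope_bound(1) abs_square_le_1[of "sin x"]
    by (intro mult_mono) auto
  then show ?thesis by simp
qed

lemma stiffness_integrand_measurable:
  "(\<lambda>x. central_slope (y * sin (real j * x)) (z * sin (real k * x)) * (sin (real k * x))\<^sup>2)
    \<in> borel_measurable borel"
  by (intro borel_measurable_times central_slope_measurable borel_measurable_continuous_onI continuous_intros)

lemma stiffness_bounded: "\<bar>stiffness j k y z\<bar> \<le> 4 * slope_bound"
proof -
  have "\<bar>integral {0..pi} (\<lambda>x. central_slope (y * sin (real j * x)) (z * sin (real k * x)) * (sin (real k * x))\<^sup>2)\<bar>
      \<le> slope_bound * (pi - 0)"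
    by (intro abs_integral_le stiffness_integrand_le slope_bound) auto
  then have "\<bar>stiffness j k y z\<bar> \<le> 4 / pi * (slope_bound * pi)"
    unfolding stiffness_def abs_mult by (intro mult_mono) auto
  then show ?thesis by simp
qed

text \<open>
  At \<open>(y,z)\<close> the integrand is discontinuous only for those \<open>x\<close> with \<open>y sin jx \<in> R\<close>. These are
  countably many when \<open>y \<noteq> 0\<close>; when \<open>y = 0\<close> there are none, because \<open>0 \<notin> R\<close>.
\<close>

lemma stiffness_continuous:
  assumes j: "0 < j"
  shows "continuous_on UNIV (\<lambda>(y, z). stiffness j k y z)"
  unfolding continuous_on_sequentially
proof (intro allI ballI impI)
  fix p :: "nat \<Rightarrow> real \<times> real" and a :: "real \<times> real"
  assume p: "(\<forall>n. p n \<in> UNIV) \<and> p \<longlonglongrightarrow> a"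
  define N where "N = (if fst a = 0 then {} else (\<Union>r\<in>R. {x. sin (real j * x) = r / fst a}))"
  have N: "countable N"
    unfolding N_def using R_finite countable_sin_level[OF j] by (auto intro: countable_finite)
  have smooth: "fst a * sin (real j * x) \<notin> R" if "x \<notin> N" for x
  proof
    assume *: "fst a * sin (real j * x) \<in> R"
    then have "fst a \<noteq> 0" using R_zero by auto
    then have "sin (real j * x) = (fst a * sin (real j * x)) / fst a" by simp
    with * \<open>fst a \<noteq> 0\<close> that show False unfolding N_def by auto
  qed
  have "(\<lambda>n. integral {0..pi} (\<lambda>x. central_slope (fst (p n) * sin (real j * x)) (snd (p n) * sin (real k * x)) * (sin (real k * x))\<^sup>2))
    \<longlonglongrightarrow> integral {0..pi} (\<lambda>x. central_slope (fst a * sin (real j * x)) (snd a * sin (real k * x)) * (sin (real k * x))\<^sup>2)"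
  proof (rule integral_tendsto_bounded[OF stiffness_integrand_measurable stiffness_integrand_measurable
        stiffness_integrand_le N])
    fix x assume "x \<in> {0..pi} - N"
    then show "(\<lambda>n. central_slope (fst (p n) * sin (real j * x)) (snd (p n) * sin (real k * x)) * (sin (real k * x))\<^sup>2)
      \<longlonglongrightarrow> central_slope (fst a * sin (real j * x)) (snd a * sin (real k * x)) * (sin (real k * x))\<^sup>2"
      using p by (intro tendsto_intros central_slope_tendsto smooth) auto
  qed
  from tendsto_mult[OF tendsto_const[of "4 / pi"] this]
  show "((\<lambda>(y, z). stiffness j k y z) \<circ> p) \<longlonglongrightarrow> (case a of (y, z) \<Rightarrow> stiffness j k y z)"
    by (simp add: o_def split_def stiffness_def)
qed

lemma stiffness_limits:
  assumes "odd j" and "0 < k"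
  shows "((\<lambda>y. stiffness j k y 0) \<longlongrightarrow> M * (1 + eps j k)) at_top"
    and "((\<lambda>y. stiffness j k y 0) \<longlongrightarrow> M * (1 - eps j k)) at_bot"
  using weighted_average_limits[OF deriv_measurable slope_bound(2) f_plus f_minus assms]
  by (simp_all add: stiffness_def central_slope_def)

lemma psi1_quotient_limits:
  assumes j: "odd j"
  shows "((\<lambda>y. psi1 f j k y 0 / y) \<longlongrightarrow> M * (1 + 1 / real j)) at_top"
    and "((\<lambda>y. psi1 f j k y 0 / y) \<longlongrightarrow> M * (1 - 1 / real j)) at_bot"
proof -
  have j0: "0 < j" using j by (auto intro: Nat.gr0I)
  define I where "I y = 4 / pi * integral {0..pi} (\<lambda>x. (\<lambda>r. f r / r) (y * sin (real j * x)) * (sin (real j * x))\<^sup>2)" for y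
  have meas: "(\<lambda>r. f r / r) \<in> borel_measurable borel"
    using borel_measurable_continuous_onI[OF f_cont] by measurable
  have "\<bar>f r / r\<bar> \<le> slope_bound" for r
    using f_abs_le[of r] slope_bound(1) by (cases "r = 0") (auto simp: divide_le_eq)
  note lims = weighted_average_limits[OF meas this f_quotient_top f_quotient_bot j j0, folded I_def]
  have eq: "psi1 f j k y 0 = y * I y" for y
  proof -
    have "(\<lambda>x. (f (y * sin (real j * x) + 0 * sin (real k * x)) + f (y * sin (real j * x) - 0 * sin (real k * x))) * sin (real j * x))
      = (\<lambda>x. (2 * y) *\<^sub>R ((\<lambda>r. f r / r) (y * sin (real j * x)) * (sin (real j * x))\<^sup>2))"
      by (auto simp: fun_eq_iff power2_eq_square f_zero)
    then show ?thesis
      unfolding psi1_def I_def by (simp only: integral_cmul) simp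
  qed
  have "\<forall>\<^sub>F y in at_top. I y = psi1 f j k y 0 / y" "\<forall>\<^sub>F y in at_bot. I y = psi1 f j k y 0 / y"
    by (rule eventually_mono[OF eventually_gt_at_top[of 0]], simp add: eq,
        rule eventually_mono[OF eventually_gt_at_bot[of 0]], simp add: eq)
  with lims show "((\<lambda>y. psi1 f j k y 0 / y) \<longlongrightarrow> M * (1 + 1 / real j)) at_top"
    "((\<lambda>y. psi1 f j k y 0 / y) \<longlongrightarrow> M * (1 - 1 / real j)) at_bot"
    unfolding eps_diagonal[OF j0] by (auto elim: Lim_transform_eventually)
qed

end

section \<open>Pure flexural solutions\<close>

lemma norm_quadruple_le:
  fixes p :: "real \<times> real \<times> real \<times> real"
  shows "norm p \<le> \<bar>fst p\<bar> + (\<bar>fst (snd p)\<bar> + (\<bar>fst (snd (snd p))\<bar> + \<bar>snd (snd (snd p))\<bar>))"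
proof -
  obtain a b c d where p: "p = (a, b, c, d)" by (metis surj_pair)
  have "norm (b, c, d) \<le> \<bar>b\<bar> + norm (c, d)" "norm (c, d) \<le> \<bar>c\<bar> + \<bar>d\<bar>"
    "norm (a, b, c, d) \<le> \<bar>a\<bar> + norm (b, c, d)"
    using norm_Pair_le[of b "(c, d)"] norm_Pair_le[of c d] norm_Pair_le[of a "(b, c, d)"] by simp_all
  then show ?thesis by (simp add: p)
qed

lemma abs_component_le_norm:
  fixes p :: "real \<times> real \<times> real \<times> real"
  shows "\<bar>fst p\<bar> \<le> norm p" "\<bar>fst (snd p)\<bar> \<le> norm p"
    "\<bar>fst (snd (snd p))\<bar> \<le> norm p" "\<bar>snd (snd (snd p))\<bar> \<le> norm p"
proof -
  obtain a b c d where p: "p = (a, b, c, d)" by (metis surj_pair)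
  show "\<bar>fst p\<bar> \<le> norm p" "\<bar>fst (snd p)\<bar> \<le> norm p"
    "\<bar>fst (snd (snd p))\<bar> \<le> norm p" "\<bar>snd (snd (snd p))\<bar> \<le> norm p"
    using norm_fst_le[of a "(b, c, d)"] norm_snd_le[of "(b, c, d)" a] norm_fst_le[of b "(c, d)"]
      norm_snd_le[of "(c, d)" b] norm_fst_le[of c d] norm_snd_le[of d c] by (auto simp: p)
qed

context asymmetric_force
begin

lemma bridge_field_lipschitz:
  assumes "0 \<le> \<alpha>" "0 \<le> \<beta>" "0 \<le> \<gamma>"
  shows "norm (bridge_field f \<alpha> \<beta> \<gamma> j k p - bridge_field f \<alpha> \<beta> \<gamma> j k p')
    \<le> (2 + \<alpha> * real j ^ 4 + \<beta> * (real k)\<^sup>2 + 8 * slope_bound + \<gamma> * (8 * slope_bound)) * norm (p - p')"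
proof -
  obtain y v z w y' v' z' w' where p: "p = (y, v, z, w)" "p' = (y', v', z', w')"
    by (metis surj_pair)
  define n where "n = norm (p - p')"
  have comp: "\<bar>y - y'\<bar> \<le> n" "\<bar>v - v'\<bar> \<le> n" "\<bar>z - z'\<bar> \<le> n" "\<bar>w - w'\<bar> \<le> n"
    using abs_component_le_norm[of "p - p'"] by (simp_all add: n_def p)
  have psi: "\<bar>psi1 f j k y z - psi1 f j k y' z'\<bar> \<le> 8 * slope_bound * n"
    "\<bar>psi2 f j k y z - psi2 f j k y' z'\<bar> \<le> 8 * slope_bound * n"
  proof -
    have "4 * slope_bound * (\<bar>y - y'\<bar> + \<bar>z - z'\<bar>) \<le> 4 * slope_bound * (n + n)"
      using slope_bound(1) comp by (intro mult_left_mono add_mono) auto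
    also have "\<dots> = 8 * slope_bound * n" by simp
    finally show "\<bar>psi1 f j k y z - psi1 f j k y' z'\<bar> \<le> 8 * slope_bound * n"
      "\<bar>psi2 f j k y z - psi2 f j k y' z'\<bar> \<le> 8 * slope_bound * n"
      by (rule order_trans[OF psi_lipschitz(1)], rule order_trans[OF psi_lipschitz(2)])
  qed
  have 1: "\<bar>(\<alpha> * real j ^ 4 * y + psi1 f j k y z) - (\<alpha> * real j ^ 4 * y' + psi1 f j k y' z')\<bar>
      \<le> \<alpha> * real j ^ 4 * n + 8 * slope_bound * n"
  proof -
    have "\<bar>\<alpha> * real j ^ 4 * (y - y')\<bar> \<le> \<alpha> * real j ^ 4 * n"
      unfolding abs_mult[of "\<alpha> * real j ^ 4"] using assms comp by (intro mult_mono) auto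
    with psi(1) show ?thesis
      using abs_triangle_ineq[of "\<alpha> * real j ^ 4 * (y - y')" "psi1 f j k y z - psi1 f j k y' z'"]
      by (simp add: right_diff_distrib algebra_simps)
  qed
  have 2: "\<bar>(\<beta> * (real k)\<^sup>2 * z + \<gamma> * psi2 f j k y z) - (\<beta> * (real k)\<^sup>2 * z' + \<gamma> * psi2 f j k y' z')\<bar>
      \<le> \<beta> * (real k)\<^sup>2 * n + \<gamma> * (8 * slope_bound * n)"
  proof -
    have "\<bar>\<beta> * (real k)\<^sup>2 * (z - z')\<bar> \<le> \<beta> * (real k)\<^sup>2 * n"
      unfolding abs_mult[of "\<beta> * (real k)\<^sup>2"] using assms comp by (intro mult_mono) auto
    moreover have "\<bar>\<gamma> * (psi2 f j k y z - psi2 f j k y' z')\<bar> \<le> \<gamma> * (8 * slope_bound * n)"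
      unfolding abs_mult using assms psi by (intro mult_mono) auto
    ultimately show ?thesis
      using abs_triangle_ineq[of "\<beta> * (real k)\<^sup>2 * (z - z')" "\<gamma> * (psi2 f j k y z - psi2 f j k y' z')"]
      by (simp add: right_diff_distrib algebra_simps)
  qed
  have "norm (bridge_field f \<alpha> \<beta> \<gamma> j k p - bridge_field f \<alpha> \<beta> \<gamma> j k p')
    \<le> \<bar>v - v'\<bar> + (\<bar>(\<alpha> * real j ^ 4 * y + psi1 f j k y z) - (\<alpha> * real j ^ 4 * y' + psi1 f j k y' z')\<bar>
      + (\<bar>w - w'\<bar> + \<bar>(\<beta> * (real k)\<^sup>2 * z + \<gamma> * psi2 f j k y z) - (\<beta> * (real k)\<^sup>2 * z' + \<gamma> * psi2 f j k y' z')\<bar>))"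
    using norm_quadruple_le[of "bridge_field f \<alpha> \<beta> \<gamma> j k p - bridge_field f \<alpha> \<beta> \<gamma> j k p'"]
    by (simp add: bridge_field_def p abs_minus_commute)
  also have "\<dots> \<le> n + ((\<alpha> * real j ^ 4 * n + 8 * slope_bound * n)
      + (n + (\<beta> * (real k)\<^sup>2 * n + \<gamma> * (8 * slope_bound * n))))"
    using 1 2 comp by (intro add_mono)
  also have "\<dots> = (2 + \<alpha> * real j ^ 4 + \<beta> * (real k)\<^sup>2 + 8 * slope_bound + \<gamma> * (8 * slope_bound)) * n"
    by (simp add: algebra_simps)
  finally show ?thesis by (simp add: n_def)
qed

lemma flexural_force_lipschitz:
  assumes "0 \<le> \<alpha>"
  shows "\<bar>(\<alpha> * real j ^ 4 * y + psi1 f j k y 0) - (\<alpha> * real j ^ 4 * y' + psi1 f j k y' 0)\<bar>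
    \<le> (\<alpha> * real j ^ 4 + 4 * slope_bound) * \<bar>y - y'\<bar>"
proof -
  have "\<bar>\<alpha> * real j ^ 4 * (y - y')\<bar> = \<alpha> * real j ^ 4 * \<bar>y - y'\<bar>"
    using assms by (simp add: abs_mult)
  moreover have "\<bar>psi1 f j k y 0 - psi1 f j k y' 0\<bar> \<le> 4 * slope_bound * \<bar>y - y'\<bar>"
    using psi_lipschitz(1)[of j k y 0 y' 0] by simp
  moreover have "(\<alpha> * real j ^ 4 * y + psi1 f j k y 0) - (\<alpha> * real j ^ 4 * y' + psi1 f j k y' 0)
      = \<alpha> * real j ^ 4 * (y - y') + (psi1 f j k y 0 - psi1 f j k y' 0)"
    by (simp add: algebra_simps)
  ultimately show ?thesis
    using abs_triangle_ineq[of "\<alpha> * real j ^ 4 * (y - y')" "psi1 f j k y 0 - psi1 f j k y' 0"]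
    unfolding distrib_right by linarith
qed

text \<open>
  The definite description of the flexural solution denotes the first component of the oscillator
  solution, by uniqueness for the Lipschitz initial value problem.
\<close>

lemma flexural_eq:
  assumes "0 \<le> \<alpha>" and \<xi>: "solves (\<lambda>_. osc (\<lambda>y. \<alpha> * real j ^ 4 * y + psi1 f j k y 0)) \<xi>" "\<xi> 0 = (q, 0)"
  shows "flexural f \<alpha> j k q = (\<lambda>t. fst (\<xi> t))" and "deriv (\<lambda>t. fst (\<xi> t)) = (\<lambda>t. snd (\<xi> t))"
proof -
  let ?h = "\<lambda>y. \<alpha> * real j ^ 4 * y + psi1 f j k y 0"
  have L: "0 \<le> \<alpha> * real j ^ 4 + 4 * slope_bound" using assms(1) slope_bound(1) by simp
  have d: "deriv (\<lambda>t. fst (\<xi> t)) = (\<lambda>t. snd (\<xi> t))"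
    by (rule ext) (rule DERIV_imp_deriv[OF osc_components(1)[OF \<xi>(1)]])
  then show "deriv (\<lambda>t. fst (\<xi> t)) = (\<lambda>t. snd (\<xi> t))" .
  show "flexural f \<alpha> j k q = (\<lambda>t. fst (\<xi> t))"
    unfolding flexural_def
  proof (rule the_equality)
    show "flexural_ivp f \<alpha> j k q (\<lambda>t. fst (\<xi> t))"
      unfolding flexural_ivp_def d
      using osc_components[OF \<xi>(1)] \<xi>(2) by (auto simp: real_differentiable_def)
    fix u assume u: "flexural_ivp f \<alpha> j k q u"
    have u_solves: "solves (\<lambda>_. osc ?h) (\<lambda>t. (u t, deriv u t))"
      using u by (intro osc_solvesI) (auto simp: flexural_ivp_def DERIV_deriv_iff_real_differentiable)
    have u_start: "(u 0, deriv u 0) = \<xi> 0" using u \<xi>(2) by (simp add: flexural_ivp_def)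
    have "(u t, deriv u t) = \<xi> t" for t
      by (rule solution_unique[OF _ osc_lipschitz[OF L flexural_force_lipschitz[OF assms(1)]]
            u_solves \<xi>(1) u_start]) (use L in simp)
    then show "u = (\<lambda>t. fst (\<xi> t))" by (metis fst_conv)
  qed
qed

end

theorem theorem1:
  fixes f :: "real \<Rightarrow> real" and R :: "real set"
    and \<alpha> \<beta> \<gamma> M :: real and j k :: nat
  assumes f_cont: "continuous_on UNIV f"
    and f_mono: "strict_mono f"
    and f_zero: "f 0 = 0"
    and R_finite: "finite R"
    and R_zero: "0 \<notin> R"
    and f_diff: "\<And>r. r \<notin> R \<Longrightarrow> f differentiable (at r)"
    and f_C1: "continuous_on (- R) (deriv f)"
    and f_left: "\<And>r. r \<in> R \<Longrightarrow> \<exists>l. (deriv f \<longlongrightarrow> l) (at_left r)"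
    and f_right: "\<And>r. r \<in> R \<Longrightarrow> \<exists>l. (deriv f \<longlongrightarrow> l) (at_right r)"
    and f_deriv0: "deriv f 0 > 0"
    and f_minus: "(deriv f \<longlongrightarrow> 0) at_bot"
    and f_plus: "(deriv f \<longlongrightarrow> M) at_top"
    and M_pos: "M > 0"
    and params: "\<alpha> > 0" "\<beta> > 0" "\<gamma> > 0"
    and jk: "j > 0" "odd j" "k > 0"
    and unstable_cond:
      "\<bar>cos (phase \<alpha> \<beta> \<gamma> M j k 1) * cos (phase \<alpha> \<beta> \<gamma> M j k (-1))
        - (amp_ratio \<beta> \<gamma> M j k + inverse (amp_ratio \<beta> \<gamma> M j k)) / 2
          * sin (phase \<alpha> \<beta> \<gamma> M j k 1) * sin (phase \<alpha> \<beta> \<gamma> M j k (-1))\<bar> > 1"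
  shows "\<exists>q0. \<forall>q>q0. q > 0 \<longrightarrow>
    unstable_periodic_solution (bridge_field f \<alpha> \<beta> \<gamma> j k) (pure_flexural f \<alpha> j k q)"
proof -
  interpret asymmetric_force f R M
    using assms by unfold_locales
  define h where "h y = \<alpha> * real j ^ 4 * y + psi1 f j k y 0" for y
  define H where "H y z = \<alpha> * real j ^ 4 * y + psi1 f j k y z" for y z
  define Q where "Q y z = \<beta> * (real k)\<^sup>2 + \<gamma> * stiffness j k y z" for y z
  define \<omega>p where "\<omega>p = freq_y \<alpha> M j 1"
  define \<omega>m where "\<omega>m = freq_y \<alpha> M j (- 1)"
  define Ap where "Ap = freq_z \<beta> \<gamma> M j k 1"
  define Am where "Am = freq_z \<beta> \<gamma> M j k (- 1)"
  define s where "s = - (pi / (2 * \<omega>p))"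
  have j1: "1 \<le> real j" using jk(1) by simp
  have eps: "- 1 \<le> eps j k" "eps j k \<le> 1" using eps_range[OF jk(2,3)] by auto
  have "0 < \<alpha> * real j ^ 4 + M * (1 + 1 / real j)" "0 < \<alpha> * real j ^ 4 + M * (1 - 1 / real j)"
    using params jk j1 M_pos by (auto intro!: add_pos_nonneg mult_nonneg_nonneg)
  then have \<omega>: "0 < \<omega>p" "0 < \<omega>m" "\<omega>p\<^sup>2 = \<alpha> * real j ^ 4 + M * (1 + 1 / real j)"
    "\<omega>m\<^sup>2 = \<alpha> * real j ^ 4 + M * (1 - 1 / real j)"
    by (simp_all add: \<omega>p_def \<omega>m_def freq_y_def)
  have "0 < \<beta> * (real k)\<^sup>2 + \<gamma> * M * (1 + eps j k)" "0 < \<beta> * (real k)\<^sup>2 + \<gamma> * M * (1 - eps j k)"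
    using params jk M_pos eps by (auto intro!: add_pos_nonneg mult_nonneg_nonneg)
  then have A: "0 < Ap" "0 < Am" "Ap\<^sup>2 = \<beta> * (real k)\<^sup>2 + \<gamma> * M * (1 + eps j k)"
    "Am\<^sup>2 = \<beta> * (real k)\<^sup>2 + \<gamma> * M * (1 - eps j k)"
    by (simp_all add: Ap_def Am_def freq_z_def)
  define \<tau>0 where "\<tau>0 = 2 * (cos (Ap / \<omega>p * pi) * cos (Am / \<omega>m * pi)
      - (Ap / Am + Am / Ap) / 2 * sin (Ap / \<omega>p * pi) * sin (Am / \<omega>m * pi))"
  have "\<tau>0 / 2 = cos (Ap / \<omega>p * pi) * cos (Am / \<omega>m * pi)
      - (Ap / Am + Am / Ap) / 2 * sin (Ap / \<omega>p * pi) * sin (Am / \<omega>m * pi)"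
    unfolding \<tau>0_def by (rule nonzero_mult_div_cancel_left) simp
  then have "1 < \<bar>\<tau>0 / 2\<bar>"
    using unstable_cond
    by (simp only:) (simp add: phase_def amp_ratio_def Ap_def Am_def \<omega>p_def \<omega>m_def)
  then have \<tau>0: "2 < \<bar>\<tau>0\<bar>" by simp
  have L: "0 \<le> \<alpha> * real j ^ 4 + 4 * slope_bound" using params slope_bound(1) by simp
  have h_lip: "\<bar>h x - h y\<bar> \<le> (\<alpha> * real j ^ 4 + 4 * slope_bound) * \<bar>x - y\<bar>" for x y
    unfolding h_def using params by (intro flexural_force_lipschitz) auto
  have h0: "h 0 = 0" by (simp add: h_def psi1_def f_zero)
  have h_quot: "h y / y = \<alpha> * real j ^ 4 + psi1 f j k y 0 / y" if "y \<noteq> 0" for y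
    using that by (simp add: h_def add_divide_distrib)
  have h_top: "((\<lambda>y. h y / y) \<longlongrightarrow> \<omega>p\<^sup>2) at_top"
    unfolding \<omega>(3)
    by (rule Lim_transform_eventually[OF tendsto_add[OF tendsto_const psi1_quotient_limits(1)[OF jk(2), of k]]])
      (rule eventually_mono[OF eventually_gt_at_top[of 0]], simp add: h_quot)
  have h_bot: "((\<lambda>y. h y / y) \<longlongrightarrow> \<omega>m\<^sup>2) at_bot"
    unfolding \<omega>(4)
    by (rule Lim_transform_eventually[OF tendsto_add[OF tendsto_const psi1_quotient_limits(2)[OF jk(2), of k]]])
      (rule eventually_mono[OF eventually_gt_at_bot[of 0]], simp add: h_quot)
  have Q_cont: "continuous_on UNIV (\<lambda>(y, z). Q y z)"
    using stiffness_continuous[OF jk(1), of k] unfolding Q_def split_def by (intro continuous_intros)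
  have P_cont: "continuous_on UNIV (\<lambda>y. Q y 0)"
    using continuous_on_compose2[OF Q_cont, of UNIV "\<lambda>y. (y, 0)"] by (simp add: continuous_intros)
  have Q_bound: "\<bar>Q y z\<bar> \<le> \<beta> * (real k)\<^sup>2 + \<gamma> * (4 * slope_bound)" for y z
  proof -
    have "\<bar>Q y z\<bar> \<le> \<bar>\<beta> * (real k)\<^sup>2\<bar> + \<bar>\<gamma> * stiffness j k y z\<bar>" unfolding Q_def by (rule abs_triangle_ineq)
    also have "\<dots> \<le> \<beta> * (real k)\<^sup>2 + \<gamma> * (4 * slope_bound)"
      using params stiffness_bounded[of j k y z] by (simp add: abs_mult)
    finally show ?thesis .
  qed
  have P_top: "((\<lambda>y. Q y 0) \<longlongrightarrow> Ap\<^sup>2) at_top" and P_bot: "((\<lambda>y. Q y 0) \<longlongrightarrow> Am\<^sup>2) at_bot"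
    unfolding A Q_def mult.assoc[of \<gamma>] by (intro tendsto_intros stiffness_limits jk)+
  have "\<exists>\<xi>. solves (\<lambda>_. osc h) \<xi> \<and> \<xi> 0 = (q, 0)" for q
    using osc_ivp[OF L h_lip] by metis
  then obtain \<xi> where \<xi>: "solves (\<lambda>_. osc h) (\<xi> q)" "\<xi> q 0 = (q, 0)" for q by metis
  have P_orbit: "continuous_on UNIV (\<lambda>t. Q (fst (\<xi> q t)) 0)" for q
    by (rule continuous_on_compose2[OF P_cont continuous_on_fst[OF solves_continuous[OF \<xi>(1)]]]) auto
  define Z where "Z z q = (SOME \<zeta>. solves (hill (\<lambda>t. Q (fst (\<xi> q t)) 0)) \<zeta> \<and> \<zeta> s = z)" for z q
  have Z: "solves (hill (\<lambda>t. Q (fst (\<xi> q t)) 0)) (Z z q)" "Z z q s = z" for q z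
  proof -
    have "\<exists>\<zeta>. solves (hill (\<lambda>t. Q (fst (\<xi> q t)) 0)) \<zeta> \<and> \<zeta> s = z"
      by (rule hill_ivp[OF P_orbit[of q] Q_bound, of s z]) blast
    from someI_ex[OF this] show "solves (hill (\<lambda>t. Q (fst (\<xi> q t)) 0)) (Z z q)" "Z z q s = z"
      unfolding Z_def by (rule conjunct1, rule conjunct2)
  qed
  have "\<forall>\<^sub>F q in at_top. \<exists>T>0. (\<forall>t. \<xi> q (t + T) = \<xi> q t) \<and>
      \<bar>fst (Z (1, 0) q (s + T)) + snd (Z (0, 1) q (s + T)) - \<tau>0\<bar> < \<bar>\<tau>0\<bar> - 2"
    unfolding s_def \<tau>0_def
    by (rule large_amplitude_hill_trace[OF \<omega>(1,2) A(1,2) L h_lip h0 h_top h_bot P_cont Q_bound P_top P_bot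
        \<xi> Z(1) Z(2)[unfolded s_def] Z(1) Z(2)[unfolded s_def]])
      (use \<tau>0 in \<open>simp add: \<tau>0_def\<close>)
  then obtain q0 where q0: "\<And>q. q0 \<le> q \<Longrightarrow> \<exists>T>0. (\<forall>t. \<xi> q (t + T) = \<xi> q t) \<and>
      \<bar>fst (Z (1, 0) q (s + T)) + snd (Z (0, 1) q (s + T)) - \<tau>0\<bar> < \<bar>\<tau>0\<bar> - 2"
    unfolding eventually_at_top_linorder by blast
  have field: "bridge_field f \<alpha> \<beta> \<gamma> j k = second_order_pair H Q"
    by (auto simp: fun_eq_iff bridge_field_def second_order_pair_def H_def Q_def psi2_eq_stiffness algebra_simps)
  define X where "X q t = (fst (\<xi> q t), snd (\<xi> q t), 0::real, 0::real)" for q t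
  have X_flexural: "pure_flexural f \<alpha> j k q = X q" for q
    by (rule ext) (simp only: pure_flexural_def X_def
      flexural_eq[OF less_imp_le[OF params(1)] \<xi>[unfolded h_def[abs_def]]])
  have X_solves: "ode_solution (second_order_pair H Q) (X q)" for q
    unfolding ode_solution_def
  proof
    fix t
    note d = osc_components[OF \<xi>(1)[of q], unfolded has_real_derivative_iff_has_vector_derivative]
    have "(X q has_vector_derivative (snd (\<xi> q t), - h (fst (\<xi> q t)), 0, 0)) (at t)"
      unfolding X_def by (intro has_vector_derivative_Pair d has_vector_derivative_const)
    then show "(X q has_vector_derivative second_order_pair H Q (X q t)) (at t)"
      by (simp add: X_def second_order_pair_def H_def h_def)
  qed
  show ?thesis
  proof (intro exI allI impI)
    fix q assume "q0 < q"
    then obtain T where T: "0 < T" "\<And>t. \<xi> q (t + T) = \<xi> q t"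
      and tr: "\<bar>fst (Z (1, 0) q (s + T)) + snd (Z (0, 1) q (s + T)) - \<tau>0\<bar> < \<bar>\<tau>0\<bar> - 2"
      using q0[of q] by auto
    show "unstable_periodic_solution (bridge_field f \<alpha> \<beta> \<gamma> j k) (pure_flexural f \<alpha> j k q)"
      unfolding X_flexural field
    proof (rule unstable_of_hyperbolic_hill[OF _ _ Q_cont Q_bound X_solves _ T(1)])
      show "norm (second_order_pair H Q p - second_order_pair H Q p')
        \<le> (2 + \<alpha> * real j ^ 4 + \<beta> * (real k)\<^sup>2 + 8 * slope_bound + \<gamma> * (8 * slope_bound)) * norm (p - p')" for p p'
        using bridge_field_lipschitz[of \<alpha> \<beta> \<gamma> j k p p'] params unfolding field by simp
      show "0 \<le> 2 + \<alpha> * real j ^ 4 + \<beta> * (real k)\<^sup>2 + 8 * slope_bound + \<gamma> * (8 * slope_bound)"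
        using params slope_bound(1) by simp
      show "transverse (X q t) = 0" for t by (simp add: transverse_def X_def zero_prod_def)
      show "X q (t + T) = X q t" for t by (simp add: X_def T)
      show "solves (hill (\<lambda>t. Q (fst (X q t)) 0)) (Z (1, 0) q)" "solves (hill (\<lambda>t. Q (fst (X q t)) 0)) (Z (0, 1) q)"
        using Z(1) by (simp_all add: X_def)
      show "Z (1, 0) q s = (1, 0)" "Z (0, 1) q s = (0, 1)" by (rule Z(2))+
      show "2 < \<bar>fst (Z (1, 0) q (s + T)) + snd (Z (0, 1) q (s + T))\<bar>"
        using tr by linarith
    qed
  qed
qed

end
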